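(* For any finitely generated multiplicative system $(X,\mu,S)$ and any $F\in L^2(X)$, the limit $$\lim_{N\to\infty}\frac1N\sum_{n=1}^N S_nF$$ exists in $L^2(X)$.
   Context: $\mathbb{N}=\{1,2,\dots\}$. Every probability space $(X,\mu)$ is assumed regular: $X$ is a compact metric space with its Borel $\sigma$-algebra. A multiplicative system $(X,\mu,S)$ consists of a probability space $(X,\mu)$ and a sequence $S=(S_n)_{n\in\mathbb{N}}$ of commuting invertible measure-preserving transformations of $(X,\mu)$ with $S_{nm}=S_n\circ S_m$ for all $n,m\in\mathbb{N}$. It is finitely generated if $\{S_p:p\text{ prime}\}$ is finite. For $F\in L^2(X)$, $S_nF=F\circ S_n$. *)

theory Defs
  imports "HOL-Probability.Probability" "HOL-Computational_Algebra.Primes"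
begin

(* Invertible in the strict sense: a bijection of the whole space, not merely up
   to null sets, with measurable inverse the_inv_into (space M) T. *)
definition invertible_measure_preserving :: "'a measure \<Rightarrow> ('a \<Rightarrow> 'a) \<Rightarrow> bool" where
  "invertible_measure_preserving M T \<longleftrightarrow>
     bij_betw T (space M) (space M) \<and>
     T \<in> measurable M M \<and>
     the_inv_into (space M) T \<in> measurable M M \<and>
     distr M M T = M"

(* The compact metric space X is space M, with the metric of the ambient type.
   S is indexed by the positive integers; S 0 is unconstrained and never used. *)
locale multiplicative_system = prob_space M
  for M :: "'a::metric_space measure" and S :: "nat \<Rightarrow> 'a \<Rightarrow> 'a" +
  assumes compact_space: "compact (space M)"
    and sets_borel: "sets M = sets (restrict_space borel (space M))"
    and invertible: "\<And>n. n \<ge> 1 \<Longrightarrow> invertible_measure_preserving M (S n)"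
    and commuting: "\<And>n m x. n \<ge> 1 \<Longrightarrow> m \<ge> 1 \<Longrightarrow> x \<in> space M \<Longrightarrow> S n (S m x) = S m (S n x)"
    and multiplicative: "\<And>n m x. n \<ge> 1 \<Longrightarrow> m \<ge> 1 \<Longrightarrow> x \<in> space M \<Longrightarrow> S (n * m) x = S n (S m x)"

(* The restriction discards the values of S p outside space M, which are not
   part of the transformation. *)
definition finitely_generated :: "'a measure \<Rightarrow> (nat \<Rightarrow> 'a \<Rightarrow> 'a) \<Rightarrow> bool" where
  "finitely_generated M S \<longleftrightarrow> finite ((\<lambda>p. restrict (S p) (space M)) ` {p. prime p})"

(* Square-integrable functions, not quotiented by almost-everywhere equality. *)
definition L2_space :: "'a measure \<Rightarrow> ('a \<Rightarrow> complex) set" where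
  "L2_space M = {F. F \<in> borel_measurable M \<and> integrable M (\<lambda>x. (cmod (F x))\<^sup>2)}"

definition L2_norm :: "'a measure \<Rightarrow> ('a \<Rightarrow> complex) \<Rightarrow> real" where
  "L2_norm M F = sqrt (\<integral>x. (cmod (F x))\<^sup>2 \<partial>M)"

definition ergodic_average :: "(nat \<Rightarrow> 'a \<Rightarrow> 'a) \<Rightarrow> ('a \<Rightarrow> complex) \<Rightarrow> nat \<Rightarrow> 'a \<Rightarrow> complex" where
  "ergodic_average S F N x = (1 / of_nat N) * (\<Sum>n = 1..N. (F \<circ> S n) x)"

end

theory Submission
  imports Defs "HOL-Number_Theory.Number_Theory" "HOL-Complex_Analysis.Complex_Analysis" "HOL-Real_Asymp.Real_Asymp"
begin

text \<open>
  Write \<open>A N F\<close> for the averages. The primes fall into finitely many classes, according to the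
  transformation \<open>S p\<close>; a class is large if the sum of the reciprocals of its primes diverges.

  If \<open>p\<close> lies in a large class, then \<open>A N (F - F \<circ> S p)\<close> tends to \<open>0\<close>. By transference (Parseval along
  boxes of exponents in an orbit) its norm is at most \<open>norm F\<close> times the supremum of
  \<open>cmod (1 - f p) * cmod (\<Sum>n\<le>N. f n) / N\<close> over the completely multiplicative unimodular \<open>f\<close> that
  are constant on the classes, and this supremum tends to \<open>0\<close> by a uniform version of Halasz's theorem:
  such an \<open>f\<close> with \<open>f p\<close> away from \<open>1\<close> cannot pretend to be \<open>n\<^sup>i\<^sup>y\<close>, since for \<open>y \<noteq> 0\<close> a bounded power
  of \<open>f\<close> is close to \<open>1\<close> on all primes while \<open>\<zeta> (1 + \<sigma> + i m y)\<close> is much smaller than \<open>\<zeta> (1 + \<sigma>)\<close>.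

  The element \<open>G\<close> of minimal norm in the closed convex hull of the orbit of \<open>F\<close> under the large classes
  is invariant under them, and \<open>A N F - A N G\<close> tends to \<open>0\<close>. On \<open>G\<close> only the small classes act; these
  involve few primes, so that \<open>G \<circ> S n\<close> depends, for most \<open>n\<close>, only on \<open>gcd n m\<close> for a fixed \<open>m\<close>, and
  \<open>A N G\<close> is a Cauchy sequence.
\<close>

subsection \<open>Averaging over short windows with Chebyshev's bound\<close>

text \<open>The obstacle is uniformity: Parseval needs a supremum over the whole torus of values of
  \<open>f\<close> on the classes, and convergence for each single \<open>f\<close> does not control
  it. So the finite set of test primes, the bound on the power of \<open>f\<close> and the range of
  \<sigma> are fixed before \<open>f\<close> is. The factor \<open>1 - f p\<close> makes this
  possible: where \<open>f p\<close> is near 1 and cancellation may fail, the factor itself is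
  small; elsewhere the divergent reciprocal sum over the class of \<open>p\<close> separates
  \<open>f\<close> from the constant 1 by an amount independent of \<open>f\<close>. Halasz's
  theorem is proved through the Dirichlet series F of \<open>f\<close>. A factor \<open>ln n\<close>
  in the sum replaces F by its derivative, written as F times F'/F: the first factor is small
  pointwise at bounded ordinates, the second has a mean square controlled by Plancherel and
  Chebyshev's bound. The weight 1/(b^2 + y^2) is chosen for its explicit positive Fourier transform:
  at b = Re s it produces squares of partial sums, and at b = T it yields the saving 1/T for
  ordinates beyond T, where F is bounded trivially.\<close>

definition unimodular_mult :: "(nat \<Rightarrow> complex) \<Rightarrow> bool" where
  "unimodular_mult f \<longleftrightarrow> f 1 = 1 \<and> (\<forall>m>0. \<forall>n>0. f (m * n) = f m * f n) \<and> (\<forall>n>0. cmod (f n) = 1)"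

definition partial_sum :: "(nat \<Rightarrow> complex) \<Rightarrow> nat \<Rightarrow> complex" where
  "partial_sum f n = (\<Sum>k=1..n. f k)"

definition log_partial_sum :: "(nat \<Rightarrow> complex) \<Rightarrow> nat \<Rightarrow> complex" where
  "log_partial_sum f n = (\<Sum>k=1..n. f k * ln (real k))"

definition cheb_psi :: "nat \<Rightarrow> real" where
  "cheb_psi n = (\<Sum>d=1..n. mangoldt d)"

text \<open>Both sides run over the pairs \<open>(d, m)\<close> with \<open>d * m \<le> n\<close>.
  The general \<open>g\<close> serves the factorial identity as well as its twist by
  \<open>f\<close>.\<close>

lemma sum_divisors_swap:
  fixes g :: "nat \<Rightarrow> nat \<Rightarrow> 'a::comm_monoid_add"
  shows "(\<Sum>k=1..n. \<Sum>d | d dvd k. g d (k div d)) = (\<Sum>d=1..n. \<Sum>m=1..n div d. g d m)"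
proof -
  have "(\<Sum>k=1..n. \<Sum>d | d dvd k. g d (k div d)) =
        (\<Sum>(k, d)\<in>Sigma {1..n} (\<lambda>k. {d. d dvd k}). g d (k div d))"
    by (intro sum.Sigma) auto
  also have "\<dots> = (\<Sum>(d, m)\<in>Sigma {1..n} (\<lambda>d. {1..n div d}). g d m)"
  proof (rule sum.reindex_bij_witness[where i = "\<lambda>(d, m). (d * m, d)" and j = "\<lambda>(k, d). (d, k div d)"])
    fix a assume "a \<in> Sigma {1..n} (\<lambda>k. {d. d dvd k})"
    then obtain k d where a: "a = (k, d)" "1 \<le> k" "k \<le> n" "d dvd k" by auto
    then obtain m where m: "k = d * m" by (elim dvdE)
    with a have "d > 0" "m > 0" by (auto intro: Nat.gr0I)
    with a m show "(case case a of (k, d) \<Rightarrow> (d, k div d) of (d, m) \<Rightarrow> (d * m, d)) = a"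
      and "(case a of (k, d) \<Rightarrow> (d, k div d)) \<in> Sigma {1..n} (\<lambda>d. {1..n div d})"
      by (auto simp: less_eq_div_iff_mult_less_eq mult.commute dest: dvd_imp_le intro: order_trans[rotated])
  next
    fix b assume "b \<in> Sigma {1..n} (\<lambda>d. {1..n div d})"
    then obtain d m where "b = (d, m)" "1 \<le> d" "d \<le> n" "1 \<le> m" "m \<le> n div d" by auto
    then show "(case case b of (d, m) \<Rightarrow> (d * m, d) of (k, d) \<Rightarrow> (d, k div d)) = b"
      and "(case b of (d, m) \<Rightarrow> (d * m, d)) \<in> Sigma {1..n} (\<lambda>k. {d. d dvd k})"
      by (auto simp: less_eq_div_iff_mult_less_eq mult.commute)
  qed auto
  also have "\<dots> = (\<Sum>d=1..n. \<Sum>m=1..n div d. g d m)"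
    by (intro sum.Sigma[symmetric]) auto
  finally show ?thesis .
qed

lemma ln_fact_sum: "ln (fact n) = (\<Sum>k=1..n. ln (real k))"
  unfolding fact_prod of_nat_prod by (subst ln_prod) auto

lemma sum_mangoldt_div: "(\<Sum>d=1..n. mangoldt d * real (n div d)) = ln (fact n)"
proof -
  have "(\<Sum>d=1..n. mangoldt d * real (n div d)) = (\<Sum>d=1..n. \<Sum>m=1..n div d. mangoldt d)"
    by (simp add: mult.commute)
  also have "\<dots> = (\<Sum>k=1..n. \<Sum>d | d dvd k. mangoldt d)"
    by (rule sum_divisors_swap[symmetric])
  also have "\<dots> = (\<Sum>k=1..n. ln (real k))"
    by (intro sum.cong refl) (subst mangoldt_sum, auto)
  finally show ?thesis by (simp add: ln_fact_sum)
qed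

text \<open>Chebyshev's argument: \<open>2 * n div d - 2 * (n div d)\<close> is nonnegative for
  every \<open>d\<close> and equals 1 for n < d \<le> 2n, so the weights of that range are bounded
  by the logarithm of the central binomial coefficient.\<close>

lemma cheb_psi_double: "cheb_psi (2 * n) - cheb_psi n \<le> 2 * real n * ln 2"
proof -
  have *: "(\<Sum>d=1..2*n. mangoldt d * real (n div d)) = ln (fact n)"
  proof -
    have "(\<Sum>d=1..2*n. mangoldt d * real (n div d)) = (\<Sum>d=1..n. mangoldt d * real (n div d))"
      by (intro sum.mono_neutral_right) auto
    then show ?thesis using sum_mangoldt_div by simp
  qed
  have "cheb_psi (2 * n) - cheb_psi n = (\<Sum>d\<in>{n+1..2*n}. mangoldt d)"
  proof -
    have "{1..2*n} = {1..n} \<union> {n+1..2*n}" by auto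
    then have "cheb_psi (2*n) = cheb_psi n + (\<Sum>d\<in>{n+1..2*n}. mangoldt d)"
      unfolding cheb_psi_def by (simp only:) (intro sum.union_disjoint, auto)
    then show ?thesis by simp
  qed
  also have "\<dots> = (\<Sum>d\<in>{n+1..2*n}. mangoldt d * (real (2*n div d) - 2 * real (n div d)))"
  proof (intro sum.cong refl)
    fix d assume "d \<in> {n+1..2*n}"
    then have "2 * n div d = 1" "n div d = 0" by (auto intro: div_nat_eqI)
    then show "mangoldt d = mangoldt d * (real (2*n div d) - 2 * real (n div d))" by simp
  qed
  also have "\<dots> \<le> (\<Sum>d=1..2*n. mangoldt d * (real (2*n div d) - 2 * real (n div d)))"
  proof (intro sum_mono2)
    fix d assume "d \<in> {1..2*n} - {n+1..2*n}"
    then have "2 * (n div d) \<le> 2 * n div d" by (auto simp: less_eq_div_iff_mult_less_eq)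
    then have "0 \<le> real (2*n div d) - 2 * real (n div d)" by linarith
    then show "0 \<le> mangoldt d * (real (2*n div d) - 2 * real (n div d))" 
      by (intro mult_nonneg_nonneg mangoldt_nonneg)
  qed auto
  also have "\<dots> = ln (fact (2*n)) - 2 * ln (fact n)"
    unfolding *[symmetric] sum_mangoldt_div[symmetric, of "2 * n"]
    by (simp add: right_diff_distrib sum_subtractf sum_distrib_left mult_ac)
  also have "\<dots> = ln (real ((2*n) choose n))"
    by (subst binomial_fact) (auto simp: ln_div ln_mult)
  also have "\<dots> \<le> ln (real (2 ^ (2*n)))"
    by (intro ln_mono) (use binomial_le_pow2[of "2*n" n] in \<open>auto simp flip: of_nat_le_iff\<close>)
  also have "\<dots> = 2 * real n * ln 2"
    by (simp add: ln_realpow)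
  finally show ?thesis .
qed

lemma cheb_psi_Suc: "cheb_psi (Suc n) = cheb_psi n + mangoldt (Suc n)"
  by (simp add: cheb_psi_def)

text \<open>Dyadic induction: starting from \<open>4 * m\<close> at \<open>m\<close>, doubling adds
  \<open>2 * m\<close> and an odd last term adds at most ln (2m + 1) \<le> 2m, which makes
  \<open>8 * m\<close> altogether.\<close>

lemma cheb_psi_le: "cheb_psi n \<le> 4 * real n"
proof (induction n rule: less_induct)
  case (less n)
  have double: "cheb_psi (2 * m) - cheb_psi m \<le> 2 * real m" for m
  proof -
    have "2 * real m * ln 2 \<le> 2 * real m * 1"
      using ln_2_less_1 by (intro mult_left_mono) auto
    then show ?thesis using cheb_psi_double[of m] by linarith
  qed
  consider "n = 0" | "n = 1" | m where "m > 0" "n = 2 * m" | m where "m > 0" "n = Suc (2 * m)"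
    by (metis One_nat_def Suc_1 gr0I mult_0_right oddE evenE Suc_eq_plus1)
  then show ?case
  proof cases
    case (3 m)
    then have "cheb_psi m \<le> 4 * real m" by (intro less.IH) auto
    then show ?thesis using double[of m] 3 by simp
  next
    case (4 m)
    then have "cheb_psi m \<le> 4 * real m" by (intro less.IH) auto
    moreover have "mangoldt (Suc (2 * m)) \<le> ln (real (Suc (2*m)))"
      by (intro mangoldt_le) auto
    moreover have "ln (real (Suc (2*m))) \<le> 2 * real m"
      using ln_add_one_self_le_self[of "2 * real m"] by (simp add: add.commute)
    ultimately show ?thesis using double[of m] 4 by (simp add: cheb_psi_Suc)
  qed (auto simp: cheb_psi_def)
qed

lemma sum_ln_quotient_le: "(\<Sum>n=1..k. ln (real k) - ln (real n)) \<le> real k"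
proof (cases "k = 0")
  case False
  \<comment> \<open>This quotient is a single term of the series of \<open>exp (real k)\<close>;
    that is the lower bound for \<open>ln (fact k)\<close> the sum asks for.\<close>
  have "(real k) ^ k / fact k \<le> exp (real k)"
    using sum_le_suminf[OF summable_exp[of "real k"], of "{k}"]
    by (simp add: exp_def scaleR_conv_of_real field_simps)
  then have "ln ((real k) ^ k / fact k) \<le> real k"
    using False by (metis divide_pos_pos fact_gt_zero ln_exp ln_mono of_nat_0_less_iff gr0I zero_less_power)
  then show ?thesis
    using False by (simp add: sum_subtractf ln_fact_sum ln_div ln_realpow)
qed auto

text \<open>The passage between sums with and without logarithm, that is between F and F'. The cost
  \<open>k\<close> is negligible against k ln k.\<close>

lemma log_partial_sum_approx:
  assumes "unimodular_mult f"
  shows "cmod (log_partial_sum f k - partial_sum f k * ln (real k)) \<le> real k"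
proof -
  have "log_partial_sum f k - partial_sum f k * ln (real k) = (\<Sum>n=1..k. f n * (ln (real n) - ln (real k)))"
    by (simp add: log_partial_sum_def partial_sum_def sum_distrib_right sum_distrib_left sum_subtractf algebra_simps)
  also have "cmod \<dots> \<le> (\<Sum>n=1..k. ln (real k) - ln (real n))"
  proof (rule sum_norm_le)
    fix n assume n: "n \<in> {1..k}"
    have "cmod (f n * (ln (real n) - ln (real k))) = \<bar>ln (real n) - ln (real k)\<bar>"
      using assms n by (simp add: unimodular_mult_def norm_mult del: of_real_diff flip: of_real_diff)
    then show "cmod (f n * (ln (real n) - ln (real k))) \<le> ln (real k) - ln (real n)"
      using n by (simp add: ln_mono)
  qed
  also have "\<dots> \<le> real k" by (rule sum_ln_quotient_le)
  finally show ?thesis .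
qed

text \<open>The logarithm is the divisor sum of \<open>mangoldt\<close>, and complete
  multiplicativity splits \<open>f n\<close> at each divisor. The partial sum at \<open>k\<close> is
  thereby controlled by those at \<open>k div d\<close>, weighted by primes.\<close>

lemma log_partial_sum_mangoldt:
  assumes "unimodular_mult f"
  shows "log_partial_sum f k = (\<Sum>d=1..k. mangoldt d * f d * partial_sum f (k div d))"
proof -
  have "(\<Sum>d=1..k. mangoldt d * f d * partial_sum f (k div d)) =
        (\<Sum>d=1..k. \<Sum>m=1..k div d. mangoldt d * (f d * f m))"
    by (simp add: partial_sum_def sum_distrib_left mult.assoc)
  also have "\<dots> = (\<Sum>n=1..k. \<Sum>d | d dvd n. mangoldt d * (f d * f (n div d)))"
    by (rule sum_divisors_swap[symmetric])
  also have "\<dots> = (\<Sum>n=1..k. f n * (\<Sum>d | d dvd n. mangoldt d))"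
  proof (intro sum.cong refl)
    fix n assume n: "n \<in> {1..k}"
    have "f d * f (n div d) = f n" if d: "d dvd n" for d
    proof -
      obtain e where e: "n = d * e" using d by auto
      with n have "d > 0" "e > 0" by (auto intro: Nat.gr0I)
      with e assms show ?thesis by (simp add: unimodular_mult_def)
    qed
    then show "(\<Sum>d | d dvd n. mangoldt d * (f d * f (n div d))) = f n * (\<Sum>d | d dvd n. mangoldt d)"
      by (simp add: sum_distrib_left mult.commute)
  qed
  also have "\<dots> = log_partial_sum f k"
    unfolding log_partial_sum_def by (intro sum.cong refl) (subst mangoldt_sum, auto)
  finally show ?thesis ..
qed

lemma partial_sum_lipschitz:
  assumes "unimodular_mult f" "x \<le> k"
  shows "cmod (partial_sum f x) \<le> cmod (partial_sum f k) + real (k - x)"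
proof -
  have "{1..k} = {1..x} \<union> {x+1..k}" using assms by auto
  then have "partial_sum f k = partial_sum f x + (\<Sum>n\<in>{x+1..k}. f n)"
    unfolding partial_sum_def by (simp only:) (intro sum.union_disjoint, auto)
  moreover have "cmod (\<Sum>n\<in>{x+1..k}. f n) \<le> (\<Sum>n\<in>{x+1..k}. 1)"
    using assms by (intro sum_norm_le) (auto simp: unimodular_mult_def)
  ultimately show ?thesis
    by (simp add: ) (smt (verit) norm_diff_triangle_ineq norm_triangle_ineq2 add_diff_cancel_left' norm_triangle_sub of_nat_diff norm_minus_commute)
qed

text \<open>Averaging over the window \<open>{x<..x+h}\<close> makes Chebyshev's bound sufficient here: no information
  on primes in short intervals is needed.\<close>

lemma partial_sum_le_average:
  assumes f: "unimodular_mult f" and x: "x \<ge> 1" and h: "1 \<le> h" "h \<le> x"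
  shows "real h * ln (real x) * cmod (partial_sum f x) \<le>
    16 * (real x)\<^sup>2 * (\<Sum>m=1..2*x. cmod (partial_sum f m) / (real m)\<^sup>2) + 2 * real h * real x + (real h)\<^sup>2 * ln (2 * real x)"
proof -
  define S where "S = (\<lambda>k. cmod (partial_sum f k))"
  define W where "W = {x+1..x+h}"
  have fin: "finite W" and cardW: "card W = h" by (auto simp: W_def)
  have Sk: "ln (real k) * S k \<le> (\<Sum>d=1..k. mangoldt d * S (k div d)) + real k" for k
  proof (cases "k = 0")
    case False
    have "S k * ln (real k) = cmod (partial_sum f k * ln (real k))"
      using False by (simp add: S_def norm_mult)
    also have "\<dots> \<le> cmod (log_partial_sum f k) + real k"
      using log_partial_sum_approx[OF f, of k] by (smt (verit) norm_triangle_ineq3)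
    also have "cmod (log_partial_sum f k) \<le> (\<Sum>d=1..k. mangoldt d * S (k div d))"
      unfolding log_partial_sum_mangoldt[OF f]
      using f by (intro sum_norm_le) (auto simp: norm_mult S_def unimodular_mult_def)
    finally show ?thesis by (simp add: mult.commute)
  qed (auto simp: S_def partial_sum_def)
  have "real h * ln (real x) * S x = (\<Sum>k\<in>W. ln (real x) * S x)"
    using cardW by simp
  \<comment> \<open>Moving from \<open>x\<close> to \<open>k\<close> in the window changes the
    partial sum by at most \<open>h\<close>; over the \<open>h\<close> values of \<open>k\<close>
    this costs the term \<open>h^2 * ln (2 * x)\<close> of the conclusion.\<close>
  also have "\<dots> \<le> (\<Sum>k\<in>W. ln (real k) * S k + real h * ln (2 * real x))"
  proof (rule sum_mono)
    fix k assume k: "k \<in> W"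
    have "ln (real x) * S x \<le> ln (real k) * (S k + real h)"
    proof (rule mult_mono)
      show "S x \<le> S k + real h"
        using partial_sum_lipschitz[OF f, of x k] k by (auto simp: W_def S_def)
    qed (use k x in \<open>auto simp: W_def S_def intro!: ln_mono\<close>)
    also have "\<dots> \<le> ln (real k) * S k + real h * ln (2 * real x)"
      using k x h by (auto simp: W_def algebra_simps intro!: mult_left_mono ln_mono)
    finally show "ln (real x) * S x \<le> ln (real k) * S k + real h * ln (2 * real x)" .
  qed
  also have "\<dots> \<le> (\<Sum>k\<in>W. (\<Sum>d=1..k. mangoldt d * S (k div d)) + real (2 * x) + real h * ln (2 * real x))"
  proof (intro sum_mono add_right_mono)
    fix k assume "k \<in> W"
    then have "real k \<le> real (2 * x)" using h by (auto simp: W_def)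
    then show "ln (real k) * S k \<le> (\<Sum>d=1..k. mangoldt d * S (k div d)) + real (2 * x)"
      using Sk[of k] by linarith
  qed
  also have "\<dots> = (\<Sum>k\<in>W. \<Sum>d=1..k. mangoldt d * S (k div d)) + 2 * real h * real x + (real h)\<^sup>2 * ln (2 * real x)"
    using cardW by (simp add: sum.distrib power2_eq_square)
  also have "(\<Sum>k\<in>W. \<Sum>d=1..k. mangoldt d * S (k div d)) \<le>
     16 * (real x)\<^sup>2 * (\<Sum>m=1..2*x. S m / (real m)\<^sup>2)"
  proof -
    \<comment> \<open>The \<open>k\<close> with \<open>k div d = m\<close> lie in an interval of
      length \<open>d\<close>, and there are none unless m d \<le> 2x. After this count each
      \<open>mangoldt d\<close> has weight at most \<open>d\<close> on a full initial range, to
      which Chebyshev's bound applies.\<close>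
    have fib: "real (card {k\<in>W. k div d = m}) * mangoldt d \<le> (if d \<le> 2 * x div m then real d * mangoldt d else 0)"
      if "d \<in> {1..2*x}" "m \<in> {1..2*x}" for d m
    proof (cases "d \<le> 2 * x div m")
      case True
      have "card {k\<in>W. k div d = m} \<le> card {m*d..<m*d+d}"
      proof -
        have "k \<in> {m*d..<m*d+d}" if "k \<in> W" "k div d = m" for k
          using that \<open>d \<in> _\<close> dividend_less_div_times[of d k] by auto
        then show ?thesis by (intro card_mono) auto
      qed
      then show ?thesis using True by (auto intro!: mult_right_mono mangoldt_nonneg)
    next
      case False
      have "{k\<in>W. k div d = m} = {}"
      proof (rule ccontr)
        assume "{k\<in>W. k div d = m} \<noteq> {}"
        then obtain k where k: "k \<in> W" "k div d = m" by auto
        have "m * d \<le> k" using k by (metis div_times_less_eq_dividend)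
        also have "k \<le> 2 * x" using k h by (auto simp: W_def)
        finally show False using False that by (auto simp: less_eq_div_iff_mult_less_eq mult.commute)
      qed
      then show ?thesis using False by (simp only: card.empty) simp
    qed
    have "(\<Sum>k\<in>W. \<Sum>d=1..k. mangoldt d * S (k div d)) = (\<Sum>k\<in>W. \<Sum>d=1..2*x. mangoldt d * S (k div d))"
    proof (rule sum.cong[OF refl], rule sum.mono_neutral_left)
      fix k assume "k \<in> W"
      then show "{1..k} \<subseteq> {1..2*x}" using h by (auto simp: W_def)
    qed (auto simp: S_def partial_sum_def)
    also have "\<dots> = (\<Sum>k\<in>W. \<Sum>d=1..2*x. \<Sum>m=1..2*x. if k div d = m then mangoldt d * S m else 0)"
    proof (intro sum.cong refl)
      fix k d assume "k \<in> W" "d \<in> {1..2*x}"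
      then have "k div d \<le> 2*x" using h by (auto simp: W_def intro: order_trans[OF div_le_dividend])
      then show "mangoldt d * S (k div d) = (\<Sum>m=1..2*x. if k div d = m then mangoldt d * S m else 0)"
        by (subst sum.delta') (auto simp: S_def partial_sum_def)
    qed
    also have "\<dots> = (\<Sum>m=1..2*x. \<Sum>d=1..2*x. \<Sum>k\<in>W. if k div d = m then mangoldt d * S m else 0)"
      by (subst sum.swap, subst sum.swap, subst sum.swap[of _ "{1..2*x}" W], rule refl)
    also have "\<dots> = (\<Sum>m=1..2*x. S m * (\<Sum>d=1..2*x. real (card {k\<in>W. k div d = m}) * mangoldt d))"
      using fin by (simp add: sum_distrib_left sum.If_cases Int_def conj_commute mult_ac)
    also have "\<dots> \<le> (\<Sum>m=1..2*x. S m * (16 * (real x)\<^sup>2 / (real m)\<^sup>2))"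
    proof (intro sum_mono mult_left_mono)
      fix m assume m: "m \<in> {1..2*x}"
      define y where "y = 2 * x div m"
      have y: "y \<le> 2 * x" unfolding y_def by simp
      have "(\<Sum>d=1..2*x. real (card {k\<in>W. k div d = m}) * mangoldt d) \<le>
            (\<Sum>d=1..2*x. if d \<le> y then real d * mangoldt d else 0)"
        unfolding y_def using m by (intro sum_mono fib) auto
      also have "\<dots> = (\<Sum>d=1..y. real d * mangoldt d)"
        using y by (intro sum.mono_neutral_cong_right) auto
      also have "\<dots> \<le> (\<Sum>d=1..y. real y * mangoldt d)"
        by (intro sum_mono mult_right_mono mangoldt_nonneg) auto
      also have "\<dots> = real y * cheb_psi y"
        by (simp add: cheb_psi_def sum_distrib_left)
      also have "\<dots> \<le> real y * (4 * real y)"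
        by (intro mult_left_mono cheb_psi_le) auto
      also have "\<dots> = 4 * (real y)\<^sup>2" by (simp add: power2_eq_square)
      also have "\<dots> \<le> 4 * (real (2 * x) / real m)\<^sup>2"
        unfolding y_def by (intro mult_left_mono power_mono of_nat_div_le_of_nat) auto
      also have "\<dots> = 16 * (real x)\<^sup>2 / (real m)\<^sup>2" by (simp add: power_divide power_mult_distrib)
      finally show "(\<Sum>d=1..2*x. real (card {k\<in>W. k div d = m}) * mangoldt d) \<le> 16 * (real x)\<^sup>2 / (real m)\<^sup>2" .
    qed (auto simp: S_def)
    finally show ?thesis by (simp add: sum_distrib_left mult_ac)
  qed
  finally show ?thesis by (simp add: S_def)
qed

subsection \<open>Plancherel with the Cauchy weight\<close>

lemma has_bochner_integral_inverse_1_plus_square: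
  "has_bochner_integral lborel (\<lambda>y::real. inverse (1 + y\<^sup>2)) pi"
  using integrable_inverse_1_plus_square LBINT_inverse_1_plus_square
  by (simp add: has_bochner_integral_iff set_integrable_def interval_lebesgue_integral_def
      set_lebesgue_integral_def einterval_def)

text \<open>Subtracting \<open>exp (-v)\<close>, the value of the exponential at \<i>, removes the
  pole in the upper half-plane, so that Cauchy's theorem on a half-disc involves no residue. The
  bound is the contribution of the arc, of length \<open>pi * R\<close>, with integrand at most
  2/(R^2 - 1).\<close>

lemma integral_fourier_cauchy_le:
  fixes v R :: real
  assumes v: "v \<ge> 0" and R: "R > 1"
  shows "cmod (integral {-R..R} (\<lambda>x. (exp (\<i> * v * x) - exp (-v)) / (1 + x\<^sup>2))) \<le> 2 * pi * R / (R\<^sup>2 - 1)"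
proof -
  define f where "f = (\<lambda>z::complex. exp (\<i> * v * z))"
  \<comment> \<open>The removable singularity at \<i> is filled in; the other factor z + \<i> of the
    denominator vanishes outside the half-plane \<open>H\<close>.\<close>
  define \<phi> where "\<phi> = (\<lambda>z. if z = \<i> then deriv f \<i> else (f z - f \<i>) / (z - \<i>))"
  define q where "q = (\<lambda>z. \<phi> z / (z + \<i>))"
  define H where "H = {z::complex. Im z > -1}"
  have fi: "f \<i> = exp (-v)" proof -
    have "\<i> * complex_of_real v * \<i> = of_real (-v)" by (simp add: complex_eq_iff)
    then show ?thesis by (simp only: f_def exp_of_real)
  qed
  have "f holomorphic_on UNIV" unfolding f_def by (intro holomorphic_intros)
  then have "\<phi> holomorphic_on UNIV" unfolding \<phi>_def by (rule pole_lemma) auto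
  then have qh: "q holomorphic_on H" unfolding q_def
    by (intro holomorphic_intros) (auto simp: H_def complex_eq_iff intro: holomorphic_on_subset)
  have q_eq: "q z = (f z - exp (-v)) / (z\<^sup>2 + 1)" if "z \<noteq> \<i>" for z
    using that by (simp add: q_def \<phi>_def fi) (simp add: power2_eq_square algebra_simps)
  have convH: "convex H" unfolding H_def by (rule convex_halfspace_Im_gt)
  define g where "g = linepath (of_real (-R)) (of_real R) +++ part_circlepath 0 R 0 pi"
  have vg: "valid_path g" unfolding g_def by (auto intro!: valid_path_join)
  have lp: "path_image (linepath (of_real (-R)) (of_real R)) \<subseteq> H"
    by (auto simp: H_def closed_segment_def)
  have cp: "path_image (part_circlepath 0 R 0 pi) \<subseteq> {z. cmod z = R \<and> Im z \<ge> 0}"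
  proof
    fix z assume "z \<in> path_image (part_circlepath 0 R 0 pi)"
    then obtain t where t: "0 \<le> t" "t \<le> pi" "z = R * exp (\<i> * t)"
      using R by (auto simp: path_image_part_circlepath)
    then show "z \<in> {z. cmod z = R \<and> Im z \<ge> 0}"
      using R by (auto simp: norm_mult Im_exp sin_ge_zero)
  qed
  have pg: "path_image g \<subseteq> H"
    unfolding g_def using lp cp by (subst path_image_join) (auto simp: H_def)
  have "(q has_contour_integral 0) g"
    by (rule Cauchy_theorem_convex_simple[OF qh convH vg pg]) (auto simp: g_def)
  moreover have iq1: "q contour_integrable_on (linepath (of_real (-R)) (of_real R))"
    by (rule contour_integrable_holomorphic_simple[OF qh _ _ lp])
       (auto simp: H_def open_halfspace_Im_gt)
  moreover have iq2: "q contour_integrable_on (part_circlepath 0 R 0 pi)"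
    by (rule contour_integrable_holomorphic_simple[OF qh]) (use cp in \<open>auto simp: H_def open_halfspace_Im_gt\<close>)
  ultimately have eq: "contour_integral (linepath (of_real (-R)) (of_real R)) q = 
       - contour_integral (part_circlepath 0 R 0 pi) q"
    unfolding g_def
    by (metis (no_types, lifting) contour_integral_join contour_integral_unique valid_path_linepath valid_path_part_circlepath
        add_eq_0_iff2 pathfinish_linepath pathstart_part_circlepath contour_integrable_joinI)
  have "cmod (contour_integral (part_circlepath 0 R 0 pi) q) \<le> 2 / (R\<^sup>2 - 1) * R * \<bar>pi - 0\<bar>"
  proof (rule contour_integral_bound_part_circlepath[OF iq2])
    fix z assume "z \<in> path_image (part_circlepath 0 R 0 pi)"
    then have z: "cmod z = R" "Im z \<ge> 0" using cp by auto
    then have "z \<noteq> \<i>" using R by auto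
    have "cmod (f z) \<le> 1" using z v by (simp add: f_def)
    moreover have "cmod (exp (- complex_of_real v)) \<le> 1" using v by (simp add: norm_exp_eq_Re)
    ultimately have "cmod (f z - exp (-v)) \<le> 2"
      using norm_triangle_ineq4[of "f z" "exp (-v)"] v by (simp add: exp_of_real) (smt (verit) exp_le_one_iff)
    moreover have "R\<^sup>2 - 1 \<le> cmod (z\<^sup>2 + 1)"
      using norm_triangle_ineq2[of "z\<^sup>2" "-1"] z by (simp add: norm_power)
    moreover have "R\<^sup>2 - 1 > 0" using R by (simp add: power2_eq_square less_1_mult)
    ultimately show "cmod (q z) \<le> 2 / (R\<^sup>2 - 1)"
      unfolding q_eq[OF \<open>z \<noteq> \<i>\<close>] norm_divide by (intro frac_le) (auto simp: exp_of_real)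
  qed (use R in \<open>auto simp: power2_eq_square less_1_mult less_imp_le\<close>)
  moreover have hi: "((\<lambda>x. q (of_real x)) has_integral (contour_integral (linepath (of_real (-R)) (of_real R)) q)) {-R..R}"
    using has_contour_integral_integral[OF iq1] R
    by (subst (asm) has_contour_integral_linepath_Reals_iff) auto
  moreover have qx: "q (of_real x) = (exp (\<i> * v * x) - exp (-v)) / (1 + x\<^sup>2)" for x :: real
    by (subst q_eq) (auto simp: f_def complex_eq_iff[of _ \<i>] add.commute exp_of_real)
  ultimately show ?thesis using eq
    by (simp add: integral_unique mult_ac)
qed

text \<open>The truncated integrals of \<open>h\<close> tend to its full integral by dominated
  convergence and to 0 by the arc bound. Hence the transform is \<open>exp (-v)\<close> times the
  integral of the weight.\<close>

lemma fourier_cauchy_nonneg: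
  fixes v :: real
  assumes v: "v \<ge> 0"
  shows "has_bochner_integral lborel (\<lambda>y::real. exp (\<i> * v * y) / (1 + y\<^sup>2)) (pi * exp (-v))"
proof -
  define h where "h = (\<lambda>y::real. (exp (\<i> * v * y) - exp (-v)) / (1 + y\<^sup>2))"
  have hb: "cmod (exp (\<i> * v * y) / (1 + y\<^sup>2)) \<le> inverse (1 + y\<^sup>2)" for y :: real
  proof -
    have "cmod (1 + (complex_of_real y)\<^sup>2) = 1 + y\<^sup>2"
      by (metis abs_of_nonneg norm_of_real of_real_1 of_real_add of_real_power add_nonneg_nonneg zero_le_one zero_le_power2)
    then show ?thesis by (simp add: norm_divide divide_inverse norm_mult norm_exp_eq_Re norm_inverse)
  qed
  have int0: "integrable lborel (\<lambda>y::real. inverse (1 + y\<^sup>2))"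
    using has_bochner_integral_inverse_1_plus_square by (simp add: has_bochner_integral_iff)
  have int1: "integrable lborel (\<lambda>y::real. exp (\<i> * v * y) / (1 + y\<^sup>2))"
    by (rule Bochner_Integration.integrable_bound[OF int0]) (use hb in auto)
  have c: "has_bochner_integral lborel (\<lambda>y::real. exp (-v) * inverse (1 + y\<^sup>2)) (exp (-v) * pi)"
    by (intro has_bochner_integral_mult_right has_bochner_integral_inverse_1_plus_square)
  from has_bochner_integral_of_real[OF c, where 'a = complex] 
  have c': "has_bochner_integral lborel (\<lambda>y::real. exp (-v) / (1 + (complex_of_real y)\<^sup>2)) (complex_of_real (exp (-v) * pi))"
    by (simp add: divide_inverse)
  have int2: "integrable lborel h"
    using int1 c' unfolding h_def diff_divide_distrib
    by (intro Bochner_Integration.integrable_diff) (auto simp: has_bochner_integral_iff)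
  have "(\<lambda>n. \<integral>y. indicator {-real n..real n} y *\<^sub>R h y \<partial>lborel) \<longlonglongrightarrow> (\<integral>y. h y \<partial>lborel)"
  proof (rule integral_dominated_convergence[where w = "\<lambda>y. cmod (h y)"])
    show "AE y in lborel. (\<lambda>n. indicator {-real n..real n} y *\<^sub>R h y) \<longlonglongrightarrow> h y"
    proof (rule AE_I2)
      fix y :: real
      obtain m :: nat where m: "\<bar>y\<bar> \<le> real m" using real_arch_simple by blast
      have "eventually (\<lambda>n. indicator {-real n..real n} y *\<^sub>R h y = h y) sequentially"
        using eventually_ge_at_top[of m] by eventually_elim (use m in \<open>auto simp: indicator_def\<close>)
      then show "(\<lambda>n. indicator {-real n..real n} y *\<^sub>R h y) \<longlonglongrightarrow> h y"
        by (rule tendsto_eventually)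
    qed
  qed (use int2 in \<open>auto simp: indicator_def\<close>)
  moreover have "(\<lambda>n. \<integral>y. indicator {-real n..real n} y *\<^sub>R h y \<partial>lborel) \<longlonglongrightarrow> 0"
  proof (rule Lim_null_comparison)
    show "eventually (\<lambda>n. cmod (\<integral>y. indicator {-real n..real n} y *\<^sub>R h y \<partial>lborel) \<le> 2 * pi * real n / ((real n)\<^sup>2 - 1)) sequentially"
      using eventually_gt_at_top[of 1]
    proof eventually_elim
      case (elim n)
      have "set_integrable lborel {-real n..real n} h"
        using int2 unfolding set_integrable_def by (intro integrable_mult_indicator) auto
      then have "(\<integral>y. indicator {-real n..real n} y *\<^sub>R h y \<partial>lborel) = integral {-real n..real n} h"
        using set_borel_integral_eq_integral(2) by (fastforce simp: set_lebesgue_integral_def)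
      then show ?case using integral_fourier_cauchy_le[OF v, of "real n"] elim
        by (simp add: h_def)
    qed
    show "(\<lambda>n. 2 * pi * real n / ((real n)\<^sup>2 - 1)) \<longlonglongrightarrow> 0" by real_asymp
  qed
  ultimately have "(\<integral>y. h y \<partial>lborel) = 0" by (rule LIMSEQ_unique)
  with int2 have "has_bochner_integral lborel h 0" by (simp add: has_bochner_integral_iff)
  from has_bochner_integral_add[OF this c'] show ?thesis
    by (simp add: h_def diff_divide_distrib mult.commute exp_of_real)
qed

lemma fourier_cauchy:
  fixes v b :: real
  assumes b: "b > 0"
  shows "has_bochner_integral lborel (\<lambda>y::real. exp (\<i> * v * y) / (b\<^sup>2 + y\<^sup>2)) (pi / b * exp (- b * \<bar>v\<bar>))"
proof -
  \<comment> \<open>The sign of \<open>c\<close> follows that of \<open>v\<close>, so the single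
    substitution by y/c both rescales the weight to width \<open>b\<close> and reduces negative
    \<open>v\<close> to the nonnegative case.\<close>
  define c where "c = (if v \<ge> 0 then b else -b)"
  have c: "c \<noteq> 0" "\<bar>c\<bar> = b" "c\<^sup>2 = b\<^sup>2" "c * v = b * \<bar>v\<bar>" using b by (auto simp: c_def)
  have "has_bochner_integral lborel (\<lambda>y::real. exp (\<i> * (b * \<bar>v\<bar>) * y) / (1 + y\<^sup>2)) (pi * exp (-(b * \<bar>v\<bar>)))"
    using fourier_cauchy_nonneg[of "b * \<bar>v\<bar>"] b by simp
  then have "has_bochner_integral lborel (\<lambda>y::real. exp (\<i> * (b * \<bar>v\<bar>) * complex_of_real (0 + (1/c) * y)) / (1 + (complex_of_real (0 + (1/c) * y))\<^sup>2)) 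
    ((pi * exp (-(b * \<bar>v\<bar>))) /\<^sub>R \<bar>1/c\<bar>)"
    using c lborel_has_bochner_integral_real_affine_iff[of "1/c" "\<lambda>y. exp (\<i> * (b * \<bar>v\<bar>) * complex_of_real y) / (1 + (complex_of_real y)\<^sup>2)" _ 0]
    by (simp add: scaleR_conv_of_real)
  from has_bochner_integral_mult_right[OF this, of "1 / (of_real b)\<^sup>2"]
  have "has_bochner_integral lborel (\<lambda>y. 1 / (of_real b)\<^sup>2 * (exp (\<i> * (b * \<bar>v\<bar>) * complex_of_real (0 + (1/c) * y)) / (1 + (complex_of_real (0 + (1/c) * y))\<^sup>2)))
     (1 / (of_real b)\<^sup>2 * ((pi * exp (-(b * \<bar>v\<bar>))) /\<^sub>R \<bar>1/c\<bar>))" by simp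
  moreover have "1 / (of_real b)\<^sup>2 * (exp (\<i> * (b * \<bar>v\<bar>) * complex_of_real (0 + (1/c) * y)) / (1 + (complex_of_real (0 + (1/c) * y))\<^sup>2))
     = exp (\<i> * v * y) / (b\<^sup>2 + y\<^sup>2)" for y :: real
  proof -
    have "complex_of_real (b * \<bar>v\<bar>) * complex_of_real (0 + (1/c) * y) = complex_of_real (v * y)"
      using c(1) unfolding c(4)[symmetric] of_real_mult[symmetric] by simp
    then have 1: "\<i> * (b * \<bar>v\<bar>) * complex_of_real (0 + (1/c) * y) = \<i> * v * y"
      by (metis mult.assoc of_real_mult)
    have "(complex_of_real b)\<^sup>2 * (1 + (complex_of_real (0 + (1/c) * y))\<^sup>2) = of_real (b\<^sup>2 * (1 + ((1/c) * y)\<^sup>2))"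
      by simp
    also have "b\<^sup>2 * (1 + ((1/c) * y)\<^sup>2) = b\<^sup>2 + y\<^sup>2"
      using c b by (simp add: field_simps power_divide)
    finally show ?thesis using b unfolding 1 by (simp add: divide_simps) 
  qed
  moreover have "1 / (of_real b)\<^sup>2 * ((pi * exp (-(b * \<bar>v\<bar>))) /\<^sub>R \<bar>1/c\<bar>) = complex_of_real (pi / b * exp (- b * \<bar>v\<bar>))"
    using b c by (simp add: field_simps power2_eq_square scaleR_conv_of_real)
  ultimately show ?thesis by simp
qed

text \<open>Expanding the square leaves the transform of the weight at the differences of
  frequencies. As this kernel is positive, coefficients may later be replaced by majorants.\<close>

lemma plancherel_cauchy_weight:
  fixes a :: "'i \<Rightarrow> complex" and l :: "'i \<Rightarrow> real"
  assumes b: "b > 0"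
  shows "has_bochner_integral lborel (\<lambda>y::real. complex_of_real ((cmod (\<Sum>n\<in>A. a n * exp (- \<i> * l n * y)))\<^sup>2 / (b\<^sup>2 + y\<^sup>2)))
    (pi / b * (\<Sum>n\<in>A. \<Sum>m\<in>A. a n * cnj (a m) * exp (- b * \<bar>l n - l m\<bar>)))"
proof -
  have "has_bochner_integral lborel (\<lambda>y::real. \<Sum>n\<in>A. \<Sum>m\<in>A. a n * cnj (a m) * (exp (\<i> * (l m - l n) * y) / (b\<^sup>2 + y\<^sup>2)))
     (\<Sum>n\<in>A. \<Sum>m\<in>A. a n * cnj (a m) * (pi / b * exp (- b * \<bar>l m - l n\<bar>)))"
    using fourier_cauchy[OF b, of "l m - l n" for n m]
    by (intro has_bochner_integral_sum has_bochner_integral_mult_right) simp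
  also have "(\<lambda>y::real. \<Sum>n\<in>A. \<Sum>m\<in>A. a n * cnj (a m) * (exp (\<i> * (l m - l n) * y) / (b\<^sup>2 + y\<^sup>2))) =
     (\<lambda>y. complex_of_real ((cmod (\<Sum>n\<in>A. a n * exp (- \<i> * l n * y)))\<^sup>2 / (b\<^sup>2 + y\<^sup>2)))" 
  proof
    fix y :: real
    have "complex_of_real ((cmod (\<Sum>n\<in>A. a n * exp (- \<i> * l n * y)))\<^sup>2 / (b\<^sup>2 + y\<^sup>2)) =
      (\<Sum>n\<in>A. a n * exp (- \<i> * l n * y)) * cnj (\<Sum>m\<in>A. a m * exp (- \<i> * l m * y)) / (b\<^sup>2 + y\<^sup>2)"
      unfolding complex_norm_square[symmetric] by simp
    also have "\<dots> = (\<Sum>n\<in>A. \<Sum>m\<in>A. (a n * exp (- \<i> * l n * y)) * (cnj (a m) * exp (\<i> * l m * y)) / (b\<^sup>2 + y\<^sup>2))"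
      by (simp add: sum_product sum_divide_distrib exp_cnj)
    also have "\<dots> = (\<Sum>n\<in>A. \<Sum>m\<in>A. a n * cnj (a m) * (exp (\<i> * (l m - l n) * y) / (b\<^sup>2 + y\<^sup>2)))"
    proof (intro sum.cong refl)
      fix n m
      have "exp (\<i> * (l m - l n) * y) = exp (- \<i> * l n * y) * exp (\<i> * l m * y)"
        by (simp add: algebra_simps flip: exp_add)
      then show "(a n * exp (- \<i> * l n * y)) * (cnj (a m) * exp (\<i> * l m * y)) / (b\<^sup>2 + y\<^sup>2) =
         a n * cnj (a m) * (exp (\<i> * (l m - l n) * y) / (b\<^sup>2 + y\<^sup>2))" by simp
    qed
    finally show "(\<Sum>n\<in>A. \<Sum>m\<in>A. a n * cnj (a m) * (exp (\<i> * (l m - l n) * y) / (b\<^sup>2 + y\<^sup>2))) = 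
      complex_of_real ((cmod (\<Sum>n\<in>A. a n * exp (- \<i> * l n * y)))\<^sup>2 / (b\<^sup>2 + y\<^sup>2))" ..
  qed
  also have "(\<Sum>n\<in>A. \<Sum>m\<in>A. a n * cnj (a m) * (pi / b * exp (- b * \<bar>l m - l n\<bar>))) =
     (pi / b * (\<Sum>n\<in>A. \<Sum>m\<in>A. a n * cnj (a m) * exp (- b * \<bar>l n - l m\<bar>)))"
    by (simp add: sum_distrib_left mult_ac abs_minus_commute)
  finally show ?thesis .
qed

subsection \<open>Euler products\<close>

lemma sum_tendsto_infsum:
  fixes t :: "nat \<Rightarrow> 'a::banach"
  assumes "t summable_on {1..}"
  shows "(\<lambda>X. \<Sum>n=1..X. t n) \<longlonglongrightarrow> infsum t {1..}"
proof -
  define g where "g = (\<lambda>n. if n \<ge> 1 then t n else 0)"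
  have "(t has_sum infsum t {1..}) {1..}" using assms by simp
  then have "(g has_sum infsum t {1..}) UNIV"
    by (subst has_sum_cong_neutral[where g = t and T = "{1..}"]) (auto simp: g_def)
  then have "g sums infsum t {1..}" by (rule has_sum_imp_sums)
  then have "(\<lambda>X. \<Sum>n\<le>X. g n) \<longlonglongrightarrow> infsum t {1..}" by (simp add: sums_def_le)
  moreover have "(\<Sum>n\<le>X. g n) = (\<Sum>n=1..X. t n)" for X
    by (rule sum.mono_neutral_cong_right) (auto simp: g_def)
  ultimately show ?thesis by simp
qed

definition primes_le :: "nat \<Rightarrow> nat set" where
  "primes_le P = {p. prime p \<and> p \<le> P}"

lemma finite_primes_le [simp, intro]: "finite (primes_le P)"
  unfolding primes_le_def by auto

lemma primes_le_Suc:
  "primes_le (Suc P) = (if prime (Suc P) then insert (Suc P) (primes_le P) else primes_le P)"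
  unfolding primes_le_def by (auto simp: le_Suc_eq)

lemma Suc_notin_primes_le [simp]: "Suc P \<notin> primes_le P"
  unfolding primes_le_def by auto

text \<open>Sieving one prime at a time gives the Euler product without rearranging an infinite product.\<close>

lemma euler_product_sieve:
  fixes t :: "nat \<Rightarrow> complex"
  assumes mult: "\<And>m n. m > 0 \<Longrightarrow> n > 0 \<Longrightarrow> t (m * n) = t m * t n"
    and summ: "t summable_on {1..}"
  shows "infsum t {1..} * (\<Prod>p\<in>primes_le P. 1 - t p) = infsum t {n. n > 0 \<and> (\<forall>p. prime p \<longrightarrow> p \<le> P \<longrightarrow> \<not> p dvd n)}"
proof (induction P)
  case 0
  have "{n::nat. n > 0 \<and> (\<forall>p. prime p \<longrightarrow> p \<le> 0 \<longrightarrow> \<not> p dvd n)} = {1..}" by auto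
  moreover have "primes_le 0 = {}" by (auto simp: primes_le_def)
  ultimately show ?case by simp
next
  case (Suc P)
  define A where "A = (\<lambda>P. {n::nat. n > 0 \<and> (\<forall>p. prime p \<longrightarrow> p \<le> P \<longrightarrow> \<not> p dvd n)})"
  show ?case
  proof (cases "prime (Suc P)")
    case True
    define q where "q = Suc P"
    have q: "prime q" "q > 0" using True by (auto simp: q_def)
    have sub: "t summable_on B" if "B \<subseteq> {1..}" for B
      using summable_on_subset[OF summ that] .
    \<comment> \<open>A number free of primes up to \<open>P\<close> is either also free of
      \<open>q\<close>, or \<open>q\<close> times such a number. The second set contributes
      \<open>t q\<close> times the old sum, so sieving by \<open>q\<close> multiplies the sum by
      \<open>1 - t q\<close>.\<close>
    have img: "A P = A q \<union> (\<lambda>n. q * n) ` A P"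
    proof (intro equalityI subsetI)
      fix n assume n: "n \<in> A P"
      show "n \<in> A q \<union> (\<lambda>n. q * n) ` A P"
      proof (cases "q dvd n")
        case True
        then obtain m where m: "n = q * m" by auto
        have "\<not> p dvd m" if "prime p" "p \<le> P" for p
        proof -
          have "\<not> p dvd q * m" using n that m by (simp add: A_def)
          with dvd_mult[of p m q] show ?thesis by argo
        qed
        moreover have "m > 0" using n m by (simp add: A_def)
        ultimately have "m \<in> A P" by (simp add: A_def)
        with m show ?thesis by blast
      next
        case False
        with n show ?thesis by (auto simp: A_def q_def le_Suc_eq)
      qed
    next
      fix n assume n: "n \<in> A q \<union> (\<lambda>n. q * n) ` A P"
      have ndvd: "\<not> p dvd q" if "prime p" "p \<le> P" for p
        using that q(1) primes_dvd_imp_eq[of p q] by (auto simp: q_def)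
      show "n \<in> A P"
      proof (cases "n \<in> A q")
        case True
        then show ?thesis unfolding A_def q_def by simp
      next
        case False
        with n obtain m where m: "n = q * m" "m \<in> A P" by blast
        have "\<not> p dvd n" if "prime p" "p \<le> P" for p
          using that m ndvd[OF that] unfolding m(1) prime_dvd_mult_iff[OF that(1)] by (simp add: A_def)
        moreover have "n > 0" using m q(2) by (simp add: A_def)
        ultimately show ?thesis by (simp add: A_def)
      qed
    qed
    have "infsum t (A P) = infsum t (A q) + infsum t ((\<lambda>n. q * n) ` A P)"
      by (subst img, rule infsum_Un_disjoint) (use q in \<open>auto intro!: sub simp: A_def Suc_le_eq\<close>)
    also have "infsum t ((\<lambda>n. q * n) ` A P) = infsum (t \<circ> (\<lambda>n. q * n)) (A P)"
      by (rule infsum_reindex) (use q in \<open>auto simp: inj_on_def\<close>)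
    also have "\<dots> = infsum (\<lambda>n. t q * t n) (A P)"
      by (intro infsum_cong) (auto simp: mult A_def q)
    also have "\<dots> = t q * infsum t (A P)"
      by (rule infsum_cmult_right')
    finally have e: "infsum t (A P) = infsum t (A q) + t q * infsum t (A P)" .
    have "b = a * (1 - c)" if "a = b + c * a" for a b c :: complex
      using that by (simp add: ring_distribs) (metis add_diff_cancel_right' mult.commute)
    from this[OF e] have "infsum t (A q) = infsum t (A P) * (1 - t q)" .
    with Suc.IH True show ?thesis
      by (simp add: primes_le_Suc A_def q_def mult_ac)
  next
    case False
    then have "A (Suc P) = A P" by (auto simp: A_def le_Suc_eq)
    with False Suc.IH show ?thesis by (simp add: primes_le_Suc A_def)
  qed
qed

lemma infsum_split_nat:
  fixes g :: "nat \<Rightarrow> real"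
  assumes "g summable_on {1..}"
  shows "infsum g {1..} = sum g {1..P} + infsum g {P<..}"
proof -
  have s: "g summable_on {P<..}" by (rule summable_on_subset[OF assms]) auto
  have "infsum g ({1..P} \<union> {P<..}) = infsum g {1..P} + infsum g {P<..}"
    by (rule infsum_Un_disjoint) (use s in auto)
  moreover have "{1..P} \<union> {P<..} = {1..}" by auto
  ultimately show ?thesis by (metis infsum_finite finite_atLeastAtMost)
qed

text \<open>Among the numbers that survive the sieve only 1 does not exceed \<open>P\<close>, so the
  sieved sum differs from \<open>t 1\<close> by at most a tail of an absolutely convergent series.
  Stating it as series times finite product avoids dividing by either.\<close>

lemma euler_product:
  fixes t :: "nat \<Rightarrow> complex"
  assumes mult: "\<And>m n. m > 0 \<Longrightarrow> n > 0 \<Longrightarrow> t (m * n) = t m * t n" and one: "t 1 = 1"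
    and summ: "(\<lambda>n. cmod (t n)) summable_on {1..}"
  shows "(\<lambda>P. infsum t {1..} * (\<Prod>p\<in>primes_le P. 1 - t p)) \<longlonglongrightarrow> 1"
proof -
  define A where "A = (\<lambda>P. {n::nat. n > 0 \<and> (\<forall>p. prime p \<longrightarrow> p \<le> P \<longrightarrow> \<not> p dvd n)})"
  have s: "t summable_on {1..}" using summ by (rule abs_summable_summable)
  have "(\<lambda>P. infsum t (A P) - 1) \<longlonglongrightarrow> 0"
  proof (rule Lim_null_comparison)
    show "\<forall>\<^sub>F P in sequentially. norm (infsum t (A P) - 1) \<le> infsum (\<lambda>n. cmod (t n)) {1..} - (\<Sum>n=1..P. cmod (t n))"
      using eventually_ge_at_top[of 1]
    proof eventually_elim
      case (elim P)
      have sub: "A P - {1} \<subseteq> {P<..}"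
      proof
        fix n assume n: "n \<in> A P - {1}"
        then have n1: "n \<noteq> 1" "n > 0" by (auto simp: A_def)
        obtain p where p: "prime p" "p dvd n" using prime_factor_nat[OF n1(1)] by auto
        then have "\<not> p \<le> P" using n by (auto simp: A_def)
        moreover have "p \<le> n" using p n1(2) by (intro dvd_imp_le)
        ultimately show "n \<in> {P<..}" by simp
      qed
      have "1 \<in> A P" by (auto simp: A_def)
      then have "infsum t (A P) = infsum t (insert 1 (A P - {1}))" by (simp add: insert_absorb)
      also have "\<dots> = t 1 + infsum t (A P - {1})"
        by (rule infsum_insert) (auto intro!: summable_on_subset[OF s] simp: A_def)
      finally have "infsum t (A P) = t 1 + infsum t (A P - {1})" .
      then have "norm (infsum t (A P) - 1) = norm (infsum t (A P - {1}))" using one by simp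
      also have "\<dots> \<le> infsum (\<lambda>n. cmod (t n)) (A P - {1})"
        by (intro norm_infsum_bound summable_on_subset[OF summ]) (auto simp: A_def)
      also have "\<dots> \<le> infsum (\<lambda>n. cmod (t n)) {P<..}"
      proof (rule infsum_mono2[OF _ _ sub])
        show "(\<lambda>n. cmod (t n)) summable_on (A P - {1})" "(\<lambda>n. cmod (t n)) summable_on {P<..}"
          by (rule summable_on_subset[OF summ], force simp: A_def)+
      qed auto
      also have "\<dots> = infsum (\<lambda>n. cmod (t n)) {1..} - (\<Sum>n=1..P. cmod (t n))"
        using infsum_split_nat[OF summ, of P] by simp
      finally show ?case .
    qed
    show "(\<lambda>P. infsum (\<lambda>n. cmod (t n)) {1..} - (\<Sum>n=1..P. cmod (t n))) \<longlonglongrightarrow> 0"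
      using tendsto_diff[OF tendsto_const sum_tendsto_infsum[OF summ], of "infsum (\<lambda>n. cmod (t n)) {1..}"]
      by (simp only: diff_self)
  qed
  then have "(\<lambda>P. infsum t (A P)) \<longlonglongrightarrow> 1" by (rule LIM_zero_cancel)
  then show ?thesis by (simp only: euler_product_sieve[OF mult s] A_def)
qed

lemma cmod_one_minus_sq: "(cmod (1 - w))\<^sup>2 = 1 + (cmod w)\<^sup>2 - 2 * Re w"
  by (simp only: cmod_power2) (simp add: power2_eq_square algebra_simps)

text \<open>With \<open>d = r - Re w\<close> one has |1 - w|^2 = (1 - r)^2 + 2d, and d \<le> 2r
  \<le> 1 allows the bound exp d \<le> 1 + 2d. The 1/2 in the exponent comes from the final square
  root.\<close>

lemma euler_factor_upper:
  fixes w :: complex and r :: real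
  assumes "cmod w = r" "0 \<le> r" "r \<le> 1 / 2"
  shows "1 - r \<le> cmod (1 - w) * exp (- (r - Re w) / 2)"
proof -
  define d where "d = r - Re w"
  have d: "0 \<le> d" "d \<le> 1" 
    using abs_Re_le_cmod[of w] assms by (auto simp: d_def)
  have "(cmod (1 - w))\<^sup>2 = (1 - r)\<^sup>2 + 2 * d"
    using assms(1) by (simp add: cmod_one_minus_sq d_def) (simp add: power2_eq_square algebra_simps)
  moreover have "(1 - r)\<^sup>2 * exp d \<le> (1 - r)\<^sup>2 + 2 * d"
  proof -
    have u: "(1 - r)\<^sup>2 \<le> 1" using assms by (simp add: power_le_one)
    have "(1 - r)\<^sup>2 * exp d \<le> (1 - r)\<^sup>2 * (1 + d + d\<^sup>2)"
      using exp_bound[of d] d by (intro mult_left_mono) auto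
    also have "\<dots> \<le> (1 - r)\<^sup>2 * (1 + 2 * d)"
      using d by (intro mult_left_mono) (auto simp: power2_eq_square mult_left_le)
    also have "\<dots> \<le> (1 - r)\<^sup>2 + 2 * d"
      using mult_right_mono[OF u, of "2 * d"] d by (simp add: algebra_simps)
    finally show ?thesis .
  qed
  ultimately have "(1 - r)\<^sup>2 \<le> (cmod (1 - w))\<^sup>2 * exp (-d)"
    by (simp add: exp_minus field_simps)
  also have "\<dots> = (cmod (1 - w) * exp (- d / 2))\<^sup>2"
    by (simp add: power_mult_distrib flip: exp_of_nat_mult)
  finally show ?thesis
    unfolding d_def by (rule power2_le_imp_le) auto
qed

text \<open>Here (1 - r)^2 \<ge> 1/4 turns the term 2d into at most 8d (1 - r)^2, and 1 + 8d \<le>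
  exp (8d); the square root leaves 4d.\<close>

lemma euler_factor_lower:
  fixes w :: complex and r :: real
  assumes "cmod w = r" "0 \<le> r" "r \<le> 1 / 2"
  shows "cmod (1 - w) \<le> (1 - r) * exp (4 * (r - Re w))"
proof -
  define d where "d = r - Re w"
  have d: "0 \<le> d" 
    using abs_Re_le_cmod[of w] assms by (auto simp: d_def)
  have "(cmod (1 - w))\<^sup>2 = (1 - r)\<^sup>2 + 2 * d"
    using assms(1) by (simp add: cmod_one_minus_sq d_def) (simp add: power2_eq_square algebra_simps)
  also have "\<dots> \<le> (1 - r)\<^sup>2 * (1 + 8 * d)"
  proof -
    have "(1/2)\<^sup>2 \<le> (1 - r)\<^sup>2" using assms by (intro power_mono) auto
    then have "1 / 4 * (8 * d) \<le> (1 - r)\<^sup>2 * (8 * d)" using d by (intro mult_right_mono) (auto simp: power2_eq_square)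
    then show ?thesis by (simp add: algebra_simps)
  qed
  also have "\<dots> \<le> (1 - r)\<^sup>2 * exp (8 * d)"
    using exp_ge_add_one_self[of "8 * d"] by (intro mult_left_mono) auto
  also have "\<dots> = ((1 - r) * exp (4 * d))\<^sup>2"
    by (simp add: power_mult_distrib flip: exp_of_nat_mult)
  finally show ?thesis
    unfolding d_def using assms by (intro power2_le_imp_le[of "cmod (1 - w)"]) auto
qed

section \<open>Dirichlet series on the half-plane of absolute convergence, and the pretentious
  distance\<close>

definition dterm :: "(nat \<Rightarrow> complex) \<Rightarrow> complex \<Rightarrow> nat \<Rightarrow> complex" where
  "dterm f s n = f n * of_nat n powr (- s)"

lemma cmod_nat_powr: "cmod (of_nat n powr s) = real n powr Re s"
  by (cases "n = 0") (auto simp: norm_powr_real_powr)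

lemma nat_powr_of_real: "complex_of_nat n powr (- of_real a) = of_real (real n powr (- a))"
  by (metis powr_of_real of_real_of_nat_eq of_real_minus of_nat_0_le_iff)

lemma cmod_dterm:
  assumes "unimodular_mult f" "n > 0"
  shows "cmod (dterm f s n) = real n powr (- Re s)"
  using assms by (simp add: dterm_def norm_mult cmod_nat_powr unimodular_mult_def)

lemma dterm_mult:
  assumes "unimodular_mult f" "m > 0" "n > 0"
  shows "dterm f s (m * n) = dterm f s m * dterm f s n"
  using assms by (simp add: dterm_def unimodular_mult_def powr_times_real)

lemma dterm_1: "unimodular_mult f \<Longrightarrow> dterm f s 1 = 1"
  by (simp add: dterm_def unimodular_mult_def)

lemma nat_powr_summable_on:
  assumes "a > 1"
  shows "(\<lambda>n. real n powr (- a)) summable_on {1..}"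
  by (rule summable_on_subset[of _ UNIV], rule summable_nonneg_imp_summable_on)
     (use assms summable_real_powr_iff[of "- a"] in auto)

lemma dterm_abs_summable:
  assumes "unimodular_mult f" "Re s > 1"
  shows "(\<lambda>n. cmod (dterm f s n)) summable_on {1..}"
  using nat_powr_summable_on[OF assms(2)]
  by (rule summable_on_cong[THEN iffD1, rotated]) (use assms cmod_dterm in auto)

definition dseries :: "(nat \<Rightarrow> complex) \<Rightarrow> complex \<Rightarrow> complex" where
  "dseries f s = infsum (dterm f s) {1..}"

definition rzeta :: "real \<Rightarrow> real" where
  "rzeta a = infsum (\<lambda>n. real n powr (- a)) {1..}"

lemma unimodular_mult_one: "unimodular_mult (\<lambda>_. 1)"
  by (simp add: unimodular_mult_def)

lemma dterm_one_of_real: "dterm (\<lambda>_. 1) (of_real a) n = of_real (real n powr (- a))"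
  by (simp add: dterm_def nat_powr_of_real)

lemma dseries_one_of_real:
  assumes "a > 1"
  shows "dseries (\<lambda>_. 1) (of_real a) = of_real (rzeta a)"
proof -
  have "dseries (\<lambda>_. 1) (of_real a) = infsum (\<lambda>n. complex_of_real (real n powr (- a))) {1..}"
    unfolding dseries_def by (intro infsum_cong) (simp add: dterm_one_of_real)
  then show ?thesis unfolding rzeta_def
    using has_sum_of_real[OF has_sum_infsum[OF nat_powr_summable_on[OF assms]], where 'a = complex]
    by (simp add: infsumI)
qed

lemma norm_dseries_le:
  assumes "unimodular_mult f" "Re s > 1"
  shows "cmod (dseries f s) \<le> rzeta (Re s)"
proof -
  have "cmod (dseries f s) \<le> infsum (\<lambda>n. cmod (dterm f s n)) {1..}"
    unfolding dseries_def by (rule norm_infsum_bound[OF dterm_abs_summable[OF assms]])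
  also have "\<dots> = rzeta (Re s)"
    unfolding rzeta_def by (intro infsum_cong) (use assms cmod_dterm in auto)
  finally show ?thesis .
qed

lemma rzeta_euler:
  assumes "a > 1"
  shows "(\<lambda>P. rzeta a * (\<Prod>p\<in>primes_le P. 1 - real p powr (- a))) \<longlonglongrightarrow> 1"
proof -
  have "(\<lambda>P. infsum (dterm (\<lambda>_. 1) (of_real a)) {1..} * (\<Prod>p\<in>primes_le P. 1 - dterm (\<lambda>_. 1) (of_real a) p)) \<longlonglongrightarrow> 1"
    by (rule euler_product) (use assms in \<open>auto simp: dterm_mult unimodular_mult_one dterm_1[unfolded One_nat_def] intro!: dterm_abs_summable[unfolded One_nat_def]\<close>)
  moreover have "infsum (dterm (\<lambda>_. 1) (of_real a)) {1..} * (\<Prod>p\<in>primes_le P. 1 - dterm (\<lambda>_. 1) (of_real a) p) =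
    of_real (rzeta a * (\<Prod>p\<in>primes_le P. 1 - real p powr (- a)))" for P
  proof -
    have "(\<Prod>p\<in>primes_le P. 1 - dterm (\<lambda>_. 1) (of_real a) p) = (\<Prod>p\<in>primes_le P. of_real (1 - real p powr (- a)))"
      by (intro prod.cong refl) (auto simp: dterm_one_of_real primes_le_def prime_gt_0_nat)
    then show ?thesis unfolding dseries_def[symmetric] dseries_one_of_real[OF assms] by simp
  qed
  ultimately have "(\<lambda>P. complex_of_real (rzeta a * (\<Prod>p\<in>primes_le P. 1 - real p powr (- a)))) \<longlonglongrightarrow> complex_of_real 1" by simp
  then show ?thesis by (simp only: tendsto_of_real_iff)
qed

lemma prime_powr_le_half: "prime p \<Longrightarrow> a \<ge> 1 \<Longrightarrow> real p powr (- a) \<le> 1 / 2"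
proof -
  assume p: "prime p" and a: "a \<ge> 1"
  then have p2: "real p \<ge> 2" using prime_ge_2_nat[of p] by simp
  have "real p powr (- a) \<le> real p powr (- 1)" using p2 a by (intro powr_mono) auto
  also have "\<dots> \<le> 1 / 2" using p2 by (simp add: powr_minus field_simps)
  finally show ?thesis .
qed

lemma rzeta_ge_1: "a > 1 \<Longrightarrow> rzeta a \<ge> 1"
  using finite_sum_le_infsum[OF nat_powr_summable_on, of a "{1}"] by (simp add: rzeta_def)

text \<open>For unit values |1 - w|^2 = 2 (1 - Re w), so the sum over primes is a smoothed form of
  twice the squared pretentious distance between \<open>f\<close> and n^(iy), where y is
  \<open>Im s\<close>.\<close>

abbreviation pretentious_term :: "(nat \<Rightarrow> complex) \<Rightarrow> complex \<Rightarrow> nat \<Rightarrow> real" where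
  "pretentious_term f s p \<equiv> real p powr (- Re s) * (cmod (1 - f p * of_nat p powr (- (\<i> * Im s))))\<^sup>2"

lemma euler_diff_eq:
  assumes "unimodular_mult f" "p > 0" 
  shows "cmod (dterm f s p) - Re (dterm f s p) = 1/2 * pretentious_term f s p"
proof -
  define w where "w = f p * of_nat p powr (- (\<i> * Im s))"
  have nw: "cmod w = 1" using assms by (simp add: w_def norm_mult cmod_nat_powr unimodular_mult_def)
  have "s = of_real (Re s) + \<i> * Im s" by (simp add: complex_eq_iff)
  then have "of_nat p powr (- s) = of_nat p powr (- of_real (Re s)) * of_nat p powr (- (\<i> * Im s))"
    by (metis minus_add_distrib powr_add)
  also have "of_nat p powr (- of_real (Re s)) = complex_of_real (real p powr (- Re s))"
    using assms by (simp add: powr_of_real[symmetric])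
  finally have "dterm f s p = of_real (real p powr (- Re s)) * w"
    by (simp add: dterm_def w_def)
  then have "cmod (dterm f s p) - Re (dterm f s p) = real p powr (- Re s) * (1 - Re w)"
    using nw by (simp add: norm_mult algebra_simps)
  moreover have "(cmod (1 - w))\<^sup>2 = 2 * (1 - Re w)"
    using nw by (simp add: cmod_one_minus_sq)
  ultimately show ?thesis by (simp add: w_def)
qed

definition pretentious_sum :: "(nat \<Rightarrow> complex) \<Rightarrow> complex \<Rightarrow> nat \<Rightarrow> real" where
  "pretentious_sum f s P = (\<Sum>p\<in>primes_le P. pretentious_term f s p)"

lemma pretentious_sum_mono: "P \<le> Q \<Longrightarrow> pretentious_sum f s P \<le> pretentious_sum f s Q"
  unfolding pretentious_sum_def by (intro sum_mono2) (auto simp: primes_le_def)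

lemma norm_euler_product:
  assumes f: "unimodular_mult f" and s: "Re s > 1"
  shows "(\<lambda>P. cmod (dseries f s) * (\<Prod>p\<in>primes_le P. cmod (1 - dterm f s p))) \<longlonglongrightarrow> 1"
proof -
  have "(\<lambda>P. infsum (dterm f s) {1..} * (\<Prod>p\<in>primes_le P. 1 - dterm f s p)) \<longlonglongrightarrow> 1"
    by (rule euler_product) (use f s in \<open>auto simp: dterm_mult dterm_1[unfolded One_nat_def] intro!: dterm_abs_summable[unfolded One_nat_def]\<close>)
  from tendsto_norm[OF this] show ?thesis
    by (simp add: norm_mult dseries_def prod_norm)
qed

text \<open>Each Euler factor is compared with that of zeta at \<open>Re s\<close>. The 1/4 is the
  product of the 1/2 in \<open>euler_factor_upper\<close> and the 1/2 in
  \<open>euler_diff_eq\<close>. Primes beyond \<open>P\<close> can only improve the bound, so a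
  truncated sum suffices.\<close>

lemma norm_dseries_le_pretentious:
  assumes f: "unimodular_mult f" and s: "Re s > 1"
  shows "cmod (dseries f s) \<le> rzeta (Re s) * exp (- pretentious_sum f s P / 4)"
proof -
  define T where "T = cmod (dseries f s)"
  note euler = norm_euler_product[OF f s, folded T_def]
  have "\<forall>\<^sub>F Q in sequentially. T * (rzeta (Re s) * (\<Prod>p\<in>primes_le Q. 1 - real p powr (- Re s))) \<le>
     rzeta (Re s) * exp (- pretentious_sum f s P / 4) * (T * (\<Prod>p\<in>primes_le Q. cmod (1 - dterm f s p)))"
    using eventually_ge_at_top[of P]
  proof eventually_elim
    case (elim Q)
    have "(\<Prod>p\<in>primes_le Q. 1 - real p powr (- Re s)) \<le>
       (\<Prod>p\<in>primes_le Q. cmod (1 - dterm f s p) * exp (- (1/2 * pretentious_term f s p) / 2))"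
    proof (intro prod_mono conjI)
      fix p assume "p \<in> primes_le Q"
      then have p: "prime p" "p > 0" by (auto simp: primes_le_def prime_gt_0_nat)
      have half: "real p powr (- Re s) \<le> 1 / 2" using prime_powr_le_half[of p "Re s"] p s by simp
      then show "0 \<le> 1 - real p powr (- Re s)" by simp
      show "1 - real p powr (- Re s) \<le> cmod (1 - dterm f s p) * exp (- (1/2 * pretentious_term f s p) / 2)"
        using euler_factor_upper[of "dterm f s p" "real p powr (- Re s)"] half p f
        unfolding euler_diff_eq[OF f p(2), symmetric] by (simp add: cmod_dterm)
    qed
    also have "\<dots> = (\<Prod>p\<in>primes_le Q. cmod (1 - dterm f s p)) * exp (- pretentious_sum f s Q / 4)"
    proof -
      have "(\<Sum>p\<in>primes_le Q. - (1/2 * pretentious_term f s p) / 2) = - pretentious_sum f s Q / 4"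
        unfolding pretentious_sum_def sum_negf[symmetric] sum_divide_distrib by (intro sum.cong) auto
      then show ?thesis unfolding prod.distrib exp_sum[OF finite_primes_le, symmetric] by simp
    qed
    also have "\<dots> \<le> (\<Prod>p\<in>primes_le Q. cmod (1 - dterm f s p)) * exp (- pretentious_sum f s P / 4)"
      using pretentious_sum_mono[OF elim] by (intro mult_left_mono prod_nonneg) auto
    finally have "(rzeta (Re s) * T) * (\<Prod>p\<in>primes_le Q. 1 - real p powr (- Re s)) \<le>
        (rzeta (Re s) * T) * ((\<Prod>p\<in>primes_le Q. cmod (1 - dterm f s p)) * exp (- pretentious_sum f s P / 4))"
      using rzeta_ge_1[OF s] by (intro mult_left_mono) (auto simp: T_def)
    then show ?case by (simp add: mult_ac)
  qed
  from tendsto_le[OF _ tendsto_mult[OF tendsto_const euler] tendsto_mult[OF tendsto_const rzeta_euler[OF s]] this]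
  show ?thesis by (simp add: T_def)
qed

text \<open>The comparison in the other direction; the exponent 2 is 4 times 1/2. It is meant for
  the constant function 1 at a complex argument, where it forces zeta to be large off the real
  axis.\<close>

lemma rzeta_le_pretentious:
  assumes f: "unimodular_mult f" and s: "Re s > 1" and D: "\<And>P. pretentious_sum f s P \<le> D"
  shows "rzeta (Re s) \<le> cmod (dseries f s) * exp (2 * D)"
proof -
  define T where "T = cmod (dseries f s)"
  note euler = norm_euler_product[OF f s, folded T_def]
  have "\<forall>\<^sub>F Q in sequentially. rzeta (Re s) * (T * (\<Prod>p\<in>primes_le Q. cmod (1 - dterm f s p))) \<le>
     T * exp (2 * D) * (rzeta (Re s) * (\<Prod>p\<in>primes_le Q. 1 - real p powr (- Re s)))"
  proof (rule always_eventually, rule allI)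
    fix Q
    have "(\<Prod>p\<in>primes_le Q. cmod (1 - dterm f s p)) \<le>
       (\<Prod>p\<in>primes_le Q. (1 - real p powr (- Re s)) * exp (4 * (1/2 * pretentious_term f s p)))"
    proof (intro prod_mono conjI)
      fix p assume "p \<in> primes_le Q"
      then have p: "prime p" "p > 0" by (auto simp: primes_le_def prime_gt_0_nat)
      have half: "real p powr (- Re s) \<le> 1 / 2" using prime_powr_le_half[of p "Re s"] p s by simp
      show "cmod (1 - dterm f s p) \<le> (1 - real p powr (- Re s)) * exp (4 * (1/2 * pretentious_term f s p))"
        using euler_factor_lower[of "dterm f s p" "real p powr (- Re s)"] half p f
        unfolding euler_diff_eq[OF f p(2), symmetric] by (simp add: cmod_dterm)
    qed auto
    also have "\<dots> = (\<Prod>p\<in>primes_le Q. 1 - real p powr (- Re s)) * exp (2 * pretentious_sum f s Q)"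
    proof -
      have "(\<Sum>p\<in>primes_le Q. 4 * (1/2 * pretentious_term f s p)) = 2 * pretentious_sum f s Q"
        unfolding pretentious_sum_def sum_distrib_left by (intro sum.cong) auto
      then show ?thesis unfolding prod.distrib exp_sum[OF finite_primes_le, symmetric] by simp
    qed
    also have "\<dots> \<le> (\<Prod>p\<in>primes_le Q. 1 - real p powr (- Re s)) * exp (2 * D)"
    proof (intro mult_left_mono prod_nonneg)
      fix p assume "p \<in> primes_le Q"
      then show "0 \<le> 1 - real p powr (- Re s)" using prime_powr_le_half[of p "Re s"] s by (auto simp: primes_le_def)
    qed (use D[of Q] in auto)
    finally have "(rzeta (Re s) * T) * (\<Prod>p\<in>primes_le Q. cmod (1 - dterm f s p)) \<le>
        (rzeta (Re s) * T) * ((\<Prod>p\<in>primes_le Q. 1 - real p powr (- Re s)) * exp (2 * D))"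
      using rzeta_ge_1[OF s] by (intro mult_left_mono) (auto simp: T_def)
    then show "rzeta (Re s) * (T * (\<Prod>p\<in>primes_le Q. cmod (1 - dterm f s p))) \<le>
     T * exp (2 * D) * (rzeta (Re s) * (\<Prod>p\<in>primes_le Q. 1 - real p powr (- Re s)))" by (simp add: mult_ac)
  qed
  from tendsto_le[OF _ tendsto_mult[OF tendsto_const rzeta_euler[OF s]] tendsto_mult[OF tendsto_const euler] this]
  show ?thesis by (simp add: T_def)
qed

text \<open>The partial products times \<open>rzeta a\<close> decrease to 1 and are therefore at
  least 1; then 1 - x \<le> exp (-x) is applied to each factor.\<close>

lemma exp_prime_sum_le_rzeta:
  assumes a: "a > 1"
  shows "exp (\<Sum>p\<in>primes_le P. real p powr (- a)) \<le> rzeta a"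
proof -
  have half: "real p powr (- a) \<le> 1 / 2" if "p \<in> primes_le P" for p P
    using prime_powr_le_half[of p a] a that by (simp add: primes_le_def)
  have "1 \<le> rzeta a * (\<Prod>p\<in>primes_le P. 1 - real p powr (- a))"
  proof (rule decseq_ge[OF _ rzeta_euler[OF a]])
    show "decseq (\<lambda>P. rzeta a * (\<Prod>p\<in>primes_le P. 1 - real p powr (- a)))"
    proof (rule decseq_SucI)
      fix P
      have nn: "0 \<le> rzeta a * (\<Prod>p\<in>primes_le P. 1 - real p powr (- a))"
      proof (intro mult_nonneg_nonneg prod_nonneg)
        fix p assume "p \<in> primes_le P"
        then show "0 \<le> 1 - real p powr (- a)" using half[of p P] by simp
      qed (use rzeta_ge_1[OF a] in auto)
      show "rzeta a * (\<Prod>p\<in>primes_le (Suc P). 1 - real p powr (- a)) \<le> rzeta a * (\<Prod>p\<in>primes_le P. 1 - real p powr (- a))"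
      proof (cases "prime (Suc P)")
        case True
        then have "real (Suc P) powr (- a) \<le> 1 / 2" using prime_powr_le_half[of "Suc P" a] a by simp
        then have "(1 - real (Suc P) powr (- a)) * (rzeta a * (\<Prod>p\<in>primes_le P. 1 - real p powr (- a))) \<le> rzeta a * (\<Prod>p\<in>primes_le P. 1 - real p powr (- a))"
          using nn by (intro mult_left_le_one_le) auto
        then show ?thesis using True by (simp add: primes_le_Suc mult_ac del: of_nat_Suc)
      qed (simp add: primes_le_Suc)
    qed
  qed
  also have "\<dots> \<le> rzeta a * (\<Prod>p\<in>primes_le P. exp (- (real p powr (- a))))"
  proof (intro mult_left_mono prod_mono conjI)
    fix p assume "p \<in> primes_le P"
    then show "0 \<le> 1 - real p powr (- a)" using half[of p P] by simp
    show "1 - real p powr (- a) \<le> exp (- (real p powr (- a)))"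
      using exp_ge_add_one_self[of "- (real p powr (- a))"] by simp
  qed (use rzeta_ge_1[OF a] in auto)
  also have "\<dots> = rzeta a * exp (- (\<Sum>p\<in>primes_le P. real p powr (- a)))"
    unfolding exp_sum[OF finite_primes_le, symmetric] by (simp add: sum_negf)
  finally show ?thesis by (simp add: exp_minus field_simps)
qed

subsection \<open>Bounds for the zeta function\<close>

lemma powr_diff_bounds:
  fixes \<sigma> :: real and n :: nat
  assumes "\<sigma> > 0" "n > 0"
  shows "(real (Suc n) powr (- \<sigma>) + \<sigma> * real (Suc n) powr (- 1 - \<sigma>)) \<le> real n powr (- \<sigma>)" (is ?A)
    and "real n powr (- \<sigma>) \<le> real (Suc n) powr (- \<sigma>) + \<sigma> * real n powr (- 1 - \<sigma>)" (is ?B)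
proof -
  have der: "\<exists>z. real n < z \<and> z < real (Suc n) \<and>
     real (Suc n) powr (- \<sigma>) - real n powr (- \<sigma>) = (real (Suc n) - real n) * (- \<sigma> * z powr (- \<sigma> - 1))"
    by (rule MVT2) (use assms in \<open>auto intro!: derivative_eq_intros\<close>)
  then obtain z where z: "real n < z" "z < real (Suc n)"
    "real (Suc n) powr (- \<sigma>) - real n powr (- \<sigma>) = - \<sigma> * z powr (- \<sigma> - 1)" by auto
  have e: "- 1 - \<sigma> = - \<sigma> - 1" by simp
  have "real (Suc n) powr (- 1 - \<sigma>) \<le> z powr (- \<sigma> - 1)" 
    unfolding e by (rule powr_mono2') (use z assms in auto)
  moreover have "z powr (- \<sigma> - 1) \<le> real n powr (- 1 - \<sigma>)" 
    unfolding e by (rule powr_mono2') (use z assms in auto)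
  ultimately show ?A ?B using z(3) assms(1) by (auto simp: algebra_simps)
      (smt (verit) mult_left_mono mult.commute)+
qed

lemma powr_tendsto_0: "\<sigma> > 0 \<Longrightarrow> (\<lambda>n. real n powr (- \<sigma>)) \<longlonglongrightarrow> 0"
  by (intro tendsto_neg_powr filterlim_real_sequentially) auto

lemma sum_powr_le:
  assumes "\<sigma> > 0"
  shows "(\<Sum>n=1..X. real n powr (- 1 - \<sigma>)) \<le> 1 + 1 / \<sigma>"
proof -
  \<comment> \<open>The subtracted term is what makes the bound inductive: its increments dominate
    the new summands.\<close>
  have "(\<Sum>n=1..X. real n powr (- 1 - \<sigma>)) \<le> 1 + 1 / \<sigma> - real X powr (- \<sigma>) / \<sigma>" if "X > 0" for X
    using that
  proof (induction X rule: nat_induct_non_zero)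
    case (Suc n)
    have "\<sigma> * real (Suc n) powr (- 1 - \<sigma>) \<le> real n powr (- \<sigma>) - real (Suc n) powr (- \<sigma>)"
      using powr_diff_bounds(1)[OF assms, of n] Suc by simp
    then have "real (Suc n) powr (- 1 - \<sigma>) \<le> real n powr (- \<sigma>) / \<sigma> - real (Suc n) powr (- \<sigma>) / \<sigma>"
      using assms by (simp add: field_simps)
    with Suc show ?case by simp
  qed simp
  from this[of X] show ?thesis using assms
    by (cases "X = 0") (auto simp: add_nonneg_nonneg intro: order_trans)
qed

lemma rzeta_le: 
  assumes "\<sigma> > 0"
  shows "rzeta (1 + \<sigma>) \<le> 1 + 1 / \<sigma>"
proof (rule LIMSEQ_le_const2)
  show "(\<lambda>X. \<Sum>n=1..X. real n powr (- (1 + \<sigma>))) \<longlonglongrightarrow> rzeta (1 + \<sigma>)"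
    unfolding rzeta_def by (rule sum_tendsto_infsum) (use nat_powr_summable_on[of "1 + \<sigma>"] assms in simp)
  show "\<exists>N. \<forall>n\<ge>N. (\<Sum>n=1..n. real n powr (- (1 + \<sigma>))) \<le> 1 + 1 / \<sigma>"
    using sum_powr_le[OF assms] by simp
qed

lemma rzeta_ge: 
  assumes "\<sigma> > 0"
  shows "1 / \<sigma> \<le> rzeta (1 + \<sigma>)"
proof (rule LIMSEQ_le)
  show "(\<lambda>X. \<Sum>n=1..X. real n powr (- (1 + \<sigma>))) \<longlonglongrightarrow> rzeta (1 + \<sigma>)"
    unfolding rzeta_def by (rule sum_tendsto_infsum) (use nat_powr_summable_on[of "1 + \<sigma>"] assms in simp)
  have "(\<lambda>X. (1 - real (Suc X) powr (- \<sigma>)) / \<sigma>) \<longlonglongrightarrow> (1 - 0) / \<sigma>"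
    using assms by (intro tendsto_divide tendsto_diff tendsto_const LIMSEQ_Suc[OF powr_tendsto_0[OF assms]]) auto
  then show "(\<lambda>X. (1 - real (Suc X) powr (- \<sigma>)) / \<sigma>) \<longlonglongrightarrow> 1 / \<sigma>" by simp
  have "(1 - real (Suc X) powr (- \<sigma>)) / \<sigma> \<le> (\<Sum>n=1..X. real n powr (- 1 - \<sigma>))" for X
  proof (induction X)
    case (Suc X)
    have "(real (Suc X) powr (- \<sigma>) - real (Suc (Suc X)) powr (- \<sigma>)) / \<sigma> \<le> real (Suc X) powr (- 1 - \<sigma>)"
      using powr_diff_bounds(2)[OF assms, of "Suc X"] assms by (simp add: field_simps del: of_nat_Suc)
    with Suc show ?case by (simp add: diff_divide_distrib del: of_nat_Suc)
  qed simp
  then show "\<exists>N. \<forall>n\<ge>N. (1 - real (Suc n) powr (- \<sigma>)) / \<sigma> \<le> (\<Sum>n=1..n. real n powr (- (1 + \<sigma>)))" by simp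
qed

text \<open>Each term \<open>n\<^sup>-\<^sup>s\<close> is compared with the integral of \<open>x\<^sup>-\<^sup>s\<close> over \<open>{n..n+1}\<close>, which telescopes to \<open>1 / (s - 1)\<close>.\<close>

lemma dirichlet_term_integral_bound:
  fixes s :: complex and n :: nat
  assumes s: "Re s > 1" and n: "n > 0"
  shows "cmod (of_nat n powr (- s) - (of_nat n powr (1 - s) - of_nat (Suc n) powr (1 - s)) / (s - 1)) \<le> cmod s * real n powr (- 2)"
proof -
  define C where "C = closed_segment (complex_of_nat n) (complex_of_nat (Suc n))"
  have cC: "convex C" unfolding C_def by (rule convex_closed_segment)
  have xC: "\<exists>x. real n \<le> x \<and> x \<le> real n + 1 \<and> z = complex_of_real x" if "z \<in> C" for z
  proof -
    from that obtain u where u: "0 \<le> u" "u \<le> 1" "z = (1 - u) *\<^sub>R of_nat n + u *\<^sub>R of_nat (Suc n)"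
      by (auto simp: C_def closed_segment_def)
    then have "z = complex_of_real (real n + u)"
      by (simp add: scaleR_conv_of_real algebra_simps)
    with u show ?thesis by (intro exI[of _ "real n + u"]) auto
  qed
  have nC: "complex_of_nat n \<in> C" "complex_of_nat (Suc n) \<in> C" by (auto simp: C_def)
  have nonneg: "z \<notin> \<real>\<^sub>\<le>\<^sub>0" "z \<noteq> 0" if "z \<in> C" for z
    using xC[OF that] n by (auto simp: complex_nonpos_Reals_iff)
  have b1: "cmod (z powr (- s) - of_nat n powr (- s)) \<le> cmod s * real n powr (- 2)" if z: "z \<in> C" for z
  proof -
    have "cmod (z powr (- s) - of_nat n powr (- s)) \<le> (cmod s * real n powr (- 2)) * cmod (z - of_nat n)"
    proof (rule field_differentiable_bound[OF cC _ _ z nC(1)])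
      fix w assume w: "w \<in> C"
      then show "((\<lambda>z. z powr (- s)) has_field_derivative (- s * w powr (- s - 1))) (at w within C)"
        using nonneg[OF w] by (auto intro!: derivative_eq_intros)
      obtain x where x: "real n \<le> x" "w = complex_of_real x" using xC[OF w] by auto
      have "cmod (- s * w powr (- s - 1)) = cmod s * x powr (- Re s - 1)"
        using x n by (simp add: norm_mult norm_powr_real_powr)
      also have "\<dots> \<le> cmod s * real n powr (- 2)"
      proof (intro mult_left_mono)
        have "x powr (- Re s - 1) \<le> x powr (- 2)" using x n s by (intro powr_mono) auto
        also have "\<dots> \<le> real n powr (- 2)" using x n by (intro powr_mono2') auto
        finally show "x powr (- Re s - 1) \<le> real n powr (- 2)" .
      qed auto
      finally show "cmod (- s * w powr (- s - 1)) \<le> cmod s * real n powr (- 2)" .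
    qed
    also have "\<dots> \<le> (cmod s * real n powr (- 2)) * 1"
    proof (intro mult_left_mono)
      obtain x where x: "real n \<le> x" "x \<le> real n + 1" "z = complex_of_real x" using xC[OF z] by auto
      have "z - of_nat n = complex_of_real (x - real n)" using x by simp
      then have "cmod (z - of_nat n) = \<bar>x - real n\<bar>" by (metis norm_of_real real_norm_def)
      then show "cmod (z - of_nat n) \<le> 1" using x by simp
    qed auto
    finally show ?thesis by simp
  qed
  \<comment> \<open>A primitive of the difference bounded in \<open>b1\<close>. Up to sign, its
    increment along the segment is the quantity to be estimated.\<close>
  define \<phi> where "\<phi> = (\<lambda>z. z powr (1 - s) / (1 - s) - z * of_nat n powr (- s))"
  have s1: "1 - s \<noteq> 0" "s - 1 \<noteq> 0" using s by auto
  have "cmod (\<phi> (of_nat (Suc n)) - \<phi> (of_nat n)) \<le> (cmod s * real n powr (- 2)) * cmod (of_nat (Suc n) - of_nat n)"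
  proof (rule field_differentiable_bound[OF cC _ _ nC(2) nC(1)])
    fix w assume w: "w \<in> C"
    show "(\<phi> has_field_derivative (w powr (- s) - of_nat n powr (- s))) (at w within C)"
      unfolding \<phi>_def using nonneg[OF w] s1 by (auto intro!: derivative_eq_intros)
    show "cmod (w powr (- s) - of_nat n powr (- s)) \<le> cmod s * real n powr (- 2)" by (rule b1[OF w])
  qed
  moreover have "\<phi> (of_nat (Suc n)) - \<phi> (of_nat n) = - (of_nat n powr (- s) - (of_nat n powr (1 - s) - of_nat (Suc n) powr (1 - s)) / (s - 1))"
  proof -
    have "x / (1 - s) = - (x / (s - 1))" for x by (metis minus_diff_eq minus_divide_right)
    then show ?thesis unfolding \<phi>_def by (simp only:) (simp add: algebra_simps diff_divide_distrib)
  qed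
  ultimately show ?thesis by (simp only: norm_minus_cancel) simp
qed

text \<open>The telescoped integrals give 1/(s - 1), and the errors |s| n^(-2) sum to at most 2 |s|.
  For bounded ordinates much larger than \<open>Re s - 1\<close> this is far below the size of zeta
  on the real axis, which is the use made of it.\<close>

lemma norm_zeta_le:
  assumes s: "Re s > 1"
  shows "cmod (dseries (\<lambda>_. 1) s) \<le> 1 / cmod (s - 1) + 2 * cmod s"
proof (rule LIMSEQ_le)
  show "(\<lambda>X. cmod (\<Sum>n=1..X. dterm (\<lambda>_. 1) s n)) \<longlonglongrightarrow> cmod (dseries (\<lambda>_. 1) s)"
    unfolding dseries_def
    by (rule tendsto_norm, rule sum_tendsto_infsum, rule abs_summable_summable, rule dterm_abs_summable[OF unimodular_mult_one s])
  have "cmod (\<Sum>n=1..X. dterm (\<lambda>_. 1) s n) \<le> 1 / cmod (s - 1) + 2 * cmod s + 1 / cmod (s - 1) * real (Suc X) powr (1 - Re s)" for X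
  proof -
    have tele: "(\<Sum>n=1..X. (of_nat n powr (1 - s) - of_nat (Suc n) powr (1 - s)) / (s - 1)) = (1 - of_nat (Suc X) powr (1 - s)) / (s - 1)"
    proof (induction X)
      case (Suc X)
      then show ?case by (simp add: diff_divide_distrib del: of_nat_Suc)
    qed simp
    have "(\<Sum>n=1..X. dterm (\<lambda>_. 1) s n) = (1 - of_nat (Suc X) powr (1 - s)) / (s - 1) + 
       (\<Sum>n=1..X. of_nat n powr (- s) - (of_nat n powr (1 - s) - of_nat (Suc n) powr (1 - s)) / (s - 1))"
      unfolding tele[symmetric] sum.distrib[symmetric] by (simp add: dterm_def)
    also have "cmod \<dots> \<le> cmod ((1 - of_nat (Suc X) powr (1 - s)) / (s - 1)) + (\<Sum>n=1..X. cmod s * real n powr (- 2))"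
      by (intro norm_triangle_mono order_refl sum_norm_le dirichlet_term_integral_bound s) auto
    also have "cmod ((1 - of_nat (Suc X) powr (1 - s)) / (s - 1)) \<le> (1 + real (Suc X) powr (1 - Re s)) / cmod (s - 1)"
      using norm_triangle_ineq4[of 1 "of_nat (Suc X) powr (1 - s)"]
      by (auto simp: norm_divide cmod_nat_powr intro!: divide_right_mono simp del: of_nat_Suc)
    also have "(\<Sum>n=1..X. cmod s * real n powr (- 2)) \<le> cmod s * 2"
      using sum_powr_le[of 1 X] by (auto simp flip: sum_distrib_left intro!: mult_left_mono)
    finally show ?thesis by (simp add: add_divide_distrib)
  qed
  then show "\<exists>N. \<forall>X\<ge>N. cmod (\<Sum>n=1..X. dterm (\<lambda>_. 1) s n) \<le>
     1 / cmod (s - 1) + 2 * cmod s + 1 / cmod (s - 1) * real (Suc X) powr (- (Re s - 1))" by simp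
  have "(\<lambda>n. 1 / cmod (s - 1) + 2 * cmod s + 1 / cmod (s - 1) * real (Suc n) powr (- (Re s - 1))) \<longlonglongrightarrow> 1 / cmod (s - 1) + 2 * cmod s + 1 / cmod (s - 1) * 0"
    using s by (intro tendsto_mult tendsto_add tendsto_const LIMSEQ_Suc[OF powr_tendsto_0]) auto
  then show "(\<lambda>n. 1 / cmod (s - 1) + 2 * cmod s + 1 / cmod (s - 1) * real (Suc n) powr (- (Re s - 1))) \<longlonglongrightarrow> 1 / cmod (s - 1) + 2 * cmod s"
    by simp
qed

subsection \<open>Multiplicative functions with finitely many values on the primes\<close>

lemma cmod_exp_i_minus_1: "cmod (exp (\<i> * of_real x) - 1) \<le> \<bar>x\<bar>"
  using iexp_approx1[of x 0] by simp

text \<open>Simultaneous Dirichlet approximation, applied to the arguments divided by 2 pi. The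
  point is the order of quantifiers: the bound \<open>M\<close> on the exponent depends on
  \<open>R\<close> and \<epsilon> alone.\<close>

lemma unit_powers_near_one:
  fixes R :: "'i set"
  assumes "finite R" "\<epsilon> > 0"
  obtains M :: nat where "\<And>z :: 'i \<Rightarrow> complex. (\<And>r. r \<in> R \<Longrightarrow> cmod (z r) = 1) \<Longrightarrow>
    \<exists>m. 0 < m \<and> m \<le> M \<and> (\<forall>r\<in>R. cmod (z r ^ m - 1) \<le> \<epsilon>)"
proof -
  obtain h where h: "bij_betw h {..<card R} R"
    using ex_bij_betw_nat_finite[OF assms(1)] by (auto simp: atLeast0LessThan)
  obtain N :: nat where N: "2 * pi / \<epsilon> < real N" using reals_Archimedean2 by blast
  then have N0: "N > 0" using assms(2) by (auto intro!: Nat.gr0I simp: not_less) (smt (verit) divide_pos_pos pi_gt_zero)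
  have N1: "2 * pi * (1 / real N) \<le> \<epsilon>" using N N0 assms(2) by (simp add: field_simps)
  have "\<exists>m. 0 < m \<and> m \<le> N ^ card R \<and> (\<forall>r\<in>R. cmod (z r ^ m - 1) \<le> \<epsilon>)"
    if z: "\<And>r. r \<in> R \<Longrightarrow> cmod (z r) = 1" for z :: "'i \<Rightarrow> complex"
  proof -
    define \<theta> where "\<theta> = (\<lambda>i. Arg (z (h i)) / (2 * pi))"
    obtain q p where q: "0 < q" "q \<le> int (N ^ card R)" 
      and qp: "\<And>i. i < card R \<Longrightarrow> \<bar>of_int q * \<theta> i - of_int (p i)\<bar> < 1 / N"
      using Dirichlet_approx_simult[OF N0, of "card R" \<theta>] by blast
    have "cmod (z r ^ nat q - 1) \<le> \<epsilon>" if "r \<in> R" for r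
    proof -
      obtain i where i: "i < card R" "r = h i" using h \<open>r \<in> R\<close> by (auto simp: bij_betw_def)
      define x where "x = 2 * pi * (of_int q * \<theta> i - of_int (p i))"
      have "z r = exp (\<i> * Arg (z r))"
        using z[OF that] Arg_eq[of "z r"] by force
      then have "z r ^ nat q = exp (\<i> * of_real (of_int q * Arg (z r)))"
        using q(1) by (metis (no_types, lifting) exp_of_nat_mult mult.left_commute of_int_of_nat_eq of_nat_nat of_real_mult of_real_of_int_eq order_less_imp_le)
      also have "of_int q * Arg (z r) = x + 2 * pi * of_int (p i)"
        unfolding x_def \<theta>_def i(2) by (simp add: algebra_simps)
      also have "exp (\<i> * of_real (x + 2 * pi * of_int (p i))) = exp (\<i> * of_real x) * exp (2 * of_int (p i) * of_real pi * \<i>)"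
        unfolding exp_add[symmetric] by (simp add: algebra_simps)
      also have "exp (2 * of_int (p i) * of_real pi * \<i>) = 1" by (auto simp: exp_eq_1)
      finally have "cmod (z r ^ nat q - 1) \<le> \<bar>x\<bar>" using cmod_exp_i_minus_1[of x] by simp
      also have "\<dots> \<le> 2 * pi * (1 / real N)"
        using qp[OF i(1)] unfolding x_def abs_mult by (intro mult_mono) auto
      finally show ?thesis using N1 by linarith
    qed
    then show ?thesis using q by (intro exI[of _ "nat q"]) (auto simp: nat_le_iff)
  qed
  then show ?thesis by (rule that)
qed

lemma cmod_one_minus_power_le: "cmod w = 1 \<Longrightarrow> cmod (1 - w ^ m) \<le> real m * cmod (1 - w)"
proof (induction m)
  case (Suc m)
  have "1 - w ^ Suc m = (1 - w) + w * (1 - w ^ m)" by (simp add: algebra_simps)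
  then have "cmod (1 - w ^ Suc m) \<le> cmod (1 - w) + cmod (w * (1 - w ^ m))" by (metis norm_triangle_ineq)
  also have "cmod (w * (1 - w ^ m)) = cmod (1 - w ^ m)" by (simp only: norm_mult Suc.prems mult_1)
  finally show ?case using Suc.IH[OF Suc.prems] by (simp only: of_nat_Suc distrib_right mult_1)
qed auto

lemma nat_powr_imaginary: "p > 0 \<Longrightarrow> of_nat p powr (- (\<i> * of_real y)) = exp (\<i> * of_real (- y * ln (real p)))"
  by (simp add: powr_def mult_ac flip: Ln_of_nat)

lemma unbounded_sum_if_not_summable:
  fixes g :: "'i \<Rightarrow> real"
  assumes "\<not> g summable_on A" "\<And>x. x \<in> A \<Longrightarrow> g x \<ge> 0"
  obtains B where "finite B" "B \<subseteq> A" "sum g B \<ge> K"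
proof -
  have "\<not> bdd_above (sum g ` {F. F \<subseteq> A \<and> finite F})"
    using nonneg_bdd_above_summable_on[of A g] assms by blast
  then show ?thesis using that unfolding bdd_above_def by (auto simp: not_le) (meson less_imp_le not_le)
qed

text \<open>If \<open>f\<close> pretended to be \<open>n\<^sup>i\<^sup>y\<close>, then a bounded power of \<open>f\<close>, which is close to \<open>1\<close> on the
  primes because \<open>f\<close> takes finitely many values there, would make \<open>n\<^sup>i\<^sup>m\<^sup>y\<close> close to \<open>1\<close> and
  \<open>\<zeta> (1 + \<sigma> + i m y)\<close> as large as \<open>\<zeta> (1 + \<sigma>)\<close>.\<close>

lemma dseries_uniform_bound:
  fixes \<rho> :: "nat \<Rightarrow> 'i"
  assumes fin: "finite (\<rho> ` {p. prime p})"
    and div: "\<not> (\<lambda>p. 1 / real p) summable_on {p. prime p \<and> \<rho> p = r}"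
    and c: "c > 0" and T: "T > 0" and \<eta>: "\<eta> > 0"
  obtains \<sigma>0 :: real where "\<sigma>0 > 0"
    "\<And>\<sigma> y f z. \<lbrakk>0 < \<sigma>; \<sigma> < \<sigma>0; unimodular_mult f; \<And>p. prime p \<Longrightarrow> f p = z (\<rho> p); cmod (z r - 1) \<ge> c; \<bar>y\<bar> \<le> T\<rbrakk>
      \<Longrightarrow> cmod (dseries f (Complex (1 + \<sigma>) y)) \<le> \<eta> / \<sigma>"
proof -
  \<comment> \<open>A pretentious sum of at least \<open>K\<close> brings the series down to
    (2/\<sigma>) exp (-K/4) \<le> \<eta>/\<sigma>; what remains is to find such a sum.\<close>
  define K where "K = max 1 (4 * ln (2 / \<eta>))"
  have K: "K \<ge> 1" "2 * exp (- K / 4) \<le> \<eta>"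
  proof -
    show "K \<ge> 1" by (simp add: K_def)
    have "ln (2 / \<eta>) \<le> K / 4" by (simp add: K_def)
    then have "2 / \<eta> \<le> exp (K / 4)" using \<eta> by (metis exp_ln exp_le_cancel_iff divide_pos_pos zero_less_numeral)
    then show "2 * exp (- K / 4) \<le> \<eta>" using \<eta> by (simp add: exp_minus field_simps)
  qed
  \<comment> \<open>The constant anticipates two losses: p^(-\<sigma>) \<ge> 1/e costs the factor
    \<open>exp 1\<close>, and |1 - f p w p| \<ge> c/2 costs 4/c^2.\<close>
  obtain B where B: "finite B" "B \<subseteq> {p. prime p \<and> \<rho> p = r}" "(\<Sum>p\<in>B. 1 / real p) \<ge> 4 * exp 1 * K / c\<^sup>2"
    using unbounded_sum_if_not_summable[OF div] by auto
  obtain P where P: "B \<subseteq> {..P}" "P > 0" 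
    using B(1) by (metis finite_nat_iff_bounded_le gr0I le_zero_eq atMost_subset_iff subset_trans zero_le_one zero_less_one)
  obtain M where M: "\<And>z :: 'i \<Rightarrow> complex. (\<And>r. r \<in> \<rho> ` {p. prime p} \<Longrightarrow> cmod (z r) = 1) \<Longrightarrow>
    \<exists>m. 0 < m \<and> m \<le> M \<and> (\<forall>r\<in>\<rho> ` {p. prime p}. cmod (z r ^ m - 1) \<le> 1 / 4)"
    using unit_powers_near_one[OF fin, of "1/4"] by auto
  define E where "E = exp (4 * (real M)\<^sup>2 * K) * (5 + 2 * real M * T)"
  have E: "E > 0" unfolding E_def using T by (intro mult_pos_pos add_pos_nonneg) auto
  \<comment> \<open>The four entries guarantee, in this order: \<sigma> < 1; sqrt \<sigma> * ln P
    \<le> c/2; \<sigma> * ln P \<le> 1; and \<sigma> E^4 < 1, which the final contradiction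
    violates. Writing 1 + ln P keeps the denominators positive at P = 1.\<close>
  define \<sigma>0 where "\<sigma>0 = Min {1, (c / (2 * (1 + ln (real P))))\<^sup>2, 1 / (1 + ln (real P)), 1 / E ^ 4}"
  have lnP: "ln (real P) \<ge> 0" using P by simp
  have \<sigma>0: "\<sigma>0 > 0" unfolding \<sigma>0_def using lnP c E by simp
  show ?thesis
  proof (rule that[OF \<sigma>0])
    fix \<sigma> y :: real and f and z :: "'i \<Rightarrow> complex"
    assume \<sigma>: "0 < \<sigma>" "\<sigma> < \<sigma>0" and f: "unimodular_mult f" and fz: "\<And>p. prime p \<Longrightarrow> f p = z (\<rho> p)"
      and zr: "cmod (z r - 1) \<ge> c" and y: "\<bar>y\<bar> \<le> T"
    have \<sigma>1: "\<sigma> < 1" "\<sigma> < (c / (2 * (1 + ln (real P))))\<^sup>2" "\<sigma> < 1 / (1 + ln (real P))" "\<sigma> < 1 / E ^ 4"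
      using \<sigma>(2) unfolding \<sigma>0_def by auto
    define s where "s = Complex (1 + \<sigma>) y"
    have s: "Re s = 1 + \<sigma>" "Im s = y" "Re s > 1" using \<sigma> by (auto simp: s_def)
    define w where "w = (\<lambda>p::nat. exp (\<i> * of_real (- y * ln (real p))))"
    have w: "of_nat p powr (- (\<i> * of_real y)) = w p" if "p > 0" for p
      unfolding w_def by (rule nat_powr_imaginary[OF that])
    have w1: "cmod (w p) = 1" for p by (simp add: w_def norm_exp_eq_Re)
    have f1: "cmod (f p) = 1" if "prime p" for p using f that by (simp add: unimodular_mult_def prime_gt_0_nat)
    have ps: "pretentious_sum f s Q = (\<Sum>p\<in>primes_le Q. real p powr (- (1 + \<sigma>)) * (cmod (1 - f p * w p))\<^sup>2)" for Q
      unfolding pretentious_sum_def s by (intro sum.cong refl) (auto simp: primes_le_def prime_gt_0_nat w)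
    have "\<exists>Q. pretentious_sum f s Q \<ge> K"
    \<comment> \<open>Below the threshold \<open>sqrt \<sigma>\<close>, the twist \<open>w p\<close>
      is within c/2 of 1 on the fixed set \<open>B\<close>, so it cannot compensate
      \<open>f p\<close>. Above it, zeta at 1 + \<sigma> + i m y is at most of order
      \<sigma>^(-1/2).\<close>
    proof (cases "\<bar>y\<bar> < sqrt \<sigma>")
      case True
      have "K \<le> (c / 2)\<^sup>2 * exp (- 1) * (\<Sum>p\<in>B. 1 / real p)"
        using mult_left_mono[OF B(3), of "(c/2)\<^sup>2 * exp (-1)"] c
        by (simp add: exp_minus field_simps power2_eq_square)
      also have "\<dots> = (\<Sum>p\<in>B. (1 / real p * exp (- 1)) * (c / 2)\<^sup>2)"
        unfolding sum_distrib_left by (rule sum.cong) simp_all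
      also have "\<dots> \<le> (\<Sum>p\<in>B. real p powr (- (1 + \<sigma>)) * (cmod (1 - f p * w p))\<^sup>2)"
      proof (intro sum_mono mult_mono power_mono)
        fix p assume "p \<in> B"
        with B(2) P have p: "prime p" "\<rho> p = r" "p \<le> P" "p > 0" by (auto simp: prime_gt_0_nat)
        have lnp: "0 \<le> ln (real p)" "ln (real p) \<le> ln (real P)" using p P by auto
        have "\<sigma> * ln (real p) \<le> \<sigma> * (1 + ln (real P))" using lnp \<sigma> by (intro mult_left_mono) auto
        also have "\<dots> \<le> 1" using \<sigma>1(3) lnP by (simp add: field_simps)
        finally have "exp (- 1) \<le> exp (- \<sigma> * ln (real p))" by simp
        moreover have "real p powr (- (1 + \<sigma>)) = 1 / real p * exp (- \<sigma> * ln (real p))"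
          using p(4) by (simp add: powr_def exp_minus exp_diff field_simps flip: exp_add)
        ultimately show "1 / real p * exp (- 1) \<le> real p powr (- (1 + \<sigma>))"
          by (simp add: divide_right_mono)
        have "sqrt \<sigma> \<le> c / (2 * (1 + ln (real P)))"
          by (intro real_le_lsqrt) (use \<sigma>1(2) c lnP in auto)
        then have "\<bar>y\<bar> * ln (real p) \<le> c / (2 * (1 + ln (real P))) * (1 + ln (real P))"
          using True lnp c by (intro mult_mono) auto
        also have "\<dots> = c / 2" using lnP by (simp add: field_simps)
        finally have "cmod (w p - 1) \<le> c / 2"
          using cmod_exp_i_minus_1[of "- y * ln (real p)"] lnp by (simp add: w_def abs_mult)
        moreover have "1 - f p * w p = (1 - f p) - f p * (w p - 1)" by (simp add: algebra_simps)
        then have "cmod (1 - f p) - cmod (f p * (w p - 1)) \<le> cmod (1 - f p * w p)"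
          by (metis norm_triangle_ineq2)
        moreover have "cmod (1 - f p) \<ge> c" using zr fz[OF p(1)] p(2) by (simp add: norm_minus_commute)
        ultimately show "c / 2 \<le> cmod (1 - f p * w p)" using f1[OF p(1)] by (simp add: norm_mult)
      qed (use c in auto)
      also have "\<dots> \<le> pretentious_sum f s P"
        unfolding ps using B(2) P by (intro sum_mono2) (auto simp: primes_le_def)
      finally show ?thesis by blast
    next
      case False
      show ?thesis
      proof (rule ccontr)
        assume "\<not> ?thesis"
        then have small: "pretentious_sum f s Q \<le> K" for Q by (auto simp: not_le less_imp_le)
        have z1: "cmod (z r) = 1" if r: "r \<in> \<rho> ` {p. prime p}" for r
        proof -
          from r obtain p where "prime p" "r = \<rho> p" by auto
          with f1[of p] fz[of p] show ?thesis by simp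
        qed
        obtain m where m: "0 < m" "m \<le> M" and zm: "\<And>p. prime p \<Longrightarrow> cmod (f p ^ m - 1) \<le> 1 / 4"
          using M[of z] z1 fz by force
        define s' where "s' = Complex (1 + \<sigma>) (real m * y)"
        have s': "Re s' = 1 + \<sigma>" "Im s' = real m * y" "Re s' > 1" using \<sigma> by (auto simp: s'_def)
        define Z where "Z = rzeta (1 + \<sigma>)"
        have Z: "Z \<ge> 1 / \<sigma>" "Z \<ge> 1" "Z > 0" using rzeta_ge[OF \<sigma>(1)] rzeta_ge_1[of "1 + \<sigma>"] \<sigma> by (auto simp: Z_def)
        \<comment> \<open>This comes from (M a + 1/4)^2 \<le> 2 M^2 a^2 + 1/8, summed over primes,
          where the weights p^(-1-\<sigma>) sum to at most ln Z. The accuracy 1/4 is small enough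
          that \<open>exp (2 * D)\<close> grows only like Z^(1/4): zeta would have order at least
          Z^(3/4), more than \<sigma>^(-1/2).\<close>
        define D where "D = 2 * (real M)\<^sup>2 * K + 1/8 * ln Z"
        have D: "pretentious_sum (\<lambda>_. 1) s' Q \<le> D" for Q
        proof -
          have "pretentious_sum (\<lambda>_. 1) s' Q = (\<Sum>p\<in>primes_le Q. real p powr (- (1 + \<sigma>)) * (cmod (1 - w p ^ m))\<^sup>2)"
            unfolding pretentious_sum_def s'
          proof (intro sum.cong refl)
            fix p assume "p \<in> primes_le Q"
            then have p: "p > 0" by (auto simp: primes_le_def prime_gt_0_nat)
            have "of_nat p powr (- (\<i> * complex_of_real (real m * y))) = w p ^ m"
              unfolding nat_powr_imaginary[OF p] w_def exp_of_nat_mult[symmetric] by (simp add: mult_ac)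
            then show "real p powr - (1 + \<sigma>) * (cmod (1 - 1 * of_nat p powr (- (\<i> * complex_of_real (real m * y)))))\<^sup>2 =
              real p powr - (1 + \<sigma>) * (cmod (1 - w p ^ m))\<^sup>2" by simp
          qed
          also have "\<dots> \<le> (\<Sum>p\<in>primes_le Q. 2 * (real M)\<^sup>2 * (real p powr (- (1 + \<sigma>)) * (cmod (1 - f p * w p))\<^sup>2) + 1/8 * real p powr (- (1 + \<sigma>)))"
          proof (intro sum_mono)
            fix p assume "p \<in> primes_le Q"
            then have p: "prime p" by (auto simp: primes_le_def)
            have "cmod (1 - w p ^ m) \<le> cmod (1 - (f p * w p) ^ m) + cmod ((f p ^ m - 1) * w p ^ m)"
            proof -
              have "1 - w p ^ m = (1 - (f p * w p) ^ m) + (f p ^ m - 1) * w p ^ m" by (simp add: algebra_simps power_mult_distrib)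
              then show ?thesis by (metis norm_triangle_ineq)
            qed
            also have "\<dots> \<le> real M * cmod (1 - f p * w p) + 1 / 4"
            proof (intro add_mono)
              have "cmod (1 - (f p * w p) ^ m) \<le> real m * cmod (1 - f p * w p)"
                by (rule cmod_one_minus_power_le) (simp add: norm_mult f1 p w1)
              also have "\<dots> \<le> real M * cmod (1 - f p * w p)" using m by (intro mult_right_mono) auto
              finally show "cmod (1 - (f p * w p) ^ m) \<le> real M * cmod (1 - f p * w p)" .
            qed (use zm[OF p] in \<open>simp add: norm_mult norm_power w1\<close>)
            finally have "(cmod (1 - w p ^ m))\<^sup>2 \<le> (real M * cmod (1 - f p * w p) + 1 / 4)\<^sup>2" by (intro power_mono) auto
            also have "\<dots> \<le> 2 * (real M)\<^sup>2 * (cmod (1 - f p * w p))\<^sup>2 + 1 / 8"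
              using zero_le_power2[of "real M * cmod (1 - f p * w p) - 1 / 4"] by (simp add: power2_eq_square algebra_simps)
            finally have "real p powr (- (1 + \<sigma>)) * (cmod (1 - w p ^ m))\<^sup>2 \<le> real p powr (- (1 + \<sigma>)) * (2 * (real M)\<^sup>2 * (cmod (1 - f p * w p))\<^sup>2 + 1 / 8)"
              by (intro mult_left_mono) auto
            then show "real p powr (- (1 + \<sigma>)) * (cmod (1 - w p ^ m))\<^sup>2 \<le> 
              2 * (real M)\<^sup>2 * (real p powr (- (1 + \<sigma>)) * (cmod (1 - f p * w p))\<^sup>2) + 1/8 * real p powr (- (1 + \<sigma>))"
              by (simp add: algebra_simps)
          qed
          also have "\<dots> = 2 * (real M)\<^sup>2 * pretentious_sum f s Q + 1/8 * (\<Sum>p\<in>primes_le Q. real p powr (- (1 + \<sigma>)))"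
            unfolding ps sum.distrib sum_distrib_left ..
          also have "\<dots> \<le> D"
          proof -
            have "(\<Sum>p\<in>primes_le Q. real p powr (- (1 + \<sigma>))) \<le> ln Z"
              using exp_prime_sum_le_rzeta[of "1 + \<sigma>" Q] \<sigma> Z unfolding Z_def[symmetric] by (simp add: ln_ge_iff)
            then show ?thesis unfolding D_def using small[of Q] by (intro add_mono mult_left_mono) auto
          qed
          finally show ?thesis .
        qed
        have y0: "\<bar>y\<bar> \<ge> sqrt \<sigma>" "sqrt \<sigma> > 0" using False \<sigma> by auto
        have ZT: "Z \<le> cmod (dseries (\<lambda>_. 1) s') * exp (2 * D)"
          using rzeta_le_pretentious[OF unimodular_mult_one s'(3) D] unfolding s' Z_def .
        have D_eq: "exp (2 * D) = exp (4 * (real M)\<^sup>2 * K) * Z powr (1/4)"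
          using Z by (simp add: D_def powr_def algebra_simps flip: exp_add)
        have TB: "cmod (dseries (\<lambda>_. 1) s') \<le> (5 + 2 * real M * T) * (1 / sqrt \<sigma>)"
        proof -
          have "s' - 1 = Complex \<sigma> (real m * y)" by (simp add: s'_def complex_eq_iff)
          then have "real m * \<bar>y\<bar> \<le> cmod (s' - 1)" 
            using abs_Im_le_cmod[of "s' - 1"] by (simp add: abs_mult)
          moreover have "1 * sqrt \<sigma> \<le> real m * \<bar>y\<bar>" using m y0 by (intro mult_mono) auto
          ultimately have "sqrt \<sigma> \<le> cmod (s' - 1)" by linarith
          then have 1: "1 / cmod (s' - 1) \<le> 1 / sqrt \<sigma>" using y0(2) by (intro frac_le) auto
          have "cmod s' \<le> \<bar>1 + \<sigma>\<bar> + \<bar>real m * y\<bar>" using cmod_le[of s'] by (simp add: s')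
          also have "\<dots> \<le> 2 + real M * T"
            using \<sigma> \<sigma>1(1) m y T by (intro add_mono) (auto simp: abs_mult intro!: mult_mono)
          finally have "2 * cmod s' \<le> (4 + 2 * real M * T) * 1" by simp
          also have "\<dots> \<le> (4 + 2 * real M * T) * (1 / sqrt \<sigma>)"
            using T \<sigma> \<sigma>1(1) by (intro mult_left_mono) auto
          finally show ?thesis using 1 norm_zeta_le[OF s'(3)] by (simp add: algebra_simps)
        qed
        have "Z \<le> (5 + 2 * real M * T) * (1 / sqrt \<sigma>) * exp (2 * D)"
          using ZT mult_right_mono[OF TB exp_ge_zero, of "2 * D"] by linarith
        then have "Z \<le> E * (1 / sqrt \<sigma>) * Z powr (1/4)"
          unfolding D_eq by (simp add: E_def mult_ac)
        moreover have "Z = Z powr (3/4) * Z powr (1/4)" using Z by (simp flip: powr_add)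
        ultimately have "Z powr (3/4) * Z powr (1/4) \<le> E * (1 / sqrt \<sigma>) * Z powr (1/4)" by simp
        then have "Z powr (3/4) \<le> E * (1 / sqrt \<sigma>)" by (rule mult_right_le_imp_le) (use Z in simp)
        moreover have "(1 / \<sigma>) powr (3/4) \<le> Z powr (3/4)" using Z \<sigma> by (intro powr_mono2) auto
        moreover have "1 / sqrt \<sigma> = (1 / \<sigma>) powr (1/2)" using \<sigma> by (simp add: powr_half_sqrt real_sqrt_divide)
        moreover have "(1 / \<sigma>) powr (3/4) = (1 / \<sigma>) powr (1/4) * (1 / \<sigma>) powr (1/2)" using \<sigma> by (simp flip: powr_add)
        ultimately have "(1 / \<sigma>) powr (1/4) * (1 / \<sigma>) powr (1/2) \<le> E * (1 / \<sigma>) powr (1/2)" by simp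
        then have "(1 / \<sigma>) powr (1/4) \<le> E" by (rule mult_right_le_imp_le) (use \<sigma> in simp)
        then have "((1 / \<sigma>) powr (1/4)) ^ 4 \<le> E ^ 4" by (intro power_mono) auto
        moreover have "((1 / \<sigma>) powr (1/4)) ^ 4 = 1 / \<sigma>" using \<sigma> by (simp add: powr_powr flip: powr_realpow)
        ultimately show False using \<sigma>1(4) \<sigma>(1) E by (simp add: field_simps)
      qed
    qed
    then obtain Q where Q: "pretentious_sum f s Q \<ge> K" by blast
    have "cmod (dseries f s) \<le> rzeta (1 + \<sigma>) * exp (- pretentious_sum f s Q / 4)"
      using norm_dseries_le_pretentious[OF f s(3)] by (simp add: s)
    also have "\<dots> \<le> (2 / \<sigma>) * exp (- K / 4)"
    proof (intro mult_mono)
      have "1 + 1 / \<sigma> \<le> 2 / \<sigma>" using \<sigma> \<sigma>1(1) by (simp add: field_simps)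
      then show "rzeta (1 + \<sigma>) \<le> 2 / \<sigma>" using rzeta_le[OF \<sigma>(1)] by linarith
    qed (use Q \<sigma> in auto)
    also have "\<dots> = (2 * exp (- K / 4)) / \<sigma>" by simp
    also have "\<dots> \<le> \<eta> / \<sigma>" using K \<sigma> by (intro divide_right_mono) auto
    finally show "cmod (dseries f (Complex (1 + \<sigma>) y)) \<le> \<eta> / \<sigma>" by (simp add: s_def)
  qed
qed

subsection \<open>Mean squares of Dirichlet polynomials\<close>

text \<open>Summation by parts: nonincreasing nonnegative weights combine the inequalities between
  partial sums with nonnegative coefficients. It carries Chebyshev's bound over to weighted
  sums.\<close>

lemma sum_mono_weights:
  fixes u v w :: "nat \<Rightarrow> real"
  assumes le: "\<And>m. m \<ge> 1 \<Longrightarrow> (\<Sum>n=1..m. u n) \<le> (\<Sum>n=1..m. v n)"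
    and w: "\<And>n. n \<ge> 1 \<Longrightarrow> w (Suc n) \<le> w n" "\<And>n. n \<ge> 1 \<Longrightarrow> w n \<ge> 0"
  shows "(\<Sum>n=1..X. u n * w n) \<le> (\<Sum>n=1..X. v n * w n)"
proof -
  have "(\<Sum>n=1..X. v n - u n) * w X \<le> (\<Sum>n=1..X. (v n - u n) * w n)" if "X \<ge> 1" for X
    using that
  proof (induction X rule: dec_induct)
    case (step m)
    have "(\<Sum>n=1..m. v n - u n) * w (Suc m) \<le> (\<Sum>n=1..m. v n - u n) * w m"
      using le[of m] step w(1)[of m] by (intro mult_left_mono) (auto simp: sum_subtractf)
    with step.IH show ?case by (simp add: distrib_right)
  qed auto
  moreover have "0 \<le> (\<Sum>n=1..X. v n - u n) * w X" if "X \<ge> 1" for X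
    using le[OF that] w(2)[OF that] by (simp add: sum_subtractf)
  ultimately have "0 \<le> (\<Sum>n=1..X. (v n - u n) * w n)"
    by (cases "X \<ge> 1") (force, simp)
  then show ?thesis by (simp add: left_diff_distrib sum_subtractf)
qed

lemma sum_mangoldt_powr_le:
  assumes "\<sigma> > 0"
  shows "(\<Sum>n=1..X. mangoldt n * real n powr (- 1 - \<sigma>)) \<le> 4 * (1 + 1 / \<sigma>)"
proof -
  have "(\<Sum>n=1..X. mangoldt n * real n powr (- 1 - \<sigma>)) \<le> (\<Sum>n=1..X. 4 * real n powr (- 1 - \<sigma>))"
  proof (rule sum_mono_weights)
    show "(\<Sum>n=1..m. mangoldt n) \<le> (\<Sum>n=1..m. 4 :: real)" for m
      using cheb_psi_le[of m] by (simp add: cheb_psi_def)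
    show "real (Suc n) powr (- 1 - \<sigma>) \<le> real n powr (- 1 - \<sigma>)" if "n \<ge> 1" for n
      using that assms by (intro powr_mono2') auto
  qed auto
  also have "\<dots> \<le> 4 * (1 + 1 / \<sigma>)"
    using sum_powr_le[OF assms, of X] by (simp flip: sum_distrib_left)
  finally show ?thesis .
qed

lemma dirichlet_poly_plancherel:
  fixes c :: "nat \<Rightarrow> complex"
  assumes b: "b > 0"
  shows "has_bochner_integral lborel (\<lambda>y. (cmod (\<Sum>n=1..X. dterm c (Complex a y) n))\<^sup>2 / (b\<^sup>2 + y\<^sup>2))
    (pi / b * Re (\<Sum>n=1..X. \<Sum>m=1..X. c n * cnj (c m) * of_real (real n powr (- a) * real m powr (- a) * exp (- b * \<bar>ln (real n) - ln (real m)\<bar>))))"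
proof -
  define e where "e = (\<lambda>n. c n * of_real (real n powr (- a)))"
  have t: "(\<Sum>n=1..X. dterm c (Complex a y) n) = (\<Sum>n=1..X. e n * exp (- \<i> * ln (real n) * y))" for y
  proof (intro sum.cong refl)
    fix n assume "n \<in> {1..X}"
    then have n: "n > 0" by simp
    have "Complex a y = of_real a + \<i> * of_real y" by (simp add: complex_eq_iff)
    then have "of_nat n powr (- Complex a y) = of_nat n powr (- of_real a) * of_nat n powr (- (\<i> * of_real y))"
      by (simp flip: powr_add)
    also have "of_nat n powr (- of_real a) = complex_of_real (real n powr (- a))"
      using n by (simp add: powr_of_real[symmetric])
    also have "of_nat n powr (- (\<i> * of_real y)) = exp (- \<i> * ln (real n) * y)"
      unfolding nat_powr_imaginary[OF n] by (simp add: mult_ac)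
    finally show "dterm c (Complex a y) n = e n * exp (- \<i> * ln (real n) * y)"
      by (simp add: dterm_def e_def)
  qed
  have "has_bochner_integral lborel (\<lambda>y::real. complex_of_real ((cmod (\<Sum>n=1..X. e n * exp (- \<i> * ln (real n) * y)))\<^sup>2 / (b\<^sup>2 + y\<^sup>2)))
    (pi / b * (\<Sum>n=1..X. \<Sum>m=1..X. e n * cnj (e m) * exp (- b * \<bar>ln (real n) - ln (real m)\<bar>)))"
    by (rule plancherel_cauchy_weight[OF b])
  from has_bochner_integral_Re[OF this]
  have "has_bochner_integral lborel (\<lambda>y. (cmod (\<Sum>n=1..X. dterm c (Complex a y) n))\<^sup>2 / (b\<^sup>2 + y\<^sup>2))
    (Re (pi / b * (\<Sum>n=1..X. \<Sum>m=1..X. e n * cnj (e m) * exp (- b * \<bar>ln (real n) - ln (real m)\<bar>))))"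
    unfolding t by simp
  also have "Re (pi / b * (\<Sum>n=1..X. \<Sum>m=1..X. e n * cnj (e m) * exp (- b * \<bar>ln (real n) - ln (real m)\<bar>))) = 
     pi / b * Re (\<Sum>n=1..X. \<Sum>m=1..X. e n * cnj (e m) * exp (- b * \<bar>ln (real n) - ln (real m)\<bar>))"
  proof -
    have "Re (of_real x * z) = x * Re z" for x z by simp
    then show ?thesis by (simp only: of_real_divide[symmetric])
  qed
  also have "(\<Sum>n=1..X. \<Sum>m=1..X. e n * cnj (e m) * exp (- b * \<bar>ln (real n) - ln (real m)\<bar>)) = 
    (\<Sum>n=1..X. \<Sum>m=1..X. c n * cnj (c m) * of_real (real n powr (- a) * real m powr (- a) * exp (- b * \<bar>ln (real n) - ln (real m)\<bar>)))"
    by (intro sum.cong refl) (simp add: e_def exp_of_real[symmetric])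
  finally show ?thesis .
qed

text \<open>By symmetry it suffices to sum over m \<le> n. There \<open>b \<ge> 1\<close> makes the
  exponential at most m/n and the kernel at most n^(-2-\<sigma>), independently of \<open>m\<close>,
  so Chebyshev bounds the inner sum. The result is of order 1/\<sigma>, whereas squaring the
  pointwise bound for F'/F would give 1/\<sigma>^2; the decay in \<open>b\<close> is kept for large
  ordinates.\<close>

lemma mean_square_mangoldt:
  fixes c :: "nat \<Rightarrow> complex"
  assumes b: "b \<ge> 1" and \<sigma>: "\<sigma> > 0" and c: "\<And>n. n \<ge> 1 \<Longrightarrow> cmod (c n) \<le> mangoldt n"
  shows "(\<integral>y. (cmod (\<Sum>n=1..X. dterm c (Complex (1 + \<sigma>) y) n))\<^sup>2 / (b\<^sup>2 + y\<^sup>2) \<partial>lborel) \<le> 32 * pi * (1 + 1 / \<sigma>) / b"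
proof -
  define k where "k = (\<lambda>n m. real n powr (- (1 + \<sigma>)) * real m powr (- (1 + \<sigma>)) * exp (- b * \<bar>ln (real n) - ln (real m)\<bar>))"
  have k: "k n m \<ge> 0" "k n m = k m n" for n m by (auto simp: k_def abs_minus_commute)
  have k_le: "k n m \<le> real n powr (- 1 - \<sigma>) / real n" if "1 \<le> m" "m \<le> n" for n m
  proof -
    have ln: "ln (real m) \<le> ln (real n)" using that by auto
    have "exp (- b * \<bar>ln (real n) - ln (real m)\<bar>) \<le> exp (- 1 * (ln (real n) - ln (real m)))"
      using ln b mult_right_mono[OF b, of "ln (real n) - ln (real m)"] by simp
    also have "\<dots> = real m / real n" using that by (simp add: exp_diff exp_minus)
    finally have 1: "exp (- b * \<bar>ln (real n) - ln (real m)\<bar>) \<le> real m / real n" .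
    have "real m powr (- (1 + \<sigma>)) \<le> real m powr (- 1)" using that \<sigma> by (intro powr_mono) auto
    also have "\<dots> = 1 / real m" using that by (simp add: powr_minus_divide)
    finally have 2: "real m powr (- (1 + \<sigma>)) \<le> 1 / real m" .
    have "k n m \<le> real n powr (- (1 + \<sigma>)) * (1 / real m) * (real m / real n)"
      unfolding k_def using 1 2 by (intro mult_mono) auto
    then show ?thesis using that by simp
  qed
  have sum_le: "(\<Sum>m=1..n. mangoldt m * k n m) \<le> 4 * real n powr (- 1 - \<sigma>)" if "n \<ge> 1" for n
  proof -
    have "(\<Sum>m=1..n. mangoldt m * k n m) \<le> (\<Sum>m=1..n. mangoldt m * (real n powr (- 1 - \<sigma>) / real n))"
      using that by (intro sum_mono mult_left_mono k_le mangoldt_nonneg) auto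
    also have "\<dots> = cheb_psi n * (real n powr (- 1 - \<sigma>) / real n)"
      unfolding cheb_psi_def sum_distrib_right ..
    also have "\<dots> \<le> (4 * real n) * (real n powr (- 1 - \<sigma>) / real n)"
      by (intro mult_right_mono cheb_psi_le) auto
    finally show ?thesis using that by simp
  qed
  have "(\<integral>y. (cmod (\<Sum>n=1..X. dterm c (Complex (1 + \<sigma>) y) n))\<^sup>2 / (b\<^sup>2 + y\<^sup>2) \<partial>lborel) =
     pi / b * Re (\<Sum>n=1..X. \<Sum>m=1..X. c n * cnj (c m) * of_real (k n m))"
    using dirichlet_poly_plancherel[of b c "1 + \<sigma>" X] b unfolding k_def
    by (auto simp: has_bochner_integral_iff)
  also have "\<dots> \<le> pi / b * (32 * (1 + 1 / \<sigma>))"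
  proof (intro mult_left_mono)
    have "Re (\<Sum>n=1..X. \<Sum>m=1..X. c n * cnj (c m) * of_real (k n m)) \<le> cmod (\<Sum>n=1..X. \<Sum>m=1..X. c n * cnj (c m) * of_real (k n m))"
      by (rule complex_Re_le_cmod)
    also have "\<dots> \<le> (\<Sum>n=1..X. \<Sum>m=1..X. mangoldt n * mangoldt m * k n m)"
    proof (intro sum_norm_le)
      fix n m assume "n \<in> {1..X}" "m \<in> {1..X}"
      then show "cmod (c n * cnj (c m) * of_real (k n m)) \<le> mangoldt n * mangoldt m * k n m"
        using c[of n] c[of m] k(1)[of n m] by (auto simp: norm_mult intro!: mult_mono mangoldt_nonneg mult_nonneg_nonneg)
    qed
    also have "\<dots> \<le> (\<Sum>n=1..X. \<Sum>m=1..X. (if m \<le> n then mangoldt n * mangoldt m * k n m else 0) + (if n \<le> m then mangoldt n * mangoldt m * k n m else 0))"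
      using k(1) by (intro sum_mono) (auto intro!: mult_nonneg_nonneg mangoldt_nonneg)
    also have "\<dots> = 2 * (\<Sum>n=1..X. \<Sum>m=1..X. (if m \<le> n then mangoldt n * mangoldt m * k n m else 0))"
    proof -
      have "(\<Sum>n=1..X. \<Sum>m=1..X. (if n \<le> m then mangoldt n * mangoldt m * k n m else 0)) =
        (\<Sum>n=1..X. \<Sum>m=1..X. (if m \<le> n then mangoldt n * mangoldt m * k n m else 0))"
        by (subst sum.swap) (intro sum.cong refl, auto simp: mult_ac k(2))
      then show ?thesis by (simp add: sum.distrib)
    qed
    also have "(\<Sum>n=1..X. \<Sum>m=1..X. (if m \<le> n then mangoldt n * mangoldt m * k n m else 0)) = (\<Sum>n=1..X. mangoldt n * (\<Sum>m=1..n. mangoldt m * k n m))"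
    proof (intro sum.cong refl)
      fix n assume "n \<in> {1..X}"
      then have "(\<Sum>m=1..X. (if m \<le> n then mangoldt n * mangoldt m * k n m else 0)) = (\<Sum>m=1..n. mangoldt n * mangoldt m * k n m)"
        by (intro sum.mono_neutral_cong_right) auto
      then show "(\<Sum>m=1..X. (if m \<le> n then mangoldt n * mangoldt m * k n m else 0)) = mangoldt n * (\<Sum>m=1..n. mangoldt m * k n m)"
        by (simp add: sum_distrib_left mult_ac)
    qed
    also have "\<dots> \<le> (\<Sum>n=1..X. mangoldt n * (4 * real n powr (- 1 - \<sigma>)))"
      by (intro sum_mono mult_left_mono sum_le mangoldt_nonneg) auto
    also have "\<dots> = 4 * (\<Sum>n=1..X. mangoldt n * real n powr (- 1 - \<sigma>))"
      by (simp add: sum_distrib_left mult_ac)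
    also have "\<dots> \<le> 4 * (4 * (1 + 1 / \<sigma>))"
      by (intro mult_left_mono sum_mangoldt_powr_le \<sigma>) auto
    finally show "Re (\<Sum>n=1..X. \<Sum>m=1..X. c n * cnj (c m) * of_real (k n m)) \<le> 32 * (1 + 1 / \<sigma>)" by simp
  qed (use b in auto)
  also have "\<dots> = 32 * pi * (1 + 1 / \<sigma>) / b" by simp
  finally show ?thesis .
qed

text \<open>The kernel at abscissa \<open>b = a\<close> is \<open>max n m\<close> to the power \<open>- 2 a\<close>, so the quadratic form is a
  weighted sum of squares of partial sums.\<close>

lemma mean_square_partial_sums:
  fixes c :: "nat \<Rightarrow> complex"
  assumes a: "a > 0" and X: "X \<ge> 1"
  shows "(\<Sum>l=1..<X. (real l powr (- 2 * a) - real (Suc l) powr (- 2 * a)) * (cmod (partial_sum c l))\<^sup>2) \<le>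
    a / pi * (\<integral>y. (cmod (\<Sum>n=1..X. dterm c (Complex a y) n))\<^sup>2 / (a\<^sup>2 + y\<^sup>2) \<partial>lborel)"
proof -
  define w where "w = (\<lambda>l. real l powr (- 2 * a))"
  define Q where "Q = (\<lambda>X. \<Sum>n=1..X. \<Sum>m=1..X. c n * cnj (c m) * of_real (w (max n m)))"
  have ker: "real n powr (- a) * real m powr (- a) * exp (- a * \<bar>ln (real n) - ln (real m)\<bar>) = w (max n m)"
    if "n \<ge> 1" "m \<ge> 1" for n m
  proof -
    have *: "real n powr (- a) * real m powr (- a) * exp (- a * \<bar>ln (real n) - ln (real m)\<bar>) = w (max n m)"
      if "1 \<le> n" "n \<le> m" for n m
    proof -
      have "ln (real n) \<le> ln (real m)" using that by auto
      then show ?thesis using that unfolding w_def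
        by (simp add: max_def powr_def algebra_simps flip: exp_add)
    qed
    show ?thesis
      using *[of n m] *[of m n] that by (cases "n \<le> m") (auto simp: mult_ac abs_minus_commute max.commute)
  qed
  \<comment> \<open>The new row and column carry the constant kernel value \<open>w (Suc X)\<close>,
    so they complete the square of the partial sum. Summation by parts then produces the differences
    of \<open>w\<close>.\<close>
  have QS: "Q (Suc X) = Q X + of_real (w (Suc X)) * of_real ((cmod (partial_sum c (Suc X)))\<^sup>2 - (cmod (partial_sum c X))\<^sup>2)" for X
  proof -
    define N where "N = partial_sum c X"
    have "Q (Suc X) = Q X + (\<Sum>n=1..X. c n * cnj (c (Suc X)) * of_real (w (Suc X))) + (\<Sum>m=1..X. c (Suc X) * cnj (c m) * of_real (w (Suc X))) + c (Suc X) * cnj (c (Suc X)) * of_real (w (Suc X))"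
      unfolding Q_def by (simp add: sum.distrib max_def)
    also have "\<dots> = Q X + of_real (w (Suc X)) * (N * cnj (c (Suc X)) + c (Suc X) * cnj N + c (Suc X) * cnj (c (Suc X)))"
      unfolding N_def partial_sum_def by (simp add: algebra_simps sum_distrib_left sum_distrib_right)
    also have "N * cnj (c (Suc X)) + c (Suc X) * cnj N + c (Suc X) * cnj (c (Suc X)) = (N + c (Suc X)) * cnj (N + c (Suc X)) - N * cnj N"
      by (simp add: algebra_simps)
    also have "\<dots> = of_real ((cmod (N + c (Suc X)))\<^sup>2 - (cmod N)\<^sup>2)"
      by (simp only: complex_norm_square of_real_diff)
    also have "N + c (Suc X) = partial_sum c (Suc X)" by (simp add: N_def partial_sum_def)
    finally show ?thesis unfolding N_def .
  qed
  have "Re (Q X) = (\<Sum>l=1..<X. (w l - w (Suc l)) * (cmod (partial_sum c l))\<^sup>2) + w X * (cmod (partial_sum c X))\<^sup>2"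
    using X
  proof (induction X rule: dec_induct)
    case base
    show ?case by (simp add: Q_def partial_sum_def complex_norm_square[symmetric] flip: of_real_mult)
  next
    case (step n)
    then show ?case unfolding QS by (simp add: algebra_simps flip: of_real_mult of_real_diff)
  qed
  also have "\<dots> \<ge> (\<Sum>l=1..<X. (w l - w (Suc l)) * (cmod (partial_sum c l))\<^sup>2)" by (simp add: w_def)
  finally have "(\<Sum>l=1..<X. (w l - w (Suc l)) * (cmod (partial_sum c l))\<^sup>2) \<le> Re (Q X)" .
  also have "Q X = (\<Sum>n=1..X. \<Sum>m=1..X. c n * cnj (c m) * of_real (real n powr (- a) * real m powr (- a) * exp (- a * \<bar>ln (real n) - ln (real m)\<bar>)))"
    unfolding Q_def by (intro sum.cong refl) (simp only: ker atLeastAtMost_iff)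
  also have "Re \<dots> = a / pi * (\<integral>y. (cmod (\<Sum>n=1..X. dterm c (Complex a y) n))\<^sup>2 / (a\<^sup>2 + y\<^sup>2) \<partial>lborel)"
    using dirichlet_poly_plancherel[OF a, of c a X] a by (auto simp: has_bochner_integral_iff)
  finally show ?thesis by (simp add: w_def)
qed

text \<open>If F is the Dirichlet series of \<open>f\<close>, these are the coefficients of -F'/F,
  and those of \<open>log_twist f\<close> belong to -F'.\<close>

definition mangoldt_twist :: "(nat \<Rightarrow> complex) \<Rightarrow> nat \<Rightarrow> complex" where
  "mangoldt_twist f n = mangoldt n * f n"

definition log_twist :: "(nat \<Rightarrow> complex) \<Rightarrow> nat \<Rightarrow> complex" where
  "log_twist f n = f n * ln (real n)"

lemma partial_sum_log_twist: "partial_sum (log_twist f) = log_partial_sum f"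
  by (rule ext) (simp add: partial_sum_def log_twist_def log_partial_sum_def)

lemma mangoldt_powr_summable_on:
  assumes "a > 1"
  shows "(\<lambda>n. mangoldt n * real n powr (- a)) summable_on {1..}"
proof (rule nonneg_bdd_above_summable_on)
  show "bdd_above (sum (\<lambda>n. mangoldt n * real n powr (- a)) ` {F. F \<subseteq> {1..} \<and> finite F})"
  proof (rule bdd_aboveI2)
    fix F :: "nat set" assume "F \<in> {F. F \<subseteq> {1..} \<and> finite F}"
    then have F: "F \<subseteq> {1..}" "finite F" by auto
    obtain X where "F \<subseteq> {..X}" using F(2) finite_nat_iff_bounded_le by blast
    with F(1) have "F \<subseteq> {1..X}" by fastforce
    then have "sum (\<lambda>n. mangoldt n * real n powr (- a)) F \<le> (\<Sum>n=1..X. mangoldt n * real n powr (- a))"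
      by (intro sum_mono2) (auto intro!: mult_nonneg_nonneg mangoldt_nonneg)
    also have "\<dots> \<le> 4 * (1 + 1 / (a - 1))"
      using sum_mangoldt_powr_le[of "a - 1" X] assms by simp
    finally show "sum (\<lambda>n. mangoldt n * real n powr (- a)) F \<le> 4 * (1 + 1 / (a - 1))" .
  qed
qed (auto intro!: mult_nonneg_nonneg mangoldt_nonneg)

lemma cmod_mangoldt_dterm:
  assumes "unimodular_mult f" "n > 0"
  shows "cmod (dterm (mangoldt_twist f) s n) = mangoldt n * real n powr (- Re s)"
  using assms by (simp add: dterm_def mangoldt_twist_def norm_mult cmod_nat_powr unimodular_mult_def)

lemma mangoldt_dterm_summable:
  assumes "unimodular_mult f" "Re s > 1"
  shows "(\<lambda>n. cmod (dterm (mangoldt_twist f) s n)) summable_on {1..}"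
  using mangoldt_powr_summable_on[OF assms(2)]
  by (rule summable_on_cong[THEN iffD1, rotated]) (use assms cmod_mangoldt_dterm in auto)

text \<open>This is \<open>- F' = F (- F' / F)\<close>; on coefficients it says \<open>log = \<Lambda> * 1\<close>, twisted by \<open>f\<close>.\<close>

lemma log_dseries:
  assumes f: "unimodular_mult f" and s: "Re s > 1"
  shows "dterm (log_twist f) s summable_on {1..}"
    and "dseries (log_twist f) s = dseries (mangoldt_twist f) s * dseries f s"
proof -
  define g where "g = dterm (mangoldt_twist f) s"
  define t where "t = dterm f s"
  have sg: "(\<lambda>n. norm (g n)) summable_on {1..}" unfolding g_def by (rule mangoldt_dterm_summable[OF f s])
  have st: "(\<lambda>n. norm (t n)) summable_on {1..}" unfolding t_def by (rule dterm_abs_summable[OF f s])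
  have prod: "(\<lambda>(d, m). g d * t m) summable_on ({1..} \<times> {1..})"
  proof (rule abs_summable_summable)
    have A1: "(\<lambda>m. norm (g d * t m)) summable_on {1..}" for d
      using summable_on_cmult_right[OF st, of "norm (g d)"] by (simp add: norm_mult)
    have A2: "(\<lambda>d. norm (infsum (\<lambda>m. norm (g d * t m)) {1..})) summable_on {1..}"
      using summable_on_cmult_left[OF sg, of "norm (infsum (\<lambda>m. norm (t m)) {1..})"]
      by (simp add: norm_mult abs_mult infsum_cmult_right')
    show "(\<lambda>x. norm (case x of (d, m) \<Rightarrow> g d * t m)) summable_on ({1..} \<times> {1..})"
      unfolding Infinite_Sum.abs_summable_on_Sigma_iff using A1 A2 by simp
  qed
  define h where "h = (\<lambda>(n, d). g d * t (n div d))"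
  have bij: "bij_betw (\<lambda>(d, m). (d * m, d)) ({1..} \<times> {1..}) (Sigma {1::nat..} (\<lambda>n. {d. d dvd n}))"
  proof (rule bij_betwI[where g = "\<lambda>(n, d). (d, n div d)"])
    show "(\<lambda>(n, d). (d, n div d)) \<in> Sigma {1::nat..} (\<lambda>n. {d. d dvd n}) \<rightarrow> {1..} \<times> {1..}"
    proof (rule Pi_I)
      fix x :: "nat \<times> nat" assume x: "x \<in> Sigma {1..} (\<lambda>n. {d. d dvd n})"
      obtain n d where nd: "x = (n, d)" by (cases x)
      with x obtain e where e: "n = d * e" by auto
      with nd x have "d > 0" "e > 0" by (auto intro: Nat.gr0I)
      with e nd show "(case x of (n, d) \<Rightarrow> (d, n div d)) \<in> {1..} \<times> {1..}" by auto
    qed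
  qed (auto simp: Suc_le_eq)
  have hs: "h summable_on (Sigma {1..} (\<lambda>n. {d. d dvd n}))"
    and hi: "infsum h (Sigma {1..} (\<lambda>n. {d. d dvd n})) = infsum (\<lambda>(d, m). g d * t m) ({1..} \<times> {1..})"
  proof -
    have eq: "h ((\<lambda>(d, m). (d * m, d)) x) = (\<lambda>(d, m). g d * t m) x" if "x \<in> {1..} \<times> {1..}" for x
      using that by (auto simp: h_def)
    show "h summable_on (Sigma {1..} (\<lambda>n. {d. d dvd n}))"
      unfolding summable_on_reindex_bij_betw[OF bij, of h, symmetric]
      by (rule summable_on_cong[OF eq, THEN iffD2, OF _ prod])
    show "infsum h (Sigma {1..} (\<lambda>n. {d. d dvd n})) = infsum (\<lambda>(d, m). g d * t m) ({1..} \<times> {1..})"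
      unfolding infsum_reindex_bij_betw[OF bij, of h, symmetric] by (rule infsum_cong[OF eq])
  qed
  have inner: "infsum (\<lambda>d. h (n, d)) {d. d dvd n} = dterm (log_twist f) s n" if "n \<in> {1..}" for n
  proof -
    have n: "n > 0" using that by auto
    have "infsum (\<lambda>d. h (n, d)) {d. d dvd n} = (\<Sum>d | d dvd n. h (n, d))"
      using n by (intro infsum_finite) (auto simp: finite_divisors_nat)
    also have "\<dots> = (\<Sum>d | d dvd n. mangoldt d * t n)"
    proof (intro sum.cong refl)
      fix d assume "d \<in> {d. d dvd n}"
      then obtain e where e: "n = d * e" by auto
      with n have "d > 0" "e > 0" by (auto intro: Nat.gr0I)
      then show "h (n, d) = mangoldt d * t n"
        using e dterm_mult[OF f, of d e s] by (simp add: h_def g_def t_def dterm_def mangoldt_twist_def)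
    qed
    also have "\<dots> = dterm (log_twist f) s n"
      using n unfolding sum_distrib_right[symmetric] by (subst mangoldt_sum) (auto simp: t_def dterm_def log_twist_def)
    finally show ?thesis .
  qed
  have "(\<lambda>n. infsum (\<lambda>d. h (n, d)) {d. d dvd n}) summable_on {1..}"
    using summable_on_Sigma_banach[of "\<lambda>n d. h (n, d)" "{1..}" "\<lambda>n. {d. d dvd n}"] hs by (simp add: case_prod_eta)
  then show "dterm (log_twist f) s summable_on {1..}"
    by (rule summable_on_cong[THEN iffD1, rotated]) (rule inner)
  have "dseries (log_twist f) s = infsum (\<lambda>n. infsum (\<lambda>d. h (n, d)) {d. d dvd n}) {1..}"
    unfolding dseries_def by (intro infsum_cong inner[symmetric])
  also have "\<dots> = infsum h (Sigma {1..} (\<lambda>n. {d. d dvd n}))"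
    by (rule infsum_Sigma_banach[OF hs])
  also have "\<dots> = infsum (\<lambda>d. infsum (\<lambda>m. g d * t m) {1..}) {1..}"
    unfolding hi using infsum_Sigma_banach[OF prod] by simp
  also have "\<dots> = infsum (\<lambda>d. g d * infsum t {1..}) {1..}" by (simp only: infsum_cmult_right')
  also have "\<dots> = infsum g {1..} * infsum t {1..}" by (rule infsum_cmult_left')
  finally show "dseries (log_twist f) s = dseries (mangoldt_twist f) s * dseries f s"
    by (simp add: dseries_def g_def t_def)
qed

lemma integrable_cauchy_weight:
  assumes "b > 0"
  shows "integrable lborel (\<lambda>y::real. C / (b\<^sup>2 + y\<^sup>2))"
proof -
  from has_bochner_integral_Re[OF fourier_cauchy[OF assms, of 0]]
  have "integrable lborel (\<lambda>y::real. Re (complex_of_real (1 / (b\<^sup>2 + y\<^sup>2))))" by (simp add: has_bochner_integral_iff)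
  then have "integrable lborel (\<lambda>y::real. C * (1 / (b\<^sup>2 + y\<^sup>2)))" unfolding Re_complex_of_real by (rule integrable_mult_right)
  then show ?thesis by simp
qed

text \<open>The uniform bound \<open>B\<close> for partial sums on the line makes a multiple of the
  Cauchy weight an integrable majorant. The passage to the limit matters because F' = F (F'/F) is an
  identity of full series and not of their truncations.\<close>

lemma mean_square_limit:
  fixes c :: "nat \<Rightarrow> complex"
  assumes b: "b > 0" and s: "\<And>y. dterm c (Complex a y) summable_on {1..}"
    and bound: "\<And>X y. cmod (\<Sum>n=1..X. dterm c (Complex a y) n) \<le> B"
  shows "integrable lborel (\<lambda>y. (cmod (dseries c (Complex a y)))\<^sup>2 / (b\<^sup>2 + y\<^sup>2))"
    and "(\<lambda>X. \<integral>y. (cmod (\<Sum>n=1..X. dterm c (Complex a y) n))\<^sup>2 / (b\<^sup>2 + y\<^sup>2) \<partial>lborel) \<longlonglongrightarrow>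
      (\<integral>y. (cmod (dseries c (Complex a y)))\<^sup>2 / (b\<^sup>2 + y\<^sup>2) \<partial>lborel)"
proof -
  have lim: "(\<lambda>X. (cmod (\<Sum>n=1..X. dterm c (Complex a y) n))\<^sup>2 / (b\<^sup>2 + y\<^sup>2)) \<longlonglongrightarrow> (cmod (dseries c (Complex a y)))\<^sup>2 / (b\<^sup>2 + y\<^sup>2)" for y
    unfolding dseries_def by (intro tendsto_divide tendsto_power tendsto_norm sum_tendsto_infsum s tendsto_const)
       (use b in \<open>auto simp: add_nonneg_eq_0_iff\<close>)
  have meas: "(\<lambda>y. (cmod (\<Sum>n=1..X. dterm c (Complex a y) n))\<^sup>2 / (b\<^sup>2 + y\<^sup>2)) \<in> borel_measurable lborel" for X
    using dirichlet_poly_plancherel[OF b, of c a X] by (auto simp: has_bochner_integral_iff)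
  define s where "s = (\<lambda>X y. (cmod (\<Sum>n=1..X. dterm c (Complex a y) n))\<^sup>2 / (b\<^sup>2 + y\<^sup>2))"
  have meas: "s X \<in> borel_measurable lborel" for X unfolding s_def by (rule meas)
  have lim: "(\<lambda>X. s X y) \<longlonglongrightarrow> (cmod (dseries c (Complex a y)))\<^sup>2 / (b\<^sup>2 + y\<^sup>2)" for y
    unfolding s_def by (rule lim)
  have measl: "(\<lambda>y. (cmod (dseries c (Complex a y)))\<^sup>2 / (b\<^sup>2 + y\<^sup>2)) \<in> borel_measurable lborel"
    by (rule borel_measurable_LIMSEQ_real[OF lim meas])
  have dom: "norm (s X y) \<le> B\<^sup>2 / (b\<^sup>2 + y\<^sup>2)" for X y
    unfolding s_def using bound by (auto intro!: divide_right_mono power_mono)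
  note conv = measl meas integrable_cauchy_weight[OF b, of "B\<^sup>2"] AE_I2[OF lim] AE_I2[OF dom]
  show "integrable lborel (\<lambda>y. (cmod (dseries c (Complex a y)))\<^sup>2 / (b\<^sup>2 + y\<^sup>2))"
    by (rule integrable_dominated_convergence[where s = s, OF conv])
  show "(\<lambda>X. \<integral>y. (cmod (\<Sum>n=1..X. dterm c (Complex a y) n))\<^sup>2 / (b\<^sup>2 + y\<^sup>2) \<partial>lborel) \<longlonglongrightarrow>
      (\<integral>y. (cmod (dseries c (Complex a y)))\<^sup>2 / (b\<^sup>2 + y\<^sup>2) \<partial>lborel)"
    using integral_dominated_convergence[where s = s, OF conv] unfolding s_def .
qed

lemma dirichlet_sum_bounded:
  fixes c :: "nat \<Rightarrow> complex"
  assumes "(\<lambda>n. cmod (c n) * real n powr (- a)) summable_on {1..}"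
  shows "cmod (\<Sum>n=1..X. dterm c (Complex a y) n) \<le> infsum (\<lambda>n. cmod (c n) * real n powr (- a)) {1..}"
proof -
  have "cmod (\<Sum>n=1..X. dterm c (Complex a y) n) \<le> (\<Sum>n=1..X. cmod (c n) * real n powr (- a))"
    by (intro sum_norm_le) (simp add: dterm_def norm_mult cmod_nat_powr)
  also have "\<dots> \<le> infsum (\<lambda>n. cmod (c n) * real n powr (- a)) {1..}"
    by (intro finite_sum_le_infsum assms) auto
  finally show ?thesis .
qed

lemma log_powr_summable_on:
  assumes "a > 1"
  shows "(\<lambda>n. ln (real n) * real n powr (- a)) summable_on {1..}"
proof -
  have "dterm (log_twist (\<lambda>_. 1)) (of_real a) summable_on {1..}"
    using assms by (intro log_dseries(1) unimodular_mult_one) auto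
  then have "(\<lambda>n. Re (dterm (log_twist (\<lambda>_. 1)) (of_real a) n)) summable_on {1..}"
    by (rule summable_on_Re)
  then show ?thesis
    by (rule summable_on_cong[THEN iffD1, rotated])
       (simp add: dterm_def log_twist_def nat_powr_of_real)
qed

text \<open>At ordinates up to \<open>T\<close> the factor F is at most \<eta>/\<sigma> and leaves
  the integral, while the mean square of F'/F is of order 1/\<sigma>. Beyond \<open>T\<close> the
  trivial bound 2/\<sigma> for F is combined with the decay of the weight. Relative to the trivial
  order \<sigma>^(-3) the gain is \<eta>^2 + 8/T.\<close>

lemma weighted_log_partial_sums:
  assumes f: "unimodular_mult f" and \<sigma>: "0 < \<sigma>" "\<sigma> \<le> 1" and T: "T \<ge> 1" and \<eta>: "\<eta> > 0"
    and F: "\<And>y. \<bar>y\<bar> \<le> T \<Longrightarrow> cmod (dseries f (Complex (1 + \<sigma>) y)) \<le> \<eta> / \<sigma>"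
  shows "(\<Sum>l=1..X. real l powr (- 3 - 2 * \<sigma>) * (cmod (log_partial_sum f l))\<^sup>2) \<le> 2 ^ 12 * (\<eta>\<^sup>2 + 8 / T) / \<sigma> ^ 3"
proof -
  define a where "a = 1 + \<sigma>"
  have a: "a > 1" "a \<le> 2" "a > 0" using \<sigma> by (auto simp: a_def)
  define G where "G = (\<lambda>y. (cmod (dseries (mangoldt_twist f) (Complex a y)))\<^sup>2)"
  define D where "D = (\<lambda>y. (cmod (dseries (log_twist f) (Complex a y)))\<^sup>2)"
  have fn: "cmod (f n) = 1" if "n > 0" for n using f that by (simp add: unimodular_mult_def)
  have sG: "dterm (mangoldt_twist f) (Complex a y) summable_on {1..}" for y
    by (rule abs_summable_summable, rule mangoldt_dterm_summable[OF f]) (use a in simp)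
  have sD: "dterm (log_twist f) (Complex a y) summable_on {1..}" for y
    by (rule log_dseries(1)[OF f]) (use a in simp)
  have bG: "(\<lambda>n. cmod (mangoldt_twist f n) * real n powr (- a)) summable_on {1..}"
    using mangoldt_powr_summable_on[OF a(1)]
    by (rule summable_on_cong[THEN iffD1, rotated]) (simp add: mangoldt_twist_def norm_mult fn)
  have bD: "(\<lambda>n. cmod (log_twist f n) * real n powr (- a)) summable_on {1..}"
    using log_powr_summable_on[OF a(1)]
    by (rule summable_on_cong[THEN iffD1, rotated]) (simp add: log_twist_def norm_mult fn)
  have Gint: "integrable lborel (\<lambda>y. G y / (b\<^sup>2 + y\<^sup>2))" and Gle: "(\<integral>y. G y / (b\<^sup>2 + y\<^sup>2) \<partial>lborel) \<le> 32 * pi * (1 + 1 / \<sigma>) / b"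
    if b: "b \<ge> 1" for b
  proof -
    have b0: "b > 0" using b by simp
    show "integrable lborel (\<lambda>y. G y / (b\<^sup>2 + y\<^sup>2))"
      unfolding G_def by (rule mean_square_limit(1)[OF b0 sG dirichlet_sum_bounded[OF bG]])
    have "(\<lambda>X. \<integral>y. (cmod (\<Sum>n=1..X. dterm (mangoldt_twist f) (Complex a y) n))\<^sup>2 / (b\<^sup>2 + y\<^sup>2) \<partial>lborel) \<longlonglongrightarrow>
      (\<integral>y. G y / (b\<^sup>2 + y\<^sup>2) \<partial>lborel)"
      unfolding G_def by (rule mean_square_limit(2)[OF b0 sG dirichlet_sum_bounded[OF bG]])
    then show "(\<integral>y. G y / (b\<^sup>2 + y\<^sup>2) \<partial>lborel) \<le> 32 * pi * (1 + 1 / \<sigma>) / b"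
    proof (rule LIMSEQ_le_const2, intro exI allI impI)
      fix X :: nat
      show "(\<integral>y. (cmod (\<Sum>n=1..X. dterm (mangoldt_twist f) (Complex a y) n))\<^sup>2 / (b\<^sup>2 + y\<^sup>2) \<partial>lborel) \<le> 32 * pi * (1 + 1 / \<sigma>) / b"
        unfolding a_def by (rule mean_square_mangoldt[OF b \<sigma>(1)]) (simp add: mangoldt_twist_def norm_mult fn)
    qed
  qed
  have Dint: "integrable lborel (\<lambda>y. D y / (a\<^sup>2 + y\<^sup>2))"
    unfolding D_def by (rule mean_square_limit(1)[OF a(3) sD dirichlet_sum_bounded[OF bD]])
  have Dlim: "(\<lambda>X. \<integral>y. (cmod (\<Sum>n=1..X. dterm (log_twist f) (Complex a y) n))\<^sup>2 / (a\<^sup>2 + y\<^sup>2) \<partial>lborel) \<longlonglongrightarrow>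
      (\<integral>y. D y / (a\<^sup>2 + y\<^sup>2) \<partial>lborel)"
    unfolding D_def by (rule mean_square_limit(2)[OF a(3) sD dirichlet_sum_bounded[OF bD]])
  have z: "rzeta a \<le> 2 / \<sigma>" using rzeta_le[OF \<sigma>(1)] \<sigma> by (simp add: a_def field_simps) 
  \<comment> \<open>Beyond \<open>T\<close> the weight is compared with the one of width
    \<open>T\<close>, at the cost of a factor 2; the mean square at \<open>b = T\<close> is what
    supplies 1/T.\<close>
  have pt: "D y / (a\<^sup>2 + y\<^sup>2) \<le> (\<eta> / \<sigma>)\<^sup>2 * (G y / (1\<^sup>2 + y\<^sup>2)) + 2 * (2 / \<sigma>)\<^sup>2 * (G y / (T\<^sup>2 + y\<^sup>2))" for y
  proof -
    define Fy where "Fy = cmod (dseries f (Complex a y))"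
    have Dy: "D y = G y * Fy\<^sup>2"
      unfolding D_def G_def Fy_def using log_dseries(2)[OF f, of "Complex a y"] a by (simp add: norm_mult power_mult_distrib)
    have G0: "G y \<ge> 0" by (simp add: G_def)
    have a2: "1 \<le> a\<^sup>2" using a by (simp add: one_le_power)
    show ?thesis
    proof (cases "\<bar>y\<bar> \<le> T")
      case True
      have "D y / (a\<^sup>2 + y\<^sup>2) \<le> (G y * (\<eta> / \<sigma>)\<^sup>2) / (1\<^sup>2 + y\<^sup>2)"
        unfolding Dy using F[OF True] a2 G0 by (intro frac_le mult_left_mono power_mono) (auto simp: Fy_def a_def add_pos_nonneg)
      moreover have "0 \<le> 2 * (2 / \<sigma>)\<^sup>2 * (G y / (T\<^sup>2 + y\<^sup>2))" using G0 by simp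
      ultimately show ?thesis by (simp add: mult_ac)
    next
      case False
      then have "T\<^sup>2 \<le> y\<^sup>2" using T by (metis abs_le_square_iff abs_of_nonneg less_imp_le not_le order_trans zero_le_one)
      then have "T\<^sup>2 + y\<^sup>2 \<le> 2 * (a\<^sup>2 + y\<^sup>2)" using a2 by simp
      have "Fy \<le> 2 / \<sigma>" using norm_dseries_le[OF f, of "Complex a y"] a z by (simp add: Fy_def)
      then have "D y / (a\<^sup>2 + y\<^sup>2) \<le> (G y * (2 / \<sigma>)\<^sup>2) / ((T\<^sup>2 + y\<^sup>2) / 2)"
        unfolding Dy using \<open>T\<^sup>2 + y\<^sup>2 \<le> 2 * (a\<^sup>2 + y\<^sup>2)\<close> G0 T
        by (intro frac_le mult_left_mono power_mono) (auto simp: Fy_def add_pos_nonneg)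
      moreover have "0 \<le> (\<eta> / \<sigma>)\<^sup>2 * (G y / (1\<^sup>2 + y\<^sup>2))" using G0 by simp
      ultimately show ?thesis by (simp add: mult_ac)
    qed
  qed
  have G1: "integrable lborel (\<lambda>y. (\<eta> / \<sigma>)\<^sup>2 * (G y / (1\<^sup>2 + y\<^sup>2)))"
    by (rule integrable_mult_right[OF Gint]) simp
  have G2: "integrable lborel (\<lambda>y. 2 * (2 / \<sigma>)\<^sup>2 * (G y / (T\<^sup>2 + y\<^sup>2)))"
    by (rule integrable_mult_right[OF Gint]) (rule T)
  have "(\<integral>y. D y / (a\<^sup>2 + y\<^sup>2) \<partial>lborel) \<le> (\<integral>y. (\<eta> / \<sigma>)\<^sup>2 * (G y / (1\<^sup>2 + y\<^sup>2)) + 2 * (2 / \<sigma>)\<^sup>2 * (G y / (T\<^sup>2 + y\<^sup>2)) \<partial>lborel)"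
    by (rule integral_mono[OF Dint Bochner_Integration.integrable_add[OF G1 G2]]) (rule pt)
  also have "\<dots> = (\<eta> / \<sigma>)\<^sup>2 * (\<integral>y. G y / (1\<^sup>2 + y\<^sup>2) \<partial>lborel) + 2 * (2 / \<sigma>)\<^sup>2 * (\<integral>y. G y / (T\<^sup>2 + y\<^sup>2) \<partial>lborel)"
    unfolding Bochner_Integration.integral_add[OF G1 G2] by (simp only: integral_mult_right_zero)
  also have "\<dots> \<le> (\<eta> / \<sigma>)\<^sup>2 * (32 * pi * (1 + 1 / \<sigma>) / 1) + 2 * (2 / \<sigma>)\<^sup>2 * (32 * pi * (1 + 1 / \<sigma>) / T)"
    by (intro add_mono mult_left_mono Gle T) auto
  also have "\<dots> = 32 * pi * (1 + 1 / \<sigma>) * (\<eta>\<^sup>2 + 8 / T) / \<sigma>\<^sup>2"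
  proof -
    have "(\<eta> / \<sigma>)\<^sup>2 * (u / 1) + 2 * (2 / \<sigma>)\<^sup>2 * (u / T) = u * (\<eta>\<^sup>2 + 8 / T) / \<sigma>\<^sup>2" for u
      by (simp add: power_divide distrib_left add_divide_distrib) (simp add: mult_ac)
    then show ?thesis .
  qed
  also have "\<dots> \<le> 32 * pi * (2 / \<sigma>) * (\<eta>\<^sup>2 + 8 / T) / \<sigma>\<^sup>2"
    using \<sigma> T by (intro divide_right_mono mult_right_mono mult_left_mono) (auto simp: field_simps)
  finally have Dle: "(\<integral>y. D y / (a\<^sup>2 + y\<^sup>2) \<partial>lborel) \<le> 64 * pi * (\<eta>\<^sup>2 + 8 / T) / \<sigma> ^ 3"
    by (simp add: power2_eq_square power3_eq_cube mult_ac)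
  have main: "(\<Sum>l=1..X. (real l powr (- 2 * a) - real (Suc l) powr (- 2 * a)) * (cmod (log_partial_sum f l))\<^sup>2) \<le> 
    a / pi * (\<integral>y. D y / (a\<^sup>2 + y\<^sup>2) \<partial>lborel)"
  proof (rule LIMSEQ_le_const[OF tendsto_mult[OF tendsto_const Dlim]], intro exI allI impI)
    fix Y assume Y: "Suc X \<le> Y"
    have w: "real (Suc l) powr (- 2 * a) \<le> real l powr (- 2 * a)" if "l \<ge> 1" for l
      using that a by (intro powr_mono2') auto
    have "(\<Sum>l=1..X. (real l powr (- 2 * a) - real (Suc l) powr (- 2 * a)) * (cmod (log_partial_sum f l))\<^sup>2) \<le>
       (\<Sum>l=1..<Y. (real l powr (- 2 * a) - real (Suc l) powr (- 2 * a)) * (cmod (log_partial_sum f l))\<^sup>2)"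
      using Y w by (intro sum_mono2) (auto intro!: mult_nonneg_nonneg simp del: of_nat_Suc)
    also have "\<dots> \<le> a / pi * (\<integral>y. (cmod (\<Sum>n=1..Y. dterm (log_twist f) (Complex a y) n))\<^sup>2 / (a\<^sup>2 + y\<^sup>2) \<partial>lborel)"
      using mean_square_partial_sums[OF a(3), of Y "log_twist f"] Y by (simp add: partial_sum_log_twist)
    finally show "(\<Sum>l=1..X. (real l powr (- 2 * a) - real (Suc l) powr (- 2 * a)) * (cmod (log_partial_sum f l))\<^sup>2) \<le>
      a / pi * (\<integral>y. (cmod (\<Sum>n=1..Y. dterm (log_twist f) (Complex a y) n))\<^sup>2 / (a\<^sup>2 + y\<^sup>2) \<partial>lborel)" .
  qed
  \<comment> \<open>The mean value theorem bounds the difference below by a multiple of (l +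
    1)^(-1-2a). Replacing l + 1 by 2l and using \<open>a \<le> 2\<close> costs 2^5, and -1 - 2a is
    -3 - 2\<sigma>.\<close>
  have w: "real l powr (- 3 - 2 * \<sigma>) \<le> 2 ^ 5 * (real l powr (- 2 * a) - real (Suc l) powr (- 2 * a))" if l: "l \<ge> 1" for l
  proof -
    have "real (2 * l) powr (- 1 - 2 * a) \<le> real (Suc l) powr (- 1 - 2 * a)"
      using l a by (intro powr_mono2') auto
    also have "\<dots> \<le> 2 * a * real (Suc l) powr (- 1 - 2 * a)"
      using a mult_right_mono[of 1 "2 * a" "real (Suc l) powr (- 1 - 2 * a)"] by simp
    also have "\<dots> \<le> real l powr (- 2 * a) - real (Suc l) powr (- 2 * a)"
      using powr_diff_bounds(1)[of "2 * a" l] l a by simp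
    finally have 1: "real (2 * l) powr (- 1 - 2 * a) \<le> real l powr (- 2 * a) - real (Suc l) powr (- 2 * a)" .
    have "real (2 * l) powr (- 1 - 2 * a) = 2 powr (- 1 - 2 * a) * real l powr (- 1 - 2 * a)"
      by (simp add: powr_mult)
    also have "\<dots> \<ge> 2 powr (- 5) * real l powr (- 1 - 2 * a)"
      using a by (intro mult_right_mono powr_mono) auto
    finally have "2 powr (- 5) * real l powr (- 1 - 2 * a) \<le> real l powr (- 2 * a) - real (Suc l) powr (- 2 * a)"
      using 1 by linarith
    moreover have "(2::real) powr (- 5) = 1 / 2 ^ 5" by (simp add: powr_minus_divide)
    moreover have "- 1 - 2 * a = - 3 - 2 * \<sigma>" by (simp add: a_def)
    ultimately show ?thesis by simp
  qed
  have "(\<Sum>l=1..X. real l powr (- 3 - 2 * \<sigma>) * (cmod (log_partial_sum f l))\<^sup>2) \<le>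
    (\<Sum>l=1..X. 2 ^ 5 * (real l powr (- 2 * a) - real (Suc l) powr (- 2 * a)) * (cmod (log_partial_sum f l))\<^sup>2)"
    by (intro sum_mono mult_right_mono w) auto
  also have "\<dots> = 2 ^ 5 * (\<Sum>l=1..X. (real l powr (- 2 * a) - real (Suc l) powr (- 2 * a)) * (cmod (log_partial_sum f l))\<^sup>2)"
    unfolding sum_distrib_left mult.assoc ..
  also have "\<dots> \<le> 2 ^ 5 * (2 / pi * (64 * pi * (\<eta>\<^sup>2 + 8 / T) / \<sigma> ^ 3))"
  proof (intro mult_left_mono order_trans[OF main])
    show "a / pi * (\<integral>y. D y / (a\<^sup>2 + y\<^sup>2) \<partial>lborel) \<le> 2 / pi * (64 * pi * (\<eta>\<^sup>2 + 8 / T) / \<sigma> ^ 3)"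
      using a Dle by (intro mult_mono divide_right_mono) (auto simp: D_def)
  qed auto
  also have "\<dots> = 2 ^ 12 * (\<eta>\<^sup>2 + 8 / T) / \<sigma> ^ 3" by simp
  finally show ?thesis .
qed

subsection \<open>Halasz's theorem\<close>

lemma sum_inverse_le_ln: "X \<ge> 1 \<Longrightarrow> (\<Sum>m=1..X. 1 / real m) \<le> 1 + ln (real X)"
proof (induction X rule: dec_induct)
  case (step n)
  have "1 / real (Suc n) \<le> ln (real (Suc n)) - ln (real n)"
  proof -
    have "ln (real n / real (Suc n)) \<le> real n / real (Suc n) - 1"
      using step by (intro ln_le_minus_one) auto
    also have "\<dots> = - 1 / real (Suc n)" using step by (simp add: field_simps)
    finally show ?thesis using step by (simp add: ln_div del: of_nat_Suc)
  qed
  with step show ?case by simp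
qed auto

text \<open>The hypothesis of Halasz's theorem made uniform in \<open>f\<close>: the series is
  o(1/\<sigma>) at bounded ordinates, where 1/\<sigma> is the size of zeta at 1 + \<sigma>.\<close>

definition uniformly_small_dseries :: "(nat \<Rightarrow> complex) set \<Rightarrow> bool" where
  "uniformly_small_dseries \<Phi> \<longleftrightarrow> (\<forall>f\<in>\<Phi>. unimodular_mult f) \<and>
     (\<forall>T>0. \<forall>\<eta>>0. \<exists>\<sigma>0>0. \<forall>\<sigma> y. \<forall>f\<in>\<Phi>. 0 < \<sigma> \<longrightarrow> \<sigma> < \<sigma>0 \<longrightarrow> \<bar>y\<bar> \<le> T \<longrightarrow>
        cmod (dseries f (Complex (1 + \<sigma>) y)) \<le> \<eta> / \<sigma>)"

lemma eventually_ln_gt: "\<forall>\<^sub>F x in sequentially. C < ln (real x)"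
  by real_asymp

lemma log_partial_sums_small:
  assumes \<Phi>: "uniformly_small_dseries \<Phi>" and \<epsilon>: "\<epsilon> > 0"
  shows "\<forall>\<^sub>F x in sequentially. \<forall>f\<in>\<Phi>. (\<Sum>l=1..x. (cmod (log_partial_sum f l))\<^sup>2 / real l ^ 3) \<le> \<epsilon> * ln (real x) ^ 3"
proof -
  \<comment> \<open>\<open>T\<close> and \<open>\<eta>\<close> are chosen so that each of the two
    terms in \<open>bound\<close> takes half of \<epsilon>.\<close>
  define T where "T = max 1 (2 ^ 16 * exp 2 / \<epsilon>)"
  define \<eta> where "\<eta> = sqrt (\<epsilon> / (2 ^ 13 * exp 2))"
  have T: "T \<ge> 1" "2 ^ 16 * exp 2 / \<epsilon> \<le> T" by (auto simp: T_def)
  have \<eta>: "\<eta> > 0" using \<epsilon> by (simp add: \<eta>_def)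
  have bound: "exp 2 * (2 ^ 12 * (\<eta>\<^sup>2 + 8 / T)) \<le> \<epsilon>"
  proof -
    have "exp 2 * (2 ^ 12 * \<eta>\<^sup>2) = \<epsilon> / 2" using \<epsilon> by (simp add: \<eta>_def field_simps)
    moreover have "2 ^ 16 * exp 2 \<le> T * \<epsilon>" using T \<epsilon> by (simp add: field_simps)
    then have "exp 2 * (2 ^ 12 * (8 / T)) \<le> \<epsilon> / 2" using T by (simp add: field_simps)
    ultimately show ?thesis by (simp add: distrib_left)
  qed
  have "T > 0" using T(1) by simp
  with \<Phi> \<eta> have "\<exists>\<sigma>0>0. \<forall>\<sigma> y. \<forall>f\<in>\<Phi>. 0 < \<sigma> \<longrightarrow> \<sigma> < \<sigma>0 \<longrightarrow> \<bar>y\<bar> \<le> T \<longrightarrow>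
        cmod (dseries f (Complex (1 + \<sigma>) y)) \<le> \<eta> / \<sigma>"
    unfolding uniformly_small_dseries_def by simp
  then obtain \<sigma>0 where \<sigma>0: "\<sigma>0 > 0" and F: "\<forall>\<sigma> y. \<forall>f\<in>\<Phi>. 0 < \<sigma> \<longrightarrow> \<sigma> < \<sigma>0 \<longrightarrow> \<bar>y\<bar> \<le> T \<longrightarrow>
        cmod (dseries f (Complex (1 + \<sigma>) y)) \<le> \<eta> / \<sigma>"
    by (elim exE conjE)
  show ?thesis
    using eventually_ln_gt[of 1] eventually_ln_gt[of "1 / \<sigma>0"] eventually_gt_at_top[of 1]
  proof eventually_elim
    case (elim x)
    define \<sigma> where "\<sigma> = 1 / ln (real x)"
    have \<sigma>: "0 < \<sigma>" "\<sigma> \<le> 1" "\<sigma> < \<sigma>0"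
      using elim \<sigma>0 by (auto simp: \<sigma>_def field_simps)
    show ?case
    proof
      fix f assume f: "f \<in> \<Phi>"
      have uf: "unimodular_mult f" using \<Phi> f by (simp add: uniformly_small_dseries_def)
      have "(\<Sum>l=1..x. (cmod (log_partial_sum f l))\<^sup>2 / real l ^ 3) \<le>
        (\<Sum>l=1..x. exp 2 * (real l powr (- 3 - 2 * \<sigma>) * (cmod (log_partial_sum f l))\<^sup>2))"
      proof (rule sum_mono)
        fix l assume l: "l \<in> {1..x}"
        have "\<sigma> * ln (real l) \<le> \<sigma> * ln (real x)" using l \<sigma> by (intro mult_left_mono) auto
        also have "\<dots> = 1" using elim by (simp add: \<sigma>_def)
        finally have "1 \<le> exp (2 - 2 * \<sigma> * ln (real l))" by simp
        also have "\<dots> = exp 2 * real l powr (- 2 * \<sigma>)" using l by (simp add: powr_def flip: exp_add)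
        finally have "1 / real l ^ 3 * 1 \<le> 1 / real l ^ 3 * (exp 2 * real l powr (- 2 * \<sigma>))"
          by (intro mult_left_mono) auto
        also have "\<dots> = exp 2 * (real l powr (- 3) * real l powr (- 2 * \<sigma>))"
          using l by (simp add: powr_minus_divide)
        also have "\<dots> = exp 2 * real l powr (- 3 - 2 * \<sigma>)" by (simp flip: powr_add)
        finally have "1 / real l ^ 3 \<le> exp 2 * real l powr (- 3 - 2 * \<sigma>)" by simp
        from mult_right_mono[OF this, of "(cmod (log_partial_sum f l))\<^sup>2"]
        show "(cmod (log_partial_sum f l))\<^sup>2 / real l ^ 3 \<le> exp 2 * (real l powr (- 3 - 2 * \<sigma>) * (cmod (log_partial_sum f l))\<^sup>2)"
          by (simp add: mult_ac)
      qed
      also have "\<dots> \<le> exp 2 * (2 ^ 12 * (\<eta>\<^sup>2 + 8 / T) / \<sigma> ^ 3)"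
        unfolding sum_distrib_left[symmetric]
      proof (intro mult_left_mono weighted_log_partial_sums[OF uf \<sigma>(1,2) T(1) \<eta>])
        show "cmod (dseries f (Complex (1 + \<sigma>) y)) \<le> \<eta> / \<sigma>" if "\<bar>y\<bar> \<le> T" for y
          using F f \<sigma> that by simp
      qed auto
      also have "\<dots> = exp 2 * (2 ^ 12 * (\<eta>\<^sup>2 + 8 / T)) * ln (real x) ^ 3"
        by (simp add: \<sigma>_def power_one_over)
      also have "\<dots> \<le> \<epsilon> * ln (real x) ^ 3"
        using elim by (intro mult_right_mono bound zero_le_power) auto
      finally show "(\<Sum>l=1..x. (cmod (log_partial_sum f l))\<^sup>2 / real l ^ 3) \<le> \<epsilon> * ln (real x) ^ 3" .
    qed
  qed
qed

text \<open>In essence Cauchy-Schwarz between the mean square of the sums with logarithm and the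
  harmonic sum. Dividing by \<open>ln m\<close> is profitable only for m \<ge> x^\<delta>; smaller
  \<open>m\<close> are estimated trivially and cost about \<delta> ln x.\<close>

lemma weighted_partial_sums_small:
  assumes \<Phi>: "uniformly_small_dseries \<Phi>" and \<epsilon>: "\<epsilon> > 0"
  shows "\<forall>\<^sub>F x in sequentially. \<forall>f\<in>\<Phi>. (\<Sum>m=1..x. cmod (partial_sum f m) / (real m)\<^sup>2) \<le> \<epsilon> * ln (real x)"
proof -
  define \<delta> where "\<delta> = min (\<epsilon> / 4) 1"
  have \<delta>: "\<delta> > 0" "\<delta> \<le> 1" "4 * \<delta> \<le> \<epsilon>" using \<epsilon> by (auto simp: \<delta>_def)
  have "\<delta> ^ 4 > 0" using \<delta> by simp
  show ?thesis
    using log_partial_sums_small[OF \<Phi> \<open>\<delta> ^ 4 > 0\<close>] eventually_ln_gt[of 1] eventually_ln_gt[of "(1 + 2 / \<delta>) / \<delta>"] eventually_gt_at_top[of 1]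
  proof eventually_elim
    case (elim x)
    define L where "L = ln (real x)"
    have L: "L > 1" "1 + 2 / \<delta> \<le> \<delta> * L" using elim \<delta> by (auto simp: L_def field_simps)
    show ?case
    proof
      fix f assume f: "f \<in> \<Phi>"
      have uf: "unimodular_mult f" using \<Phi> f by (simp add: uniformly_small_dseries_def)
      have f1: "cmod (f n) = 1" if "n > 0" for n using uf that by (simp add: unimodular_mult_def)
      define S where "S = (\<lambda>m. cmod (partial_sum f m))"
      define N where "N = (\<lambda>m. cmod (log_partial_sum f m))"
      have S_le: "S m \<le> real m" for m
      proof -
        have "S m \<le> (\<Sum>k=1..m. 1)" unfolding S_def partial_sum_def
          by (rule sum_norm_le) (simp add: f1)
        then show ?thesis by simp
      qed
      have inv: "(\<Sum>m=1..x. 1 / real m) \<le> 1 + L"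
        using sum_inverse_le_ln[of x] elim by (simp add: L_def)
      have N2: "(\<Sum>m=1..x. (N m)\<^sup>2 / real m ^ 3) \<le> \<delta> ^ 4 * L ^ 3"
        using elim(1) f by (simp add: N_def L_def)
      have tm: "S m / (real m)\<^sup>2 \<le> (if ln (real m) < \<delta> * L then 1 / real m else 0) +
          ((N m)\<^sup>2 / real m ^ 3 / (\<delta>\<^sup>2 * L) + \<delta>\<^sup>2 * L * (1 / real m)) / 2 / (\<delta> * L) + 1 / real m / (\<delta> * L)" 
        if m: "m \<ge> 1" for m
      proof (cases "ln (real m) < \<delta> * L")
        case True
        have "S m / (real m)\<^sup>2 \<le> real m / (real m)\<^sup>2" by (intro divide_right_mono S_le) auto
        also have "\<dots> = 1 / real m" by (simp add: power2_eq_square)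
        finally show ?thesis using True L \<delta> by (simp add: add_nonneg_nonneg add_increasing2)
      next
        case False
        have DL: "\<delta> * L > 0" "\<delta>\<^sup>2 * L > 0" using L \<delta> by auto
        have "S m * (\<delta> * L) \<le> S m * ln (real m)" using False by (intro mult_left_mono) (auto simp: S_def)
        also have "\<dots> = cmod (partial_sum f m * ln (real m))" using m by (simp add: S_def norm_mult)
        also have "\<dots> \<le> N m + real m"
          using log_partial_sum_approx[OF uf, of m] norm_triangle_ineq3[of "log_partial_sum f m" "partial_sum f m * ln (real m)"]
          unfolding N_def by linarith
        finally have "S m \<le> (N m + real m) / (\<delta> * L)" using DL by (simp add: field_simps)
        then have "S m / (real m)\<^sup>2 \<le> (N m + real m) / (\<delta> * L) / (real m)\<^sup>2" by (intro divide_right_mono) auto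
        also have "\<dots> = (N m / (real m)\<^sup>2) / (\<delta> * L) + 1 / real m / (\<delta> * L)"
          using m by (simp add: add_divide_distrib power2_eq_square mult_ac)
        also have "N m / (real m)\<^sup>2 \<le> ((N m)\<^sup>2 / real m ^ 3 / (\<delta>\<^sup>2 * L) + \<delta>\<^sup>2 * L * (1 / real m)) / 2"
        proof -
          \<comment> \<open>This weight in the inequality of arithmetic and geometric means balances
            \<delta>^4 L^3 / \<tau> against \<tau> L.\<close>
          define \<tau> where "\<tau> = \<delta>\<^sup>2 * L"
          have \<tau>: "\<tau> > 0" using DL by (simp add: \<tau>_def)
          have "0 \<le> (N m / real m - \<tau>)\<^sup>2 / (\<tau> * real m)" using \<tau> by simp
          also have "\<dots> = (N m)\<^sup>2 / real m ^ 3 / \<tau> - 2 * (N m / (real m)\<^sup>2) + \<tau> * (1 / real m)"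
            using \<tau> m by (simp add: power2_eq_square power3_eq_cube field_simps)
          finally show ?thesis unfolding \<tau>_def by simp
        qed
        finally show ?thesis using False DL by (simp add: divide_right_mono)
      qed
      have small: "(\<Sum>m=1..x. if ln (real m) < \<delta> * L then 1 / real m else 0) \<le> 1 + \<delta> * L"
      proof -
        define Y where "Y = nat \<lfloor>exp (\<delta> * L)\<rfloor>"
        have e1: "exp (\<delta> * L) \<ge> 1" using \<delta> L by simp
        have Y: "Y \<ge> 1" "real Y \<le> exp (\<delta> * L)" using e1 by (auto simp: Y_def le_nat_iff)
        have "(\<Sum>m=1..x. if ln (real m) < \<delta> * L then 1 / real m else 0) = (\<Sum>m\<in>{m\<in>{1..x}. ln (real m) < \<delta> * L}. 1 / real m)"
          by (simp add: sum.If_cases Int_def)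
        also have "\<dots> \<le> (\<Sum>m=1..Y. 1 / real m)"
        proof (rule sum_mono2)
          show "{m\<in>{1..x}. ln (real m) < \<delta> * L} \<subseteq> {1..Y}"
          proof
            fix m assume m: "m \<in> {m\<in>{1..x}. ln (real m) < \<delta> * L}"
            then have "real m < exp (\<delta> * L)" by (subst ln_less_cancel_iff[symmetric]) auto
            then have "m \<le> Y" by (simp add: Y_def le_nat_floor)
            with m show "m \<in> {1..Y}" by auto
          qed
        qed auto
        also have "\<dots> \<le> 1 + ln (real Y)" by (rule sum_inverse_le_ln[OF Y(1)])
        also have "ln (real Y) \<le> \<delta> * L" using ln_mono[of "real Y" "exp (\<delta> * L)"] Y by simp
        finally show ?thesis by simp
      qed
      have "(\<Sum>m=1..x. S m / (real m)\<^sup>2) \<le> (\<Sum>m=1..x. (if ln (real m) < \<delta> * L then 1 / real m else 0) +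
          ((N m)\<^sup>2 / real m ^ 3 / (\<delta>\<^sup>2 * L) + \<delta>\<^sup>2 * L * (1 / real m)) / 2 / (\<delta> * L) + 1 / real m / (\<delta> * L))"
        by (intro sum_mono tm) auto
      also have "\<dots> = (\<Sum>m=1..x. (if ln (real m) < \<delta> * L then 1 / real m else 0)) +
          ((\<Sum>m=1..x. (N m)\<^sup>2 / real m ^ 3) / (\<delta>\<^sup>2 * L) + \<delta>\<^sup>2 * L * (\<Sum>m=1..x. 1 / real m)) / 2 / (\<delta> * L) + (\<Sum>m=1..x. 1 / real m) / (\<delta> * L)"
        unfolding sum.distrib sum_divide_distrib[symmetric] sum_distrib_left[symmetric] ..
      also have "\<dots> \<le> (1 + \<delta> * L) + (\<delta> ^ 4 * L ^ 3 / (\<delta>\<^sup>2 * L) + \<delta>\<^sup>2 * L * (1 + L)) / 2 / (\<delta> * L) + (1 + L) / (\<delta> * L)"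
        using \<delta> L by (intro add_mono divide_right_mono mult_left_mono small N2 inv) auto
      also have "\<dots> \<le> (1 + \<delta> * L) + (\<delta>\<^sup>2 * L\<^sup>2 + \<delta>\<^sup>2 * L * (2 * L)) / 2 / (\<delta> * L) + (2 * L) / (\<delta> * L)"
      proof -
        have "\<delta> ^ 4 * L ^ 3 / (\<delta>\<^sup>2 * L) = \<delta>\<^sup>2 * L\<^sup>2" using \<delta> L by (simp add: field_simps power2_eq_square eval_nat_numeral)
        then show ?thesis using \<delta> L by (intro add_mono divide_right_mono mult_left_mono) auto
      qed
      also have "\<dots> = 1 + \<delta> * L + 3 / 2 * \<delta> * L + 2 / \<delta>"
        using \<delta> L by (simp add: field_simps power2_eq_square)
      also have "\<dots> \<le> 4 * \<delta> * L" using L(2) mult_pos_pos[of \<delta> L] \<delta>(1) L(1) unfolding mult.assoc by linarith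
      also have "\<dots> \<le> \<epsilon> * L" using \<delta> L by (intro mult_right_mono) auto
      finally show "(\<Sum>m=1..x. cmod (partial_sum f m) / (real m)\<^sup>2) \<le> \<epsilon> * ln (real x)"
        by (simp add: S_def L_def)
    qed
  qed
qed

theorem halasz_uniform:
  assumes \<Phi>: "uniformly_small_dseries \<Phi>" and \<epsilon>: "\<epsilon> > 0"
  shows "\<forall>\<^sub>F x in sequentially. \<forall>f\<in>\<Phi>. cmod (partial_sum f x) \<le> \<epsilon> * real x"
proof -
  define \<delta> where "\<delta> = min (\<epsilon> / 80) (1/2)"
  have \<delta>: "\<delta> > 0" "\<delta> \<le> 1/2" "80 * \<delta> \<le> \<epsilon>" using \<epsilon> by (auto simp: \<delta>_def)
  have "\<forall>\<^sub>F x in sequentially. \<forall>f\<in>\<Phi>. (\<Sum>m=1..2*x. cmod (partial_sum f m) / (real m)\<^sup>2) \<le> \<delta>\<^sup>2 * ln (real (2 * x))"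
  proof -
    have "filterlim (\<lambda>x::nat. 2 * x) sequentially sequentially"
      by (rule filterlim_subseq) (auto simp: strict_mono_def)
    moreover have "\<delta>\<^sup>2 > 0" using \<delta> by simp
    ultimately show ?thesis
      using eventually_compose_filterlim[OF weighted_partial_sums_small[OF \<Phi>]] by blast
  qed
  then show ?thesis
    using eventually_ln_gt[of 1] eventually_ln_gt[of "4 / \<epsilon>"] eventually_gt_at_top[of "nat \<lceil>1 / \<delta>\<rceil> + 2"]
  proof eventually_elim
    case (elim x)
    define L where "L = ln (real x)"
    have L: "L > 1" "2 / L \<le> \<epsilon> / 2" using elim \<epsilon> by (auto simp: L_def field_simps)
    have x: "x \<ge> 2" "\<delta> * real x \<ge> 1"
    proof -
      show "x \<ge> 2" using elim by simp
      have "1 / \<delta> \<le> real x" using elim(4) by linarith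
      then show "\<delta> * real x \<ge> 1" using \<delta> by (simp add: field_simps)
    qed
    \<comment> \<open>With a weighted sum of order \<delta>^2 L, a window of length about \<delta> x
      balances the terms: after division by \<open>h * L\<close>, the main term and the cost of
      shifting are both of order \<delta> x.\<close>
    define h where "h = nat \<lceil>\<delta> * real x\<rceil>"
    have h1: "real h \<ge> \<delta> * real x" unfolding h_def by linarith
    have h2: "real h \<le> 2 * \<delta> * real x" using x(2) unfolding h_def by linarith
    have "2 * \<delta> * real x \<le> real x" using mult_right_mono[of "2 * \<delta>" 1 "real x"] \<delta> by simp
    then have h: "1 \<le> h" "h \<le> x" "real h > 0" using h1 h2 x by linarith+
    have L2: "ln (2 * real x) \<le> 2 * L"
    proof -
      have "ln (2 * real x) \<le> ln (real x * real x)" using x by (intro ln_mono) auto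
      then show ?thesis using x by (simp add: ln_mult L_def)
    qed
    show ?case
    proof
      fix f assume f: "f \<in> \<Phi>"
      have uf: "unimodular_mult f" using \<Phi> f by (simp add: uniformly_small_dseries_def)
      have "real h * L * cmod (partial_sum f x) \<le>
        16 * (real x)\<^sup>2 * (\<Sum>m=1..2*x. cmod (partial_sum f m) / (real m)\<^sup>2) + 2 * real h * real x + (real h)\<^sup>2 * ln (2 * real x)"
        unfolding L_def using partial_sum_le_average[OF uf _ h(1,2)] x by simp
      also have "\<dots> \<le> 16 * (real x)\<^sup>2 * (\<delta>\<^sup>2 * (2 * L)) + 2 * real h * real x + (real h)\<^sup>2 * (2 * L)"
      proof (intro add_mono mult_left_mono order_refl L2)
        have "(\<Sum>m=1..2*x. cmod (partial_sum f m) / (real m)\<^sup>2) \<le> \<delta>\<^sup>2 * ln (2 * real x)"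
          using elim(1) f by simp
        also have "\<dots> \<le> \<delta>\<^sup>2 * (2 * L)" by (intro mult_left_mono L2) auto
        finally show "(\<Sum>m=1..2*x. cmod (partial_sum f m) / (real m)\<^sup>2) \<le> \<delta>\<^sup>2 * (2 * L)" .
      qed auto
      also have "\<dots> = 32 * (\<delta> * real x)\<^sup>2 * L + 2 * real h * real x + 2 * (real h)\<^sup>2 * L"
        by (simp add: power_mult_distrib mult_ac)
      also have "\<dots> \<le> 32 * (real h * (\<delta> * real x)) * L + 2 * real h * real x + 2 * (real h * (2 * \<delta> * real x)) * L"
        using h1 h2 L \<delta> x by (intro add_mono mult_right_mono mult_left_mono order_refl) (auto simp: power2_eq_square intro!: mult_mono)
      also have "\<dots> = real h * L * ((36 * \<delta> + 2 / L) * real x)"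
        using L by (simp add: field_simps)
      finally have "cmod (partial_sum f x) \<le> (36 * \<delta> + 2 / L) * real x"
        by (rule mult_left_le_imp_le) (use h L in auto)
      also have "\<dots> \<le> \<epsilon> * real x"
        using \<delta> L by (intro mult_right_mono) auto
      finally show "cmod (partial_sum f x) \<le> \<epsilon> * real x" .
    qed
  qed
qed

subsection \<open>Square-integrable functions\<close>

abbreviation L2_dist :: "'a measure \<Rightarrow> ('a \<Rightarrow> complex) \<Rightarrow> ('a \<Rightarrow> complex) \<Rightarrow> real" where
  "L2_dist M F G \<equiv> L2_norm M (\<lambda>x. F x - G x)"

lemma L2_spaceD:
  assumes "F \<in> L2_space M"
  shows "F \<in> borel_measurable M" "integrable M (\<lambda>x. (cmod (F x))\<^sup>2)"
  using assms by (auto simp: L2_space_def)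

lemma L2_norm_nonneg [simp]: "L2_norm M F \<ge> 0"
  by (simp add: L2_norm_def)

lemma L2_norm_sq: "(L2_norm M F)\<^sup>2 = (\<integral>x. (cmod (F x))\<^sup>2 \<partial>M)"
  by (simp add: L2_norm_def)

lemma cmod_add_sq_le:
  assumes "t > 0"
  shows "(cmod (a + b))\<^sup>2 \<le> (1 + t) * (cmod a)\<^sup>2 + (1 + 1 / t) * (cmod b)\<^sup>2"
proof -
  have "(cmod (a + b))\<^sup>2 \<le> (cmod a + cmod b)\<^sup>2"
    by (intro power_mono norm_triangle_ineq) auto
  also have "\<dots> \<le> (1 + t) * (cmod a)\<^sup>2 + (1 + 1 / t) * (cmod b)\<^sup>2"
  proof -
    have "0 \<le> (t * cmod a - cmod b)\<^sup>2 / t" using assms by simp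
    also have "\<dots> = t * (cmod a)\<^sup>2 + (cmod b)\<^sup>2 / t - 2 * cmod a * cmod b"
      using assms by (simp add: power2_eq_square field_simps)
    finally show ?thesis by (simp add: power2_eq_square algebra_simps)
  qed
  finally show ?thesis .
qed

lemma L2_space_add:
  assumes "F \<in> L2_space M" "G \<in> L2_space M"
  shows "(\<lambda>x. F x + G x) \<in> L2_space M"
proof -
  note [measurable] = L2_spaceD(1)[OF assms(1)] L2_spaceD(1)[OF assms(2)]
  have "integrable M (\<lambda>x. (cmod (F x + G x))\<^sup>2)"
  proof (rule Bochner_Integration.integrable_bound)
    show "integrable M (\<lambda>x. 2 * (cmod (F x))\<^sup>2 + 2 * (cmod (G x))\<^sup>2)"
      using assms by (intro Bochner_Integration.integrable_add integrable_mult_right L2_spaceD)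
    show "AE x in M. norm ((cmod (F x + G x))\<^sup>2) \<le> norm (2 * (cmod (F x))\<^sup>2 + 2 * (cmod (G x))\<^sup>2)"
      using cmod_add_sq_le[of 1 "F x" "G x" for x] by auto
  qed measurable
  then show ?thesis by (auto simp: L2_space_def)
qed

lemma L2_space_scale:
  assumes "F \<in> L2_space M"
  shows "(\<lambda>x. c * F x) \<in> L2_space M"
  using assms by (auto simp: L2_space_def norm_mult power_mult_distrib)

lemma L2_norm_scale: "L2_norm M (\<lambda>x. c * F x) = cmod c * L2_norm M F"
  by (simp add: L2_norm_def norm_mult power_mult_distrib real_sqrt_mult)

lemma L2_space_diff:
  assumes "F \<in> L2_space M" "G \<in> L2_space M"
  shows "(\<lambda>x. F x - G x) \<in> L2_space M"
  using L2_space_add[OF assms(1) L2_space_scale[OF assms(2), of "-1"]] by simp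

lemma L2_space_zero [simp]: "(\<lambda>_. 0) \<in> L2_space M"
  by (simp add: L2_space_def)

lemma L2_space_sum:
  assumes "\<And>i. i \<in> I \<Longrightarrow> F i \<in> L2_space M"
  shows "(\<lambda>x. \<Sum>i\<in>I. F i x) \<in> L2_space M"
  using assms by (induction I rule: infinite_finite_induct) (auto intro: L2_space_add)

lemma L2_norm_zero [simp]: "L2_norm M (\<lambda>_. 0) = 0"
  by (simp add: L2_norm_def)

text \<open>Integrating \<open>cmod_add_sq_le\<close> with t = b/a gives (a + b)^2 when
  \<open>a\<close> and \<open>b\<close> bound the norms. The added e/2 keeps the quotient meaningful
  if a norm is 0.\<close>

lemma L2_norm_triangle:
  assumes "F \<in> L2_space M" "G \<in> L2_space M"
  shows "L2_norm M (\<lambda>x. F x + G x) \<le> L2_norm M F + L2_norm M G"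
proof (rule field_le_epsilon)
  fix e :: real assume e: "e > 0"
  define a where "a = L2_norm M F + e / 2"
  define b where "b = L2_norm M G + e / 2"
  have ab: "a > 0" "b > 0" "L2_norm M F \<le> a" "L2_norm M G \<le> b"
    using e L2_norm_nonneg[of M F] L2_norm_nonneg[of M G] unfolding a_def b_def by linarith+
  have "(L2_norm M (\<lambda>x. F x + G x))\<^sup>2 \<le> (\<integral>x. (1 + b / a) * (cmod (F x))\<^sup>2 + (1 + 1 / (b / a)) * (cmod (G x))\<^sup>2 \<partial>M)"
    unfolding L2_norm_sq
    using assms ab L2_space_add[OF assms]
    by (intro integral_mono Bochner_Integration.integrable_add integrable_mult_right cmod_add_sq_le L2_spaceD(2)) auto
  also have "\<dots> = (1 + b / a) * (L2_norm M F)\<^sup>2 + (1 + 1 / (b / a)) * (L2_norm M G)\<^sup>2"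
    using assms by (subst Bochner_Integration.integral_add) (auto simp: L2_norm_sq intro!: integrable_mult_right L2_spaceD)
  also have "\<dots> \<le> (1 + b / a) * a\<^sup>2 + (1 + 1 / (b / a)) * b\<^sup>2"
    using ab by (intro add_mono mult_left_mono power_mono) auto
  also have "\<dots> = (a + b)\<^sup>2"
    using ab by (simp add: field_simps power2_eq_square)
  finally have "L2_norm M (\<lambda>x. F x + G x) \<le> a + b" 
    by (rule power2_le_imp_le) (use ab in simp)
  then show "L2_norm M (\<lambda>x. F x + G x) \<le> L2_norm M F + L2_norm M G + e"
    by (simp add: a_def b_def)
qed

lemma L2_norm_minus_commute: "L2_dist M F G = L2_dist M G F"
  by (simp add: L2_norm_def norm_minus_commute)

lemma L2_norm_triangle_diff:
  assumes "F \<in> L2_space M" "G \<in> L2_space M" "H \<in> L2_space M"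
  shows "L2_dist M F H \<le> L2_dist M F G + L2_dist M G H"
  using L2_norm_triangle[OF L2_space_diff[OF assms(1,2)] L2_space_diff[OF assms(2,3)]] by simp

lemma L2_norm_sum_le:
  assumes "\<And>i. i \<in> I \<Longrightarrow> F i \<in> L2_space M"
  shows "L2_norm M (\<lambda>x. \<Sum>i\<in>I. F i x) \<le> (\<Sum>i\<in>I. L2_norm M (F i))"
  using assms
proof (induction I rule: infinite_finite_induct)
  case (insert i I)
  have "L2_norm M (\<lambda>x. \<Sum>i\<in>insert i I. F i x) \<le> L2_norm M (F i) + L2_norm M (\<lambda>x. \<Sum>i\<in>I. F i x)"
    using insert L2_norm_triangle[of "F i" M "\<lambda>x. \<Sum>i\<in>I. F i x"] L2_space_sum[of I F M] by simp
  with insert show ?case by simp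
qed auto

lemma L2_norm_parallelogram:
  assumes "F \<in> L2_space M" "G \<in> L2_space M"
  shows "(L2_dist M F G)\<^sup>2 = 2 * (L2_norm M F)\<^sup>2 + 2 * (L2_norm M G)\<^sup>2 - (L2_norm M (\<lambda>x. F x + G x))\<^sup>2"
proof -
  have "(L2_dist M F G)\<^sup>2 + (L2_norm M (\<lambda>x. F x + G x))\<^sup>2 = (\<integral>x. (cmod (F x - G x))\<^sup>2 + (cmod (F x + G x))\<^sup>2 \<partial>M)"
    unfolding L2_norm_sq
    by (intro Bochner_Integration.integral_add[symmetric] L2_spaceD(2) L2_space_add L2_space_diff assms)
  also have "\<dots> = (\<integral>x. 2 * (cmod (F x))\<^sup>2 + 2 * (cmod (G x))\<^sup>2 \<partial>M)"
  proof (intro Bochner_Integration.integral_cong refl)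
    fix x
    show "(cmod (F x - G x))\<^sup>2 + (cmod (F x + G x))\<^sup>2 = 2 * (cmod (F x))\<^sup>2 + 2 * (cmod (G x))\<^sup>2"
      by (simp add: cmod_power2) (simp add: power2_eq_square algebra_simps)
  qed
  also have "\<dots> = 2 * (L2_norm M F)\<^sup>2 + 2 * (L2_norm M G)\<^sup>2"
    using assms by (subst Bochner_Integration.integral_add) (auto simp: L2_norm_sq intro!: integrable_mult_right L2_spaceD)
  finally show ?thesis by simp
qed

lemma L2_nn_integral:
  assumes "F \<in> L2_space M"
  shows "(\<integral>\<^sup>+x. ennreal ((cmod (F x))\<^sup>2) \<partial>M) = ennreal ((L2_norm M F)\<^sup>2)"
  unfolding L2_norm_sq by (rule nn_integral_eq_integral[OF L2_spaceD(2)[OF assms]]) auto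

lemma L2_norm_le_nn_integral:
  assumes "F \<in> borel_measurable M" "(\<integral>\<^sup>+x. ennreal ((cmod (F x))\<^sup>2) \<partial>M) \<le> ennreal (C\<^sup>2)" "C \<ge> 0"
  shows "F \<in> L2_space M" "L2_norm M F \<le> C"
proof -
  have "integrable M (\<lambda>x. (cmod (F x))\<^sup>2)"
    using assms by (intro integrableI_bounded) (auto simp: less_top[symmetric] top_unique dest: order_le_less_trans)
  then show F: "F \<in> L2_space M" using assms by (simp add: L2_space_def)
  have "(L2_norm M F)\<^sup>2 \<le> C\<^sup>2"
    using assms(2) unfolding L2_nn_integral[OF F] by (simp add: ennreal_le_iff)
  then show "L2_norm M F \<le> C" using assms(3) by (rule power2_le_imp_le)
qed

text \<open>The Riesz-Fischer argument: a rapidly convergent subsequence converges almost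
  everywhere, and Fatou's lemma turns this pointwise limit into a norm limit of the whole
  sequence.\<close>

lemma (in prob_space) L2_complete:
  assumes F: "\<And>n. F n \<in> L2_space M"
    and cauchy: "\<And>e. e > 0 \<Longrightarrow> \<exists>N. \<forall>m\<ge>N. \<forall>n\<ge>N. L2_dist M (F m) (F n) \<le> e"
  obtains G where "G \<in> L2_space M" "(\<lambda>n. L2_dist M (F n) G) \<longlonglongrightarrow> 0"
proof -
  have "\<forall>j::nat. \<exists>N. \<forall>m\<ge>N. \<forall>n\<ge>N. L2_dist M (F m) (F n) \<le> (1/2)^j"
    using cauchy by simp
  then obtain N where N: "\<And>j m n. m \<ge> N j \<Longrightarrow> n \<ge> N j \<Longrightarrow> L2_dist M (F m) (F n) \<le> (1/2)^j"
    by metis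
  \<comment> \<open>Summing the thresholds makes every index from \<open>r j\<close> on admissible
    for all accuracies up to \<open>j\<close> at once.\<close>
  define r where "r = (\<lambda>j. \<Sum>i\<le>j. N i)"
  have r: "r i \<ge> N j" if "i \<ge> j" for i j
    unfolding r_def using that by (intro member_le_sum) auto
  have [measurable]: "F n \<in> borel_measurable M" for n using F by (rule L2_spaceD)
  define D where "D = (\<lambda>j x. F (r (Suc j)) x - F (r j) x)"
  have [measurable]: "D j \<in> borel_measurable M" for j unfolding D_def by measurable
  have D: "D j \<in> L2_space M" "L2_norm M (D j) \<le> (1/2)^j" for j
    unfolding D_def by (auto intro!: L2_space_diff F N r)
  \<comment> \<open>The quadratic bound becomes one for the first moment by the inequality of
    arithmetic and geometric means with weight 2^j, the constant term being integrated against total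
    mass 1. Summable first moments give almost everywhere convergence.\<close>
  have D1: "(\<integral>\<^sup>+x. ennreal (cmod (D j x)) \<partial>M) \<le> ennreal ((1/2)^j)" for j
  proof -
    have "cmod (D j x) \<le> 2^j / 2 * (cmod (D j x))\<^sup>2 + (1/2)^j / 2" for x
    proof -
      have "0 \<le> (cmod (D j x) - (1/2)^j)\<^sup>2 * 2^j" by simp
      also have "\<dots> = 2^j * (cmod (D j x))\<^sup>2 - 2 * cmod (D j x) + (1/2)^j"
        by (simp add: power2_eq_square algebra_simps power_one_over)
      finally show ?thesis by simp
    qed
    then have "(\<integral>\<^sup>+x. ennreal (cmod (D j x)) \<partial>M) \<le> (\<integral>\<^sup>+x. ennreal (2^j / 2 * (cmod (D j x))\<^sup>2 + (1/2)^j / 2) \<partial>M)"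
      by (intro nn_integral_mono ennreal_leI)
    also have "\<dots> = ennreal (\<integral>x. 2^j / 2 * (cmod (D j x))\<^sup>2 + (1/2)^j / 2 \<partial>M)"
      by (intro nn_integral_eq_integral Bochner_Integration.integrable_add integrable_mult_right L2_spaceD(2)[OF D(1)]) auto
    also have "(\<integral>x. 2^j / 2 * (cmod (D j x))\<^sup>2 + (1/2)^j / 2 \<partial>M) = 2^j / 2 * (L2_norm M (D j))\<^sup>2 + (1/2)^j / 2"
      by (subst Bochner_Integration.integral_add)
         (auto simp: L2_norm_sq prob_space intro!: integrable_mult_right L2_spaceD(2)[OF D(1)])
    also have "\<dots> \<le> 2^j / 2 * ((1/2)^j)\<^sup>2 + (1/2)^j / 2"
      using D(2) by (intro add_mono mult_left_mono power_mono) auto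
    also have "\<dots> = (1/2)^j" by (simp add: power2_eq_square power_one_over)
    finally show ?thesis by (simp add: ennreal_leI)
  qed
  have summ: "AE x in M. summable (\<lambda>j. cmod (D j x))"
  proof -
    have "(\<integral>\<^sup>+x. (\<Sum>j. ennreal (cmod (D j x))) \<partial>M) = (\<Sum>j. \<integral>\<^sup>+x. ennreal (cmod (D j x)) \<partial>M)"
      by (intro nn_integral_suminf) measurable
    also have "\<dots> \<le> (\<Sum>j. ennreal ((1/2)^j))" by (intro suminf_le D1) auto
    also have "\<dots> = ennreal (\<Sum>j. (1/2)^j)" by (intro suminf_ennreal2) (auto intro!: summable_geometric)
    also have "\<dots> < \<infinity>" by simp
    finally have "AE x in M. (\<Sum>j. ennreal (cmod (D j x))) \<noteq> \<infinity>"
      by (intro nn_integral_PInf_AE) auto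
    then show ?thesis
      by eventually_elim (rule summable_suminf_not_top, auto)
  qed
  \<comment> \<open>On the null set without convergence \<open>lim\<close> is an unspecified value;
    \<open>G\<close> is measurable nevertheless.\<close>
  define G where "G = (\<lambda>x. lim (\<lambda>j. F (r j) x))"
  have [measurable]: "G \<in> borel_measurable M" unfolding G_def by (rule borel_measurable_lim_metric) measurable
  have lim: "AE x in M. (\<lambda>j. F (r j) x) \<longlonglongrightarrow> G x"
    using summ
  proof eventually_elim
    case (elim x)
    then have "summable (\<lambda>j. D j x)" by (rule summable_norm_cancel)
    then have "convergent (\<lambda>n. \<Sum>j<n. D j x)" by (simp add: summable_iff_convergent)
    then have "convergent (\<lambda>n. F (r 0) x + (\<Sum>j<n. D j x))"
      by (intro convergent_add convergent_const)
    also have "(\<lambda>n. F (r 0) x + (\<Sum>j<n. D j x)) = (\<lambda>n. F (r n) x)"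
      unfolding D_def using sum_lessThan_telescope[of "\<lambda>j. F (r j) x"] by (intro ext) simp
    finally show ?case unfolding G_def by (simp add: convergent_LIMSEQ_iff)
  qed
  have close: "F n \<in> L2_space M \<and> (\<lambda>x. F n x - G x) \<in> L2_space M \<and> L2_dist M (F n) G \<le> (1/2)^j" if n: "n \<ge> N j" for n j
  proof -
    have "(\<integral>\<^sup>+x. ennreal ((cmod (F n x - G x))\<^sup>2) \<partial>M) = (\<integral>\<^sup>+x. liminf (\<lambda>i. ennreal ((cmod (F n x - F (r i) x))\<^sup>2)) \<partial>M)"
    proof (rule nn_integral_cong_AE, use lim in eventually_elim)
      case (elim x)
      have "(\<lambda>i. ennreal ((cmod (F n x - F (r i) x))\<^sup>2)) \<longlonglongrightarrow> ennreal ((cmod (F n x - G x))\<^sup>2)"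
        by (intro tendsto_ennrealI tendsto_power tendsto_norm tendsto_diff tendsto_const elim)
      then show ?case by (intro lim_imp_Liminf[symmetric]) auto
    qed
    also have "\<dots> \<le> liminf (\<lambda>i. \<integral>\<^sup>+x. ennreal ((cmod (F n x - F (r i) x))\<^sup>2) \<partial>M)"
      by (rule nn_integral_liminf) measurable
    also have "\<dots> \<le> ennreal (((1/2)^j)\<^sup>2)"
    proof (rule Liminf_le)
      show "\<forall>\<^sub>F i in sequentially. (\<integral>\<^sup>+x. ennreal ((cmod (F n x - F (r i) x))\<^sup>2) \<partial>M) \<le> ennreal (((1/2)^j)\<^sup>2)"
        using eventually_ge_at_top[of j]
      proof eventually_elim
        case (elim i)
        have "(\<integral>\<^sup>+x. ennreal ((cmod (F n x - F (r i) x))\<^sup>2) \<partial>M) = ennreal ((L2_dist M (F n) (F (r i)))\<^sup>2)"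
          by (rule L2_nn_integral[OF L2_space_diff[OF F F]])
        also have "\<dots> \<le> ennreal (((1/2)^j)\<^sup>2)"
          using N[OF n r[OF elim]] by (intro ennreal_leI power_mono) auto
        finally show ?case .
      qed
    qed auto
    finally have "(\<integral>\<^sup>+x. ennreal ((cmod (F n x - G x))\<^sup>2) \<partial>M) \<le> ennreal (((1/2)^j)\<^sup>2)" .
    from L2_norm_le_nn_integral[OF _ this] F show ?thesis by auto
  qed
  have "G \<in> L2_space M"
    using L2_space_diff[of "F (N 0)" M "\<lambda>x. F (N 0) x - G x"] close[of 0 "N 0"] by simp
  moreover have "(\<lambda>n. L2_dist M (F n) G) \<longlonglongrightarrow> 0"
  proof (rule LIMSEQ_I)
    fix e :: real assume "e > 0"
    then obtain j where j: "(1/2::real)^j < e" using real_arch_pow_inv[of e "1/2"] by auto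
    then show "\<exists>no. \<forall>n\<ge>no. norm (L2_dist M (F n) G - 0) < e"
      using close by (intro exI[of _ "N j"]) force
  qed
  ultimately show ?thesis by (rule that)
qed

section \<open>Finite Fourier analysis on boxes of exponents\<close>

text \<open>The grid stands for the group of functions from \<open>R\<close> to the integers modulo \<open>Q\<close>, written with
  representatives below \<open>Q\<close>; \<open>grid_shift\<close> is its translation.\<close>

definition grid :: "'i set \<Rightarrow> nat \<Rightarrow> ('i \<Rightarrow> nat) set" where
  "grid R Q = (\<Pi>\<^sub>E r\<in>R. {..<Q})"

definition root_of_unity :: "nat \<Rightarrow> complex" where
  "root_of_unity Q = exp (2 * of_real pi * \<i> / of_nat Q)"

definition grid_char :: "'i set \<Rightarrow> nat \<Rightarrow> ('i \<Rightarrow> nat) \<Rightarrow> ('i \<Rightarrow> nat) \<Rightarrow> complex" where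
  "grid_char R Q \<theta> u = (\<Prod>r\<in>R. (root_of_unity Q ^ \<theta> r) ^ u r)"

lemma root_of_unity_power: "Q > 0 \<Longrightarrow> root_of_unity Q ^ Q = 1"
  unfolding root_of_unity_def exp_of_nat_mult[symmetric] by simp

lemma cmod_root_of_unity [simp]: "cmod (root_of_unity Q) = 1"
  by (simp add: root_of_unity_def norm_exp_eq_Re)

text \<open>A geometric sum whose ratio is a root of unity of order dividing \<open>Q\<close>; the
  ratio is 1 only if \<open>a\<close> and \<open>b\<close> agree modulo \<open>Q\<close>, and both
  are below \<open>Q\<close>.\<close>

lemma sum_root_of_unity:
  assumes "Q > 0" "a < Q" "b < Q"
  shows "(\<Sum>t<Q. (root_of_unity Q ^ t) ^ a * cnj ((root_of_unity Q ^ t) ^ b)) = (if a = b then of_nat Q else 0)"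
proof -
  define \<omega> where "\<omega> = root_of_unity Q"
  have c1: "\<omega> ^ n * cnj (\<omega> ^ n) = 1" for n
    by (simp only: complex_norm_square[symmetric]) (simp add: \<omega>_def norm_power)
  define q where "q = \<omega> ^ a * cnj (\<omega> ^ b)"
  have t: "(\<omega> ^ t) ^ a * cnj ((\<omega> ^ t) ^ b) = q ^ t" for t
    by (simp add: q_def power_mult_distrib mult.commute flip: power_mult)
  show ?thesis
  proof (cases "a = b")
    case True
    then show ?thesis using t c1 unfolding \<omega>_def[symmetric] by (simp add: q_def)
  next
    case False
    have "q ^ Q = (\<omega> ^ Q) ^ a * cnj ((\<omega> ^ Q) ^ b)" by (rule t[symmetric])
    then have "q ^ Q = 1" using root_of_unity_power[OF assms(1)] by (simp add: \<omega>_def)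
    moreover have "q \<noteq> 1"
    proof
      assume "q = 1"
      have "\<omega> ^ a = \<omega> ^ a * (\<omega> ^ b * cnj (\<omega> ^ b))" by (simp only: c1 mult_1_right)
      also have "\<dots> = q * \<omega> ^ b" by (simp only: q_def mult_ac)
      finally have "\<omega> ^ a = \<omega> ^ b" using \<open>q = 1\<close> by simp
      then have "exp (of_nat a * (2 * of_real pi * \<i> / of_nat Q)) = exp (of_nat b * (2 * of_real pi * \<i> / of_nat Q))"
        unfolding \<omega>_def root_of_unity_def exp_of_nat_mult .
      then obtain n :: int where "of_nat a * (2 * of_real pi * \<i> / of_nat Q) = of_nat b * (2 * of_real pi * \<i> / of_nat Q) + (of_int (2 * n) * of_real pi) * \<i>"
        unfolding exp_eq by auto
      then have "of_nat a * (2 * of_real pi * \<i>) = of_nat b * (2 * of_real pi * \<i>) + (of_int (2 * n) * of_real pi) * \<i> * of_nat Q"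
        using assms(1) by (simp add: field_simps)
      then have "(2 * of_real pi * \<i>) * of_nat a = (2 * of_real pi * \<i>) * (of_nat b + of_int n * of_nat Q)"
        by (simp add: algebra_simps)
      then have "complex_of_int (int a) = complex_of_int (int b + n * int Q)" by simp
      then have "int a = int b + n * int Q" by (simp only: of_int_eq_iff)
      then have "int a mod int Q = int b mod int Q" by simp
      then show False using assms False by simp
    qed
    ultimately have "(\<Sum>t<Q. q ^ t) = 0" by (simp add: sum_gp_strict)
    then show ?thesis using False t unfolding \<omega>_def[symmetric] by simp
  qed
qed

lemma finite_grid [simp]: "finite R \<Longrightarrow> finite (grid R Q)"
  unfolding grid_def by (intro finite_PiE) auto

lemma grid_char_orthogonal:
  assumes "finite R" "Q > 0" "u \<in> grid R Q" "v \<in> grid R Q"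
  shows "(\<Sum>\<theta>\<in>grid R Q. grid_char R Q \<theta> u * cnj (grid_char R Q \<theta> v)) = (if u = v then of_nat (Q ^ card R) else 0)"
proof -
  have "(\<Sum>\<theta>\<in>grid R Q. grid_char R Q \<theta> u * cnj (grid_char R Q \<theta> v)) =
    (\<Sum>\<theta>\<in>grid R Q. \<Prod>r\<in>R. (root_of_unity Q ^ \<theta> r) ^ u r * cnj ((root_of_unity Q ^ \<theta> r) ^ v r))"
    by (simp add: grid_char_def prod.distrib)
  also have "\<dots> = (\<Prod>r\<in>R. \<Sum>t<Q. (root_of_unity Q ^ t) ^ u r * cnj ((root_of_unity Q ^ t) ^ v r))"
    unfolding grid_def by (rule prod_sum_PiE[symmetric]) (use assms in auto)
  also have "\<dots> = (\<Prod>r\<in>R. if u r = v r then of_nat Q else 0)"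
    using assms by (intro prod.cong refl sum_root_of_unity) (auto simp: grid_def PiE_iff)
  also have "\<dots> = (if u = v then of_nat (Q ^ card R) else 0)"
  proof (cases "u = v")
    case False
    then obtain r where "r \<in> R" "u r \<noteq> v r" using assms(3,4) by (metis PiE_ext grid_def)
    then show ?thesis using False assms(1) by (auto intro!: prod_zero)
  qed simp
  finally show ?thesis .
qed

lemma grid_parseval:
  assumes "finite R" "Q > 0"
  shows "(\<Sum>\<theta>\<in>grid R Q. (cmod (\<Sum>u\<in>grid R Q. h u * grid_char R Q \<theta> u))\<^sup>2) = real (Q ^ card R) * (\<Sum>u\<in>grid R Q. (cmod (h u))\<^sup>2)"
proof -
  have "complex_of_real (\<Sum>\<theta>\<in>grid R Q. (cmod (\<Sum>u\<in>grid R Q. h u * grid_char R Q \<theta> u))\<^sup>2) =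
    (\<Sum>\<theta>\<in>grid R Q. (\<Sum>u\<in>grid R Q. h u * grid_char R Q \<theta> u) * cnj (\<Sum>v\<in>grid R Q. h v * grid_char R Q \<theta> v))"
    by (simp only: of_real_sum complex_norm_square)
  also have "\<dots> = (\<Sum>\<theta>\<in>grid R Q. \<Sum>u\<in>grid R Q. \<Sum>v\<in>grid R Q. h u * cnj (h v) * (grid_char R Q \<theta> u * cnj (grid_char R Q \<theta> v)))"
    by (simp add: sum_product mult_ac)
  also have "\<dots> = (\<Sum>u\<in>grid R Q. \<Sum>v\<in>grid R Q. h u * cnj (h v) * (\<Sum>\<theta>\<in>grid R Q. grid_char R Q \<theta> u * cnj (grid_char R Q \<theta> v)))"
    unfolding sum_distrib_left by (rule trans[OF sum.swap], rule sum.cong[OF refl], rule sum.swap)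
  also have "\<dots> = (\<Sum>u\<in>grid R Q. \<Sum>v\<in>grid R Q. if u = v then h u * cnj (h v) * of_nat (Q ^ card R) else 0)"
    using assms by (intro sum.cong refl) (simp add: grid_char_orthogonal)
  also have "\<dots> = (\<Sum>u\<in>grid R Q. h u * cnj (h u) * of_nat (Q ^ card R))"
    using assms by (intro sum.cong refl) simp
  also have "\<dots> = complex_of_real (real (Q ^ card R) * (\<Sum>u\<in>grid R Q. (cmod (h u))\<^sup>2))"
    by (simp add: sum_distrib_left mult_ac complex_norm_square[symmetric])
  finally show ?thesis by (simp only: of_real_eq_iff)
qed

definition grid_shift :: "'i set \<Rightarrow> nat \<Rightarrow> ('i \<Rightarrow> nat) \<Rightarrow> ('i \<Rightarrow> nat) \<Rightarrow> 'i \<Rightarrow> nat" where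
  "grid_shift R Q e u = (\<lambda>r\<in>R. (u r + e r) mod Q)"

lemma bij_grid_shift:
  assumes "finite R" "Q > 0"
  shows "bij_betw (grid_shift R Q e) (grid R Q) (grid R Q)"
proof -
  have into: "grid_shift R Q e ` grid R Q \<subseteq> grid R Q"
    using assms by (auto simp: grid_shift_def grid_def)
  have "inj_on (grid_shift R Q e) (grid R Q)"
  proof (rule inj_onI)
    fix u v assume uv: "u \<in> grid R Q" "v \<in> grid R Q" "grid_shift R Q e u = grid_shift R Q e v"
    have "u r = v r" if "r \<in> R" for r
    proof -
      have "(u r + e r) mod Q = (v r + e r) mod Q"
        using fun_cong[OF uv(3), of r] that by (simp add: grid_shift_def)
      then have "[u r + e r = v r + e r] (mod Q)" by (simp add: cong_def)
      then have "[u r = v r] (mod Q)" by (simp add: cong_add_rcancel_nat)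
      moreover have "u r < Q" "v r < Q" using uv that by (auto simp: grid_def PiE_iff)
      ultimately show ?thesis by (simp add: cong_def)
    qed
    then show "u = v" using uv(1,2) by (metis PiE_ext grid_def)
  qed
  then show ?thesis using into endo_inj_surj[OF finite_grid[OF assms(1)]] by (simp add: bij_betw_def)
qed

lemma grid_char_shift:
  assumes "finite R" "Q > 0" "u \<in> grid R Q"
  shows "grid_char R Q \<theta> u = cnj (\<Prod>r\<in>R. (root_of_unity Q ^ \<theta> r) ^ e r) * grid_char R Q \<theta> (grid_shift R Q e u)"
proof -
  have "grid_char R Q \<theta> (grid_shift R Q e u) = (\<Prod>r\<in>R. (root_of_unity Q ^ \<theta> r) ^ (u r + e r))"
    unfolding grid_char_def
  proof (intro prod.cong refl)
    fix r assume r: "r \<in> R"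
    define w where "w = root_of_unity Q ^ \<theta> r"
    have "w ^ Q = (root_of_unity Q ^ Q) ^ \<theta> r" by (simp add: w_def mult.commute flip: power_mult)
    then have wQ: "w ^ Q = 1" using root_of_unity_power[OF assms(2)] by simp
    have "w ^ (u r + e r) = w ^ ((u r + e r) mod Q + Q * ((u r + e r) div Q))" by simp
    also have "\<dots> = w ^ ((u r + e r) mod Q)" unfolding power_add power_mult wQ by simp
    finally show "(root_of_unity Q ^ \<theta> r) ^ grid_shift R Q e u r = (root_of_unity Q ^ \<theta> r) ^ (u r + e r)"
      using r by (simp add: w_def grid_shift_def)
  qed
  also have "\<dots> = grid_char R Q \<theta> u * (\<Prod>r\<in>R. (root_of_unity Q ^ \<theta> r) ^ e r)"
    by (simp add: power_add prod.distrib grid_char_def)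
  finally have "cnj (\<Prod>r\<in>R. (root_of_unity Q ^ \<theta> r) ^ e r) * grid_char R Q \<theta> (grid_shift R Q e u) =
    grid_char R Q \<theta> u * ((\<Prod>r\<in>R. (root_of_unity Q ^ \<theta> r) ^ e r) * cnj (\<Prod>r\<in>R. (root_of_unity Q ^ \<theta> r) ^ e r))"
    by (simp add: mult_ac)
  also have "(\<Prod>r\<in>R. (root_of_unity Q ^ \<theta> r) ^ e r) * cnj (\<Prod>r\<in>R. (root_of_unity Q ^ \<theta> r) ^ e r) = 1"
    by (simp only: complex_norm_square[symmetric]) (simp add: prod_norm[symmetric] norm_power)
  finally show ?thesis by simp
qed

text \<open>A combination of translations is diagonal in the characters. Its eigenvalue at \<theta>
  is the sum in the hypothesis, evaluated at conjugate roots of unity, so \<kappa> bounds every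
  eigenvalue and Parseval bounds the operator.\<close>

lemma grid_convolution_bound:
  fixes g :: "('i \<Rightarrow> nat) \<Rightarrow> complex" and c :: "'n \<Rightarrow> complex"
  assumes R: "finite R" and Q: "Q > 0"
    and \<kappa>: "\<And>z. (\<And>r. r \<in> R \<Longrightarrow> cmod (z r) = 1) \<Longrightarrow> cmod (\<Sum>n\<in>A. c n * (\<Prod>r\<in>R. z r ^ e n r)) \<le> \<kappa>"
  shows "(\<Sum>u\<in>grid R Q. (cmod (\<Sum>n\<in>A. c n * g (grid_shift R Q (e n) u)))\<^sup>2) \<le> \<kappa>\<^sup>2 * (\<Sum>u\<in>grid R Q. (cmod (g u))\<^sup>2)"
proof -
  define h where "h = (\<lambda>u. \<Sum>n\<in>A. c n * g (grid_shift R Q (e n) u))"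
  define gh where "gh = (\<lambda>\<theta>. \<Sum>u\<in>grid R Q. g u * grid_char R Q \<theta> u)"
  have H: "(\<Sum>u\<in>grid R Q. h u * grid_char R Q \<theta> u) = (\<Sum>n\<in>A. c n * (\<Prod>r\<in>R. cnj (root_of_unity Q ^ \<theta> r) ^ e n r)) * gh \<theta>" for \<theta>
  proof -
    have "(\<Sum>u\<in>grid R Q. h u * grid_char R Q \<theta> u) = (\<Sum>n\<in>A. c n * (\<Sum>u\<in>grid R Q. g (grid_shift R Q (e n) u) * grid_char R Q \<theta> u))"
      unfolding h_def sum_distrib_right sum_distrib_left by (subst sum.swap) (simp add: mult_ac)
    also have "\<dots> = (\<Sum>n\<in>A. c n * (cnj (\<Prod>r\<in>R. (root_of_unity Q ^ \<theta> r) ^ e n r) * gh \<theta>))"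
    proof (intro sum.cong refl arg_cong2[of _ _ _ _ "(*)"])
      fix n
      have "(\<Sum>u\<in>grid R Q. g (grid_shift R Q (e n) u) * grid_char R Q \<theta> u) =
        (\<Sum>u\<in>grid R Q. g (grid_shift R Q (e n) u) * (cnj (\<Prod>r\<in>R. (root_of_unity Q ^ \<theta> r) ^ e n r) * grid_char R Q \<theta> (grid_shift R Q (e n) u)))"
        by (intro sum.cong refl arg_cong2[of _ _ _ _ "(*)"] grid_char_shift R Q)
      also have "\<dots> = (\<Sum>u\<in>grid R Q. g u * (cnj (\<Prod>r\<in>R. (root_of_unity Q ^ \<theta> r) ^ e n r) * grid_char R Q \<theta> u))"
        by (rule sum.reindex_bij_betw[OF bij_grid_shift[OF R Q]])
      also have "\<dots> = cnj (\<Prod>r\<in>R. (root_of_unity Q ^ \<theta> r) ^ e n r) * gh \<theta>"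
        unfolding gh_def sum_distrib_left by (intro sum.cong refl) (simp only: mult_ac)
      finally show "(\<Sum>u\<in>grid R Q. g (grid_shift R Q (e n) u) * grid_char R Q \<theta> u) = cnj (\<Prod>r\<in>R. (root_of_unity Q ^ \<theta> r) ^ e n r) * gh \<theta>" .
    qed
    finally show ?thesis by (simp add: sum_distrib_right mult.assoc)
  qed
  have "real (Q ^ card R) * (\<Sum>u\<in>grid R Q. (cmod (h u))\<^sup>2) = (\<Sum>\<theta>\<in>grid R Q. (cmod (\<Sum>u\<in>grid R Q. h u * grid_char R Q \<theta> u))\<^sup>2)"
    by (rule grid_parseval[OF R Q, symmetric])
  also have "\<dots> \<le> (\<Sum>\<theta>\<in>grid R Q. \<kappa>\<^sup>2 * (cmod (gh \<theta>))\<^sup>2)"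
  proof (rule sum_mono)
    fix \<theta>
    have "cmod (\<Sum>n\<in>A. c n * (\<Prod>r\<in>R. cnj (root_of_unity Q ^ \<theta> r) ^ e n r)) \<le> \<kappa>"
      by (rule \<kappa>) (simp add: norm_power)
    then show "(cmod (\<Sum>u\<in>grid R Q. h u * grid_char R Q \<theta> u))\<^sup>2 \<le> \<kappa>\<^sup>2 * (cmod (gh \<theta>))\<^sup>2"
      unfolding H norm_mult power_mult_distrib by (intro mult_right_mono power_mono) auto
  qed
  also have "\<dots> = real (Q ^ card R) * (\<kappa>\<^sup>2 * (\<Sum>u\<in>grid R Q. (cmod (g u))\<^sup>2))"
    unfolding gh_def sum_distrib_left[symmetric] grid_parseval[OF R Q] by simp
  finally show ?thesis unfolding h_def using Q by simp
qed

subsection \<open>Transference\<close>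

definition class_exponent :: "(nat \<Rightarrow> 'i) \<Rightarrow> nat \<Rightarrow> 'i \<Rightarrow> nat" where
  "class_exponent \<rho> n r = count (image_mset \<rho> (prime_factorization n)) r"

lemma class_exponent_mult:
  "m > 0 \<Longrightarrow> n > 0 \<Longrightarrow> class_exponent \<rho> (m * n) r = class_exponent \<rho> m r + class_exponent \<rho> n r"
  by (simp add: class_exponent_def prime_factorization_mult)

lemma class_exponent_1 [simp]: "class_exponent \<rho> (Suc 0) r = 0" "class_exponent \<rho> 1 r = 0"
  by (simp_all add: class_exponent_def)

lemma class_exponent_prime: "prime p \<Longrightarrow> class_exponent \<rho> p r = (if r = \<rho> p then 1 else 0)"
  by (simp add: class_exponent_def prime_factorization_prime)

text \<open>A character of the group of exponent vectors, read along \<open>n\<close>. For unit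
  \<open>z\<close> these are the unimodular completely multiplicative functions that are constant on
  the classes.\<close>

definition class_character :: "(nat \<Rightarrow> 'i) \<Rightarrow> ('i \<Rightarrow> complex) \<Rightarrow> nat \<Rightarrow> complex" where
  "class_character \<rho> z n = (\<Prod>r\<in>\<rho> ` {p. prime p}. z r ^ class_exponent \<rho> n r)"

lemma class_character_unimodular:
  assumes "finite (\<rho> ` {p. prime p})" "\<And>r. r \<in> \<rho> ` {p. prime p} \<Longrightarrow> cmod (z r) = 1"
  shows "unimodular_mult (class_character \<rho> z)"
  unfolding unimodular_mult_def class_character_def
  using assms by (auto simp: class_exponent_mult power_add prod.distrib norm_power prod_norm[symmetric])

lemma class_character_prime:
  assumes "finite (\<rho> ` {p. prime p})" "prime p"
  shows "class_character \<rho> z p = z (\<rho> p)"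
proof -
  have "class_character \<rho> z p = (\<Prod>r\<in>\<rho> ` {p. prime p}. if r = \<rho> p then z r else 1)"
    unfolding class_character_def using assms(2) by (intro prod.cong refl) (simp add: class_exponent_prime)
  also have "\<dots> = z (\<rho> p)" using assms by (subst prod.delta) auto
  finally show ?thesis .
qed

lemma class_characters_uniformly_small:
  assumes fin: "finite (\<rho> ` {p. prime p})" and div: "\<not> (\<lambda>p. 1 / real p) summable_on {p. prime p \<and> \<rho> p = r}"
    and c: "c > 0"
  shows "uniformly_small_dseries {class_character \<rho> z |z. (\<forall>r\<in>\<rho> ` {p. prime p}. cmod (z r) = 1) \<and> cmod (z r - 1) \<ge> c}"
  unfolding uniformly_small_dseries_def
proof (intro conjI ballI allI impI)
  fix f assume "f \<in> {class_character \<rho> z |z. (\<forall>r\<in>\<rho> ` {p. prime p}. cmod (z r) = 1) \<and> cmod (z r - 1) \<ge> c}"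
  then show "unimodular_mult f" using class_character_unimodular[OF fin] by blast
next
  fix T \<eta> :: real assume T: "T > 0" and \<eta>: "\<eta> > 0"
  obtain \<sigma>0 where \<sigma>0: "\<sigma>0 > 0"
    and *: "\<And>\<sigma> y f z. \<lbrakk>0 < \<sigma>; \<sigma> < \<sigma>0; unimodular_mult f; \<And>p. prime p \<Longrightarrow> f p = z (\<rho> p); cmod (z r - 1) \<ge> c; \<bar>y\<bar> \<le> T\<rbrakk>
      \<Longrightarrow> cmod (dseries f (Complex (1 + \<sigma>) y)) \<le> \<eta> / \<sigma>"
    by (rule dseries_uniform_bound[OF fin div c T \<eta>]) blast
  have "cmod (dseries (class_character \<rho> z) (Complex (1 + \<sigma>) y)) \<le> \<eta> / \<sigma>"
    if "\<forall>r\<in>\<rho> ` {p. prime p}. cmod (z r) = 1" "cmod (z r - 1) \<ge> c" "0 < \<sigma>" "\<sigma> < \<sigma>0" "\<bar>y\<bar> \<le> T" for z \<sigma> y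
    by (rule *[of _ _ z]) (use that in \<open>auto intro!: class_character_unimodular fin class_character_prime\<close>)
  with \<sigma>0 show "\<exists>\<sigma>0>0. \<forall>\<sigma> y. \<forall>f\<in>{class_character \<rho> z |z. (\<forall>r\<in>\<rho> ` {p. prime p}. cmod (z r) = 1) \<and> cmod (z r - 1) \<ge> c}.
     0 < \<sigma> \<longrightarrow> \<sigma> < \<sigma>0 \<longrightarrow> \<bar>y\<bar> \<le> T \<longrightarrow> cmod (dseries f (Complex (1 + \<sigma>) y)) \<le> \<eta> / \<sigma>"
    by (intro exI[of _ \<sigma>0]) blast
qed

lemma ergodic_average_altdef: "ergodic_average S F N x = (\<Sum>n=1..N. (1 / of_nat N) * F (S n x))"
  by (simp add: ergodic_average_def sum_distrib_left)

lemma ergodic_average_diff: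
  "ergodic_average S (\<lambda>x. F x - G x) N x = ergodic_average S F N x - ergodic_average S G N x"
  by (simp add: ergodic_average_def sum_subtractf right_diff_distrib)

context multiplicative_system
begin

lemma S_measurable [measurable]: "n \<ge> 1 \<Longrightarrow> S n \<in> measurable M M"
  using invertible[of n] by (simp add: invertible_measure_preserving_def)

lemma S_space: "n \<ge> 1 \<Longrightarrow> x \<in> space M \<Longrightarrow> S n x \<in> space M"
  using measurable_space[OF S_measurable] by blast

lemma S_distr: "n \<ge> 1 \<Longrightarrow> distr M M (S n) = M"
  using invertible[of n] by (simp add: invertible_measure_preserving_def)

lemma S_one: 
  assumes "x \<in> space M"
  shows "S (Suc 0) x = x"
proof -
  have "S 1 (S 1 x) = S 1 x" using multiplicative[of 1 1 x] assms by simp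
  moreover have "inj_on (S 1) (space M)" using invertible[of 1] by (auto simp: invertible_measure_preserving_def bij_betw_def)
  ultimately show ?thesis using assms S_space[of 1 x] by (auto dest: inj_onD)
qed

lemma L2_space_S:
  assumes "F \<in> L2_space M" "n \<ge> 1"
  shows "(\<lambda>x. F (S n x)) \<in> L2_space M"
proof -
  note [measurable] = L2_spaceD(1)[OF assms(1)] S_measurable[OF assms(2)]
  have "integrable (distr M M (S n)) (\<lambda>x. (cmod (F x))\<^sup>2)"
    using L2_spaceD(2)[OF assms(1)] S_distr[OF assms(2)] by simp
  then have "integrable M (\<lambda>x. (cmod (F (S n x)))\<^sup>2)"
    by (subst (asm) integrable_distr_eq) auto
  then show ?thesis by (simp add: L2_space_def)
qed

lemma L2_norm_S:
  assumes "F \<in> L2_space M" "n \<ge> 1"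
  shows "L2_norm M (\<lambda>x. F (S n x)) = L2_norm M F"
proof -
  note [measurable] = L2_spaceD(1)[OF assms(1)] S_measurable[OF assms(2)]
  have "(\<integral>x. (cmod (F x))\<^sup>2 \<partial>distr M M (S n)) = (\<integral>x. (cmod (F (S n x)))\<^sup>2 \<partial>M)"
    by (rule integral_distr) auto
  then show ?thesis using S_distr[OF assms(2)] by (simp add: L2_norm_def)
qed

lemma L2_space_average:
  assumes "F \<in> L2_space M"
  shows "ergodic_average S F N \<in> L2_space M"
  unfolding ergodic_average_altdef using assms by (intro L2_space_sum L2_space_scale L2_space_S) auto

lemma L2_norm_average_le:
  assumes "F \<in> L2_space M"
  shows "L2_norm M (ergodic_average S F N) \<le> L2_norm M F"
proof (cases "N = 0")
  case False
  have "L2_norm M (ergodic_average S F N) \<le> (\<Sum>n=1..N. L2_norm M (\<lambda>x. (1 / of_nat N) * F (S n x)))"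
    unfolding ergodic_average_altdef using assms by (intro L2_norm_sum_le L2_space_scale L2_space_S) auto
  also have "\<dots> = (\<Sum>n=1..N. (1 / real N) * L2_norm M F)"
    using assms by (intro sum.cong refl) (subst L2_norm_scale, subst L2_norm_S, auto simp: norm_divide)
  also have "\<dots> = L2_norm M F" using False by simp
  finally show ?thesis .
next
  case True
  then have "ergodic_average S F N = (\<lambda>_. 0)" by (simp add: ergodic_average_def fun_eq_iff)
  then show ?thesis by simp
qed

text \<open>The labels of the classes are themselves primes, one representative for each class, so
  an exponent vector can be turned back into an index of \<open>S\<close>.\<close>

definition class_power :: "(nat \<Rightarrow> nat) \<Rightarrow> (nat \<Rightarrow> nat) \<Rightarrow> nat" where
  "class_power \<rho> u = (\<Prod>r\<in>\<rho> ` {p. prime p}. r ^ u r)"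

text \<open>Induction over the prime factors, each \<open>p\<close> acting as its representative
  \<open>\<rho> p\<close>. Thus \<open>S n\<close> depends on the exponent vector of
  \<open>n\<close> only, and acts along an orbit as translation by it.\<close>

lemma S_class_power:
  assumes fin: "finite (\<rho> ` {p. prime p})" and \<rho>: "\<And>p. prime p \<Longrightarrow> prime (\<rho> p)"
    and S\<rho>: "\<And>p x. prime p \<Longrightarrow> x \<in> space M \<Longrightarrow> S (\<rho> p) x = S p x"
    and n: "n > 0" and x: "x \<in> space M"
  shows "S (class_power \<rho> (class_exponent \<rho> n)) x = S n x"
  using n
proof (induction n rule: prime_divisors_induct)
  case (unit n)
  then show ?case by (simp add: class_power_def)
next
  case (factor p n)
  then have p: "prime p" "p > 0" and n: "n > 0" by (auto simp: prime_gt_0_nat)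
  have pos: "class_power \<rho> u > 0" for u
    unfolding class_power_def using \<rho> by (intro prod_pos) (auto simp: prime_gt_0_nat)
  have "class_power \<rho> (class_exponent \<rho> (p * n)) = class_power \<rho> (class_exponent \<rho> p) * class_power \<rho> (class_exponent \<rho> n)"
    unfolding class_power_def using p n by (simp add: class_exponent_mult power_add prod.distrib)
  also have "class_power \<rho> (class_exponent \<rho> p) = \<rho> p"
  proof -
    have "class_power \<rho> (class_exponent \<rho> p) = (\<Prod>r\<in>\<rho> ` {p. prime p}. if r = \<rho> p then r else 1)"
      unfolding class_power_def using p(1) by (intro prod.cong refl) (simp add: class_exponent_prime)
    also have "\<dots> = \<rho> p" using fin p by (subst prod.delta) auto
    finally show ?thesis .
  qed
  finally have "S (class_power \<rho> (class_exponent \<rho> (p * n))) x = S (\<rho> p) (S (class_power \<rho> (class_exponent \<rho> n)) x)"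
    using multiplicative[of "\<rho> p" "class_power \<rho> (class_exponent \<rho> n)" x] \<rho>[OF p(1)] pos x by (simp add: Suc_le_eq prime_gt_0_nat)
  also have "\<dots> = S p (S n x)"
    using factor.IH n S\<rho>[OF p(1)] S_space x by simp
  also have "\<dots> = S (p * n) x" using multiplicative[of p n x] p n x by simp
  finally show ?case .
qed auto

text \<open>Transference: along each orbit the operator is a convolution on a box of exponents, where Parseval
  applies; the boundary of the box is negligible as the box grows.\<close>

lemma transference:
  assumes fin: "finite (\<rho> ` {p. prime p})" and \<rho>: "\<And>p. prime p \<Longrightarrow> prime (\<rho> p)"
    and S\<rho>: "\<And>p x. prime p \<Longrightarrow> x \<in> space M \<Longrightarrow> S (\<rho> p) x = S p x"
    and A: "finite A" "\<And>n. n \<in> A \<Longrightarrow> n > 0" and G: "G \<in> L2_space M"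
    and \<kappa>: "\<kappa> \<ge> 0" "\<And>z. (\<And>r. r \<in> \<rho> ` {p. prime p} \<Longrightarrow> cmod (z r) = 1) \<Longrightarrow> cmod (\<Sum>n\<in>A. c n * class_character \<rho> z n) \<le> \<kappa>"
  shows "L2_norm M (\<lambda>x. \<Sum>n\<in>A. c n * G (S n x)) \<le> \<kappa> * L2_norm M G"
proof -
  define R where "R = \<rho> ` {p. prime p}"
  define e where "e = class_exponent \<rho>"
  define P where "P = class_power \<rho>"
  define K where "K = (\<lambda>x. \<Sum>n\<in>A. c n * G (S n x))"
  \<comment> \<open>A bound for all exponents in play: translation by \<open>e n\<close> moves the
    box of side \<open>L\<close> into the box of side \<open>L + B\<close>, so the reduction modulo
    \<open>L + B\<close> is inactive there.\<close>
  define B where "B = (\<Sum>n\<in>A. \<Sum>r\<in>R. e n r)"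
  have R: "finite R" using fin by (simp add: R_def)
  have B: "e n r \<le> B" if "n \<in> A" "r \<in> R" for n r
  proof -
    have "e n r \<le> (\<Sum>r\<in>R. e n r)" using that R by (intro member_le_sum) auto
    also have "\<dots> \<le> B" unfolding B_def using that A by (intro member_le_sum[of n A "\<lambda>n. \<Sum>r\<in>R. e n r"]) auto
    finally show ?thesis .
  qed
  have P: "P u \<ge> 1" for u
    unfolding P_def class_power_def using \<rho> by (auto simp: Suc_le_eq prime_gt_0_nat intro!: prod_pos)
  have K: "K \<in> L2_space M" unfolding K_def using A G by (intro L2_space_sum L2_space_scale L2_space_S) (auto simp: Suc_le_eq)
  have pointwise: "(\<Sum>u\<in>grid R L. (cmod (K (S (P u) x)))\<^sup>2) \<le> \<kappa>\<^sup>2 * (\<Sum>u\<in>grid R (L + B). (cmod (G (S (P u) x)))\<^sup>2)"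
    if x: "x \<in> space M" and L: "L > 0" for x L
  proof -
    define g where "g = (\<lambda>u. G (S (P u) x))"
    have eq: "K (S (P u) x) = (\<Sum>n\<in>A. c n * g (grid_shift R (L + B) (e n) u))" if u: "u \<in> grid R L" for u
      unfolding K_def g_def
    proof (intro sum.cong refl arg_cong2[of _ _ _ _ "(*)"] arg_cong[of _ _ G])
      fix n assume n: "n \<in> A"
      have "grid_shift R (L + B) (e n) u r = u r + e n r" if "r \<in> R" for r
        using u B[OF n that] that by (auto simp: grid_shift_def grid_def PiE_iff add_strict_mono add_less_le_mono)
      then have "P (grid_shift R (L + B) (e n) u) = P (e n) * P u"
        unfolding P_def class_power_def R_def[symmetric] by (simp add: power_add prod.distrib[symmetric] mult.commute)
      then have "S (P (grid_shift R (L + B) (e n) u)) x = S (P (e n)) (S (P u) x)"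
        using multiplicative[of "P (e n)" "P u" x] P x by simp
      also have "\<dots> = S n (S (P u) x)"
        using S_class_power[OF fin \<rho> S\<rho>, of n "S (P u) x"] A(2)[OF n] S_space[OF P x] by (simp add: P_def e_def)
      finally show "S n (S (P u) x) = S (P (grid_shift R (L + B) (e n) u)) x" ..
    qed
    have "(\<Sum>u\<in>grid R L. (cmod (K (S (P u) x)))\<^sup>2) = (\<Sum>u\<in>grid R L. (cmod (\<Sum>n\<in>A. c n * g (grid_shift R (L + B) (e n) u)))\<^sup>2)"
      by (intro sum.cong refl) (simp add: eq)
    also have "\<dots> \<le> (\<Sum>u\<in>grid R (L + B). (cmod (\<Sum>n\<in>A. c n * g (grid_shift R (L + B) (e n) u)))\<^sup>2)"
    proof (rule sum_mono2)
      show "grid R L \<subseteq> grid R (L + B)" unfolding grid_def by (intro PiE_mono) auto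
    qed (use R in auto)
    also have "\<dots> \<le> \<kappa>\<^sup>2 * (\<Sum>u\<in>grid R (L + B). (cmod (g u))\<^sup>2)"
      using \<kappa>(2) L unfolding class_character_def R_def[symmetric] e_def[symmetric]
      by (intro grid_convolution_bound R) auto
    finally show ?thesis by (simp add: g_def)
  qed
  define k where "k = card R"
  have card: "card (grid R L) = L ^ k" for L using R by (simp add: grid_def card_PiE k_def)
  have int: "integrable M (\<lambda>x. (cmod (H (S (P u) x)))\<^sup>2)" if "H \<in> L2_space M" for H u
    by (rule L2_spaceD(2)[OF L2_space_S[OF that P]])
  have int_eq: "(\<integral>x. (cmod (H (S (P u) x)))\<^sup>2 \<partial>M) = (L2_norm M H)\<^sup>2" if "H \<in> L2_space M" for H u
    using L2_norm_S[OF that P[of u]] L2_norm_sq[of M "\<lambda>x. H (S (P u) x)"] by simp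
  have main: "real L ^ k * (L2_norm M K)\<^sup>2 \<le> \<kappa>\<^sup>2 * (real (L + B) ^ k * (L2_norm M G)\<^sup>2)" if L: "L > 0" for L
  proof -
    have "real L ^ k * (L2_norm M K)\<^sup>2 = (\<integral>x. (\<Sum>u\<in>grid R L. (cmod (K (S (P u) x)))\<^sup>2) \<partial>M)"
      by (subst Bochner_Integration.integral_sum) (auto simp: int_eq[OF K] card intro!: int K)
    also have "\<dots> \<le> (\<integral>x. \<kappa>\<^sup>2 * (\<Sum>u\<in>grid R (L + B). (cmod (G (S (P u) x)))\<^sup>2) \<partial>M)"
      by (intro integral_mono Bochner_Integration.integrable_sum integrable_mult_right int K G pointwise L)
    also have "\<dots> = \<kappa>\<^sup>2 * (real (L + B) ^ k * (L2_norm M G)\<^sup>2)"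
    proof -
      have "(\<integral>x. (\<Sum>u\<in>grid R (L + B). (cmod (G (S (P u) x)))\<^sup>2) \<partial>M) = real (L + B) ^ k * (L2_norm M G)\<^sup>2"
        by (subst Bochner_Integration.integral_sum) (auto simp: int_eq[OF G] card intro!: int G)
      then show ?thesis by simp
    qed
    finally show ?thesis .
  qed
  \<comment> \<open>The ratio of the volumes of the two boxes tends to 1 with growing
    \<open>L\<close>, which removes the boundary loss from the constant.\<close>
  have "(L2_norm M K)\<^sup>2 \<le> \<kappa>\<^sup>2 * (L2_norm M G)\<^sup>2"
  proof (rule LIMSEQ_le_const)
    have "(\<lambda>L. real (Suc L + B) / real (Suc L)) \<longlonglongrightarrow> 1" by real_asymp
    then have "(\<lambda>L. \<kappa>\<^sup>2 * ((real (Suc L + B) / real (Suc L)) ^ k * (L2_norm M G)\<^sup>2)) \<longlonglongrightarrow> \<kappa>\<^sup>2 * (1 ^ k * (L2_norm M G)\<^sup>2)"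
      by (intro tendsto_mult tendsto_const tendsto_power)
    then show "(\<lambda>L. \<kappa>\<^sup>2 * ((real (Suc L + B) / real (Suc L)) ^ k * (L2_norm M G)\<^sup>2)) \<longlonglongrightarrow> \<kappa>\<^sup>2 * (L2_norm M G)\<^sup>2" by simp
    have "(L2_norm M K)\<^sup>2 \<le> \<kappa>\<^sup>2 * ((real (Suc L + B) / real (Suc L)) ^ k * (L2_norm M G)\<^sup>2)" for L
      using main[of "Suc L"] by (simp add: power_divide pos_le_divide_eq mult_ac del: of_nat_Suc of_nat_add)
    then show "\<exists>N. \<forall>L\<ge>N. (L2_norm M K)\<^sup>2 \<le> \<kappa>\<^sup>2 * ((real (Suc L + B) / real (Suc L)) ^ k * (L2_norm M G)\<^sup>2)" by blast
  qed
  then have "(L2_norm M K)\<^sup>2 \<le> (\<kappa> * L2_norm M G)\<^sup>2" by (simp add: power_mult_distrib)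
  then show ?thesis unfolding K_def by (rule power2_le_imp_le) (use \<kappa> in simp)
qed

lemma average_coboundary_tendsto_0:
  assumes fin: "finite (\<rho> ` {p. prime p})" and \<rho>: "\<And>p. prime p \<Longrightarrow> prime (\<rho> p)"
    and S\<rho>: "\<And>p x. prime p \<Longrightarrow> x \<in> space M \<Longrightarrow> S (\<rho> p) x = S p x"
    and p: "prime p" and div: "\<not> (\<lambda>q. 1 / real q) summable_on {q. prime q \<and> \<rho> q = \<rho> p}"
    and F: "F \<in> L2_space M"
  shows "(\<lambda>N. L2_norm M (ergodic_average S (\<lambda>x. F x - F (S p x)) N)) \<longlonglongrightarrow> 0"
proof (rule LIMSEQ_I)
  fix e :: real assume e: "e > 0"
  define \<epsilon> where "\<epsilon> = e / (2 * (L2_norm M F + 1))"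
  have LF: "L2_norm M F + 1 > 0" using L2_norm_nonneg[of M F] by linarith
  have \<epsilon>: "\<epsilon> > 0" using e LF by (simp add: \<epsilon>_def)
  \<comment> \<open>Only characters with \<open>f p\<close> at distance at least \<epsilon> from 1
    require Halasz's theorem; there |1 - f p| \<le> 2 explains the bound \<epsilon>/2. For the
    others the factor is below \<epsilon> and the average of \<open>f\<close> is at most 1.\<close>
  define \<Phi> where "\<Phi> = {class_character \<rho> z |z. (\<forall>r\<in>\<rho> ` {p. prime p}. cmod (z r) = 1) \<and> cmod (z (\<rho> p) - 1) \<ge> \<epsilon>}"
  have "\<forall>\<^sub>F N in sequentially. \<forall>f\<in>\<Phi>. cmod (partial_sum f N) \<le> (\<epsilon> / 2) * real N"
    unfolding \<Phi>_def by (rule halasz_uniform[OF class_characters_uniformly_small[OF fin div \<epsilon>]]) (use \<epsilon> in simp)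
  then obtain N0 where N0: "\<And>N f. N \<ge> N0 \<Longrightarrow> f \<in> \<Phi> \<Longrightarrow> cmod (partial_sum f N) \<le> (\<epsilon> / 2) * real N"
    by (auto simp: eventually_sequentially)
  have "norm (L2_norm M (ergodic_average S (\<lambda>x. F x - F (S p x)) N) - 0) < e" if N: "N \<ge> Suc N0" for N
  proof -
    have N1: "N \<ge> N0" "N > 0" using N by auto
    have p0: "p > 0" using p by (rule prime_gt_0_nat)
    \<comment> \<open>The coefficients of the averaged coboundary as a combination of
      \<open>S n\<close> with n \<le> p N: the terms that contain \<open>S p\<close> occupy the
      multiples of \<open>p\<close>.\<close>
    define c where "c = (\<lambda>n. (if n \<le> N then 1 / of_nat N else 0) - (if p dvd n then 1 / complex_of_nat N else 0))"
    have expand: "(\<Sum>n=1..p*N. c n * h n) = (\<Sum>n=1..N. 1 / of_nat N * (h n - h (p * n)))" for h :: "nat \<Rightarrow> complex"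
    proof -
      have "(\<Sum>n=1..p*N. c n * h n) = (\<Sum>n=1..p*N. if n \<le> N then 1 / of_nat N * h n else 0) - (\<Sum>n=1..p*N. if p dvd n then 1 / of_nat N * h n else 0)"
        unfolding sum_subtractf[symmetric] by (intro sum.cong refl) (auto simp: c_def algebra_simps)
      also have "(\<Sum>n=1..p*N. if n \<le> N then 1 / of_nat N * h n else 0) = (\<Sum>n=1..N. 1 / of_nat N * h n)"
      proof (rule sum.mono_neutral_cong_right)
        have "N \<le> p * N" using p0 by simp
        then show "{1..N} \<subseteq> {1..p*N}" by auto
      qed auto
      also have "(\<Sum>n=1..p*N. if p dvd n then 1 / of_nat N * h n else 0) = (\<Sum>n\<in>(\<lambda>n. p * n) ` {1..N}. 1 / of_nat N * h n)"
      proof (rule sum.mono_neutral_cong_right)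
        show "\<forall>i\<in>{1..p*N} - (\<lambda>n. p * n) ` {1..N}. (if p dvd i then 1 / of_nat N * h i else 0) = 0"
        proof
          fix i assume i: "i \<in> {1..p*N} - (\<lambda>n. p * n) ` {1..N}"
          have "\<not> p dvd i"
          proof
            assume "p dvd i"
            then obtain j where j: "i = p * j" by auto
            with i have "j \<in> {1..N}" using p0 by (auto simp: Suc_le_eq intro: Nat.gr0I)
            with i j show False by auto
          qed
          then show "(if p dvd i then 1 / of_nat N * h i else 0) = 0" by simp
        qed
      qed (use p0 in \<open>auto simp: Suc_le_eq\<close>)
      also have "\<dots> = (\<Sum>n=1..N. 1 / of_nat N * h (p * n))"
        by (subst sum.reindex) (use p0 in \<open>auto simp: inj_on_def\<close>)
      finally show ?thesis by (simp add: right_diff_distrib sum_subtractf)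
    qed
    have "L2_norm M (\<lambda>x. \<Sum>n=1..p*N. c n * F (S n x)) \<le> \<epsilon> * L2_norm M F"
    proof (rule transference[OF fin \<rho> S\<rho> _ _ F])
      fix z :: "nat \<Rightarrow> complex" assume z: "\<And>r. r \<in> \<rho> ` {p. prime p} \<Longrightarrow> cmod (z r) = 1"
      define f where "f = class_character \<rho> z"
      have uf: "unimodular_mult f" unfolding f_def by (rule class_character_unimodular[OF fin z])
      have fp: "f p = z (\<rho> p)" unfolding f_def by (rule class_character_prime[OF fin p])
      have "(\<Sum>n=1..p*N. c n * f n) = (\<Sum>n=1..N. 1 / of_nat N * ((1 - z (\<rho> p)) * f n))"
        unfolding expand using uf p0 by (intro sum.cong refl) (auto simp: unimodular_mult_def fp algebra_simps)
      also have "\<dots> = (1 - z (\<rho> p)) * partial_sum f N / of_nat N"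
        by (simp add: partial_sum_def sum_distrib_left sum_divide_distrib)
      finally have "cmod (\<Sum>n=1..p*N. c n * f n) = cmod (z (\<rho> p) - 1) * (cmod (partial_sum f N) / real N)"
        by (simp add: norm_mult norm_divide norm_minus_commute)
      also have "\<dots> \<le> \<epsilon>"
      proof (cases "cmod (z (\<rho> p) - 1) \<ge> \<epsilon>")
        case True
        then have "f \<in> \<Phi>" unfolding \<Phi>_def f_def using z by blast
        then have "cmod (partial_sum f N) / real N \<le> \<epsilon> / 2" using N0[OF N1(1)] N1 by (simp add: field_simps)
        moreover have "cmod (z (\<rho> p) - 1) \<le> 2"
          using norm_triangle_ineq4[of "z (\<rho> p)" 1] z[of "\<rho> p"] p by auto
        ultimately have "cmod (z (\<rho> p) - 1) * (cmod (partial_sum f N) / real N) \<le> 2 * (\<epsilon> / 2)"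
          by (intro mult_mono) auto
        then show ?thesis by simp
      next
        case False
        have "cmod (partial_sum f N) \<le> (\<Sum>k=1..N. 1)"
          unfolding partial_sum_def by (rule sum_norm_le) (use uf in \<open>auto simp: unimodular_mult_def\<close>)
        then have "cmod (partial_sum f N) / real N \<le> 1" using N1 by (simp add: field_simps)
        then have "cmod (z (\<rho> p) - 1) * (cmod (partial_sum f N) / real N) \<le> \<epsilon> * 1"
          using False \<epsilon> by (intro mult_mono) auto
        then show ?thesis by simp
      qed
      finally show "cmod (\<Sum>n=1..p*N. c n * class_character \<rho> z n) \<le> \<epsilon>" by (simp add: f_def)
    qed (use \<epsilon> in auto)
    also have "L2_norm M (\<lambda>x. \<Sum>n=1..p*N. c n * F (S n x)) = L2_norm M (ergodic_average S (\<lambda>x. F x - F (S p x)) N)"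
      unfolding L2_norm_def
    proof (intro arg_cong[of _ _ sqrt] Bochner_Integration.integral_cong refl arg_cong[of _ _ "\<lambda>t. (cmod t)\<^sup>2"])
      fix x assume x: "x \<in> space M"
      show "(\<Sum>n=1..p*N. c n * F (S n x)) = ergodic_average S (\<lambda>x. F x - F (S p x)) N x"
        unfolding expand ergodic_average_altdef using x p0 by (intro sum.cong refl) (simp add: multiplicative Suc_le_eq)
    qed
    finally have "L2_norm M (ergodic_average S (\<lambda>x. F x - F (S p x)) N) \<le> \<epsilon> * L2_norm M F" .
    also have "\<dots> \<le> \<epsilon> * (L2_norm M F + 1)" using \<epsilon> by simp
    also have "\<dots> = e / 2" unfolding \<epsilon>_def using LF by (simp add: field_simps)
    also have "\<dots> < e" using e by simp
    finally show ?thesis by simp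
  qed
  then show "\<exists>no. \<forall>N\<ge>no. norm (L2_norm M (ergodic_average S (\<lambda>x. F x - F (S p x)) N) - 0) < e" by blast
qed

end

subsection \<open>Convergence of the averages\<close>

text \<open>Subtracting \<open>N\<close> times the mean over one period from the partial sum leaves
  a periodic, hence bounded, remainder.\<close>

lemma periodic_average_convergent:
  fixes h :: "nat \<Rightarrow> real"
  assumes m: "m > 0" and per: "\<And>n. h (n + m) = h n"
  shows "convergent (\<lambda>N. (\<Sum>n=1..N. h n) / real N)"
proof -
  define c where "c = (\<Sum>n=1..m. h n) / real m"
  define D where "D = (\<lambda>N. (\<Sum>n=1..N. h n) - c * real N)"
  have D_per: "D (N + m) = D N" for N
  proof (induction N)
    case 0
    show ?case using m by (simp add: D_def c_def)
  next
    case (Suc N)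
    then show ?case using per[of "Suc N"] by (simp add: D_def algebra_simps)
  qed
  have D_mod: "D (k * m + N) = D N" for k N
  proof (induction k)
    case (Suc k)
    then show ?case using D_per[of "k * m + N"] by (simp add: ac_simps)
  qed simp
  define B where "B = (\<Sum>j<m. \<bar>D j\<bar>)"
  have bound: "\<bar>D N\<bar> \<le> B" for N
  proof -
    have "D N = D (N mod m)" using D_mod[of "N div m" "N mod m"] by (simp add: div_mult_mod_eq)
    also have "\<bar>\<dots>\<bar> \<le> B" unfolding B_def using m by (intro member_le_sum) auto
    finally show ?thesis .
  qed
  have "(\<lambda>N. D N / real N) \<longlonglongrightarrow> 0"
  proof (rule Lim_null_comparison)
    show "\<forall>\<^sub>F N in sequentially. norm (D N / real N) \<le> B / real N"
      using bound by (auto intro!: always_eventually divide_right_mono)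
    show "(\<lambda>N. B / real N) \<longlonglongrightarrow> 0" by real_asymp
  qed
  then have "(\<lambda>N. D N / real N + c) \<longlonglongrightarrow> 0 + c" by (intro tendsto_add tendsto_const)
  moreover have "\<forall>\<^sub>F N in sequentially. D N / real N + c = (\<Sum>n=1..N. h n) / real N"
    using eventually_gt_at_top[of 0] by eventually_elim (simp add: D_def field_simps)
  ultimately have "(\<lambda>N. (\<Sum>n=1..N. h n) / real N) \<longlonglongrightarrow> 0 + c"
    by (rule Lim_transform_eventually)
  then show ?thesis by (rule convergentI)
qed

lemma card_multiples_le: "real (card {n\<in>{1..N}. d dvd n}) \<le> real N / real d"
proof (cases "d = 0")
  case False
  have "card {n\<in>{1..N}. d dvd n} \<le> card ((\<lambda>j. d * j) ` {1..N div d})"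
  proof (rule card_mono)
    show "{n\<in>{1..N}. d dvd n} \<subseteq> (\<lambda>j. d * j) ` {1..N div d}"
    proof
      fix n assume n: "n \<in> {n\<in>{1..N}. d dvd n}"
      then obtain j where j: "n = d * j" by auto
      with n False have "j \<in> {1..N div d}" by (auto simp: less_eq_div_iff_mult_less_eq mult.commute intro!: Nat.gr0I)
      with j show "n \<in> (\<lambda>j. d * j) ` {1..N div d}" by auto
    qed
  qed auto
  also have "\<dots> \<le> N div d" using card_image_le[of "{1..N div d}" "\<lambda>j. d * j"] by simp
  finally have "real (card {n\<in>{1..N}. d dvd n}) \<le> real (N div d)" by simp
  also have "\<dots> \<le> real N / real d" by (rule of_nat_div_le_of_nat)
  finally show ?thesis .
qed auto

text \<open>If \<open>q\<close> survives in the cofactor, then the gcd does not contain the full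
  power of \<open>q\<close> in \<open>n\<close>; that power therefore exceeds the one in
  \<open>M\<close>, which is at least \<open>q ^ K\<close>.\<close>

lemma prime_dvd_div_gcd:
  fixes n q :: nat
  assumes q: "prime q" and n: "n > 0" and dvd: "q dvd n div gcd n M" and M: "q ^ K dvd M" 
  shows "q ^ Suc K dvd n"
proof (rule ccontr)
  assume not: "\<not> q ^ Suc K dvd n"
  define a where "a = multiplicity q n"
  have nu: "\<not> is_unit q" "n \<noteq> 0" using q n by auto
  have "a < Suc K" unfolding a_def using not nu by (metis multiplicity_dvd' not_less)
  then have "q ^ a dvd q ^ K" by (intro le_imp_power_dvd) auto
  then have "q ^ a dvd M" using M by (rule dvd_trans)
  moreover have "q ^ a dvd n" unfolding a_def by (rule multiplicity_dvd)
  ultimately have "q ^ a dvd gcd n M" by simp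
  then have "q ^ a * q dvd gcd n M * (n div gcd n M)" using dvd by (rule mult_dvd_mono)
  then have "q ^ Suc a dvd n" by (simp add: mult.commute)
  then have "Suc a \<le> multiplicity q n" using nu by (intro multiplicity_geI) auto
  then show False by (simp add: a_def)
qed

context multiplicative_system
begin

lemma L2_norm_average_diff_le:
  assumes "F \<in> L2_space M" "G \<in> L2_space M"
  shows "L2_dist M (ergodic_average S F N) (ergodic_average S G N) \<le> L2_dist M F G"
  using L2_norm_average_le[OF L2_space_diff[OF assms], of N] by (simp add: ergodic_average_diff[abs_def])

text \<open>Functions are not identified almost everywhere, so invariance is expressed as vanishing
  distance; composition with the measure-preserving \<open>S n\<close> does not change that
  distance.\<close>

lemma L2_norm_S_eq_0_mult:
  assumes G: "G \<in> L2_space M" and m: "m \<ge> 1" "L2_norm M (\<lambda>x. G (S m x) - G x) = 0" and n: "n \<ge> 1"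
  shows "L2_norm M (\<lambda>x. G (S (m * n) x) - G (S n x)) = 0"
proof -
  have "L2_norm M (\<lambda>x. G (S (m * n) x) - G (S n x)) = L2_norm M (\<lambda>x. (\<lambda>x. G (S m x) - G x) (S n x))"
    unfolding L2_norm_def using m n
    by (intro arg_cong[of _ _ sqrt] Bochner_Integration.integral_cong refl) (simp add: multiplicative)
  also have "\<dots> = L2_norm M (\<lambda>x. G (S m x) - G x)"
    by (rule L2_norm_S[OF L2_space_diff[OF L2_space_S[OF G m(1)] G] n])
  finally show ?thesis using m(2) by simp
qed

lemma L2_invariant_products:
  assumes G: "G \<in> L2_space M" and inv: "\<And>p. prime p \<Longrightarrow> p dvd m \<Longrightarrow> L2_norm M (\<lambda>x. G (S p x) - G x) = 0" and m: "m > 0"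
  shows "L2_norm M (\<lambda>x. G (S m x) - G x) = 0"
  using m inv
proof (induction m rule: prime_divisors_induct)
  case (unit m)
  then have m1: "m = Suc 0" by simp
  have "L2_norm M (\<lambda>x. G (S m x) - G x) = L2_norm M (\<lambda>x. 0)"
    unfolding L2_norm_def m1
    by (intro arg_cong[of _ _ sqrt] Bochner_Integration.integral_cong refl) (simp add: S_one)
  then show ?case by simp
next
  case (factor p m)
  then have p: "prime p" "p \<ge> 1" and m: "m \<ge> 1" by (auto simp: prime_gt_0_nat Suc_le_eq)
  have "L2_norm M (\<lambda>x. G (S (p * m) x) - G x) \<le> L2_norm M (\<lambda>x. G (S (p * m) x) - G (S m x)) + L2_norm M (\<lambda>x. G (S m x) - G x)"
    using p m by (intro L2_norm_triangle_diff L2_space_S G) (auto simp: Suc_le_eq)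
  also have "L2_norm M (\<lambda>x. G (S (p * m) x) - G (S m x)) = 0"
    using p m factor.prems by (intro L2_norm_S_eq_0_mult G) auto
  also have "L2_norm M (\<lambda>x. G (S m x) - G x) = 0"
    using m factor.prems by (intro factor.IH) auto
  finally show ?case using L2_norm_nonneg[of M "\<lambda>x. G (S (p * m) x) - G x"] by linarith
qed simp

text \<open>Grouping by \<open>d = gcd n m\<close> leaves finitely many fixed functions, whose
  coefficients are the frequencies of conditions periodic modulo \<open>m\<close> and hence
  converge.\<close>

lemma periodic_average_cauchy:
  assumes G: "G \<in> L2_space M" and m: "m > 0" and e: "e > 0"
  shows "\<exists>N0. \<forall>N\<ge>N0. \<forall>N'\<ge>N0. L2_norm M (\<lambda>x. (\<Sum>n=1..N. (1 / of_nat N) * G (S (gcd n m) x)) - (\<Sum>n=1..N'. (1 / of_nat N') * G (S (gcd n m) x))) \<le> e"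
proof -
  define a where "a = (\<lambda>d N. (\<Sum>n=1..N. if gcd n m = d then 1 else 0 :: real) / real N)"
  have A: "(\<Sum>n=1..N. (1 / of_nat N) * G (S (gcd n m) x)) = (\<Sum>d=1..m. of_real (a d N) * G (S d x))" for N x
  proof -
    have "(\<Sum>n=1..N. (1 / of_nat N) * G (S (gcd n m) x)) = (\<Sum>n=1..N. \<Sum>d=1..m. if gcd n m = d then (1 / of_nat N) * G (S d x) else 0)"
      using m by (intro sum.cong refl) (subst sum.delta', auto simp: Suc_le_eq gcd_le2_nat)
    also have "\<dots> = (\<Sum>d=1..m. \<Sum>n=1..N. if gcd n m = d then (1 / of_nat N) * G (S d x) else 0)"
      by (rule sum.swap)
    also have "\<dots> = (\<Sum>d=1..m. of_real (a d N) * G (S d x))"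
    proof (intro sum.cong refl)
      fix d
      have "(\<Sum>n=1..N. if gcd n m = d then (1 / of_nat N) * G (S d x) else 0) = (\<Sum>n=1..N. (if gcd n m = d then 1 else 0) * ((1 / of_nat N) * G (S d x)))"
        by (intro sum.cong refl) auto
      also have "\<dots> = of_real (a d N) * G (S d x)"
        unfolding sum_distrib_right[symmetric] by (simp add: a_def if_distrib[of of_real] cong: if_cong)
      finally show "(\<Sum>n=1..N. if gcd n m = d then (1 / of_nat N) * G (S d x) else 0) = of_real (a d N) * G (S d x)" .
    qed
    finally show ?thesis .
  qed
  define \<epsilon> where "\<epsilon> = e / (real m * (L2_norm M G + 1))"
  have LG: "L2_norm M G + 1 > 0" using L2_norm_nonneg[of M G] by linarith
  have \<epsilon>: "\<epsilon> > 0" using e LG m by (simp add: \<epsilon>_def)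
  have "Cauchy (a d)" for d
  proof -
    have "convergent (a d)" unfolding a_def
      by (rule periodic_average_convergent[OF m]) (simp add: gcd.commute[of _ m] add.commute[of _ m])
    then show ?thesis by (rule convergent_Cauchy)
  qed
  then have "\<exists>N0. \<forall>N\<ge>N0. \<forall>N'\<ge>N0. \<bar>a d N - a d N'\<bar> < \<epsilon>" for d
    using \<epsilon> unfolding Cauchy_def dist_real_def by blast
  then obtain N0 where N0: "\<And>d N N'. N \<ge> N0 d \<Longrightarrow> N' \<ge> N0 d \<Longrightarrow> \<bar>a d N - a d N'\<bar> < \<epsilon>" by metis
  define N1 where "N1 = (\<Sum>d=1..m. N0 d)"
  have N1: "N0 d \<le> N1" if "d \<in> {1..m}" for d unfolding N1_def using that by (intro member_le_sum) auto
  show ?thesis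
  proof (intro exI[of _ N1] allI impI)
    fix N N' assume N: "N \<ge> N1" "N' \<ge> N1"
    have "L2_norm M (\<lambda>x. (\<Sum>n=1..N. (1 / of_nat N) * G (S (gcd n m) x)) - (\<Sum>n=1..N'. (1 / of_nat N') * G (S (gcd n m) x))) =
      L2_norm M (\<lambda>x. \<Sum>d=1..m. of_real (a d N - a d N') * G (S d x))"
      unfolding A by (simp add: sum_subtractf left_diff_distrib)
    also have "\<dots> \<le> (\<Sum>d=1..m. L2_norm M (\<lambda>x. of_real (a d N - a d N') * G (S d x)))"
      using G by (intro L2_norm_sum_le L2_space_scale L2_space_S) auto
    also have "\<dots> \<le> (\<Sum>d=1..m. \<epsilon> * L2_norm M G)"
    proof (intro sum_mono)
      fix d assume d: "d \<in> {1..m}"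
      have "\<bar>a d N - a d N'\<bar> \<le> \<epsilon>" using N0[of d N N'] N N1[OF d] by force
      moreover have "L2_norm M (\<lambda>x. of_real (a d N - a d N') * G (S d x)) = \<bar>a d N - a d N'\<bar> * L2_norm M G"
        using L2_norm_scale[of M "of_real (a d N - a d N')" "\<lambda>x. G (S d x)"] L2_norm_S[OF G, of d] d
        by (simp del: of_real_diff)
      ultimately show "L2_norm M (\<lambda>x. of_real (a d N - a d N') * G (S d x)) \<le> \<epsilon> * L2_norm M G"
        by (simp add: mult_right_mono)
    qed
    also have "\<dots> \<le> real m * (\<epsilon> * (L2_norm M G + 1))" using \<epsilon> by (simp add: mult_left_mono)
    also have "\<dots> = e"
    proof -
      have "r * (e / (r * l) * l) = e" if "r \<noteq> 0" "l \<noteq> 0" for r l :: real using that by simp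
      then show ?thesis unfolding \<epsilon>_def using LG m by simp
    qed
    finally show "L2_norm M (\<lambda>x. (\<Sum>n=1..N. (1 / of_nat N) * G (S (gcd n m) x)) - (\<Sum>n=1..N'. (1 / of_nat N') * G (S (gcd n m) x))) \<le> e" .
  qed
qed

text \<open>If the primes that move \<open>G\<close> have convergent reciprocal sum, then up to a small proportion of \<open>n\<close>,
  \<open>S n G\<close> only depends on \<open>gcd n m\<close> for a suitable \<open>m\<close>.\<close>

lemma average_cauchy_if_few_primes:
  assumes G: "G \<in> L2_space M" and Q: "\<And>q. q \<in> Q \<Longrightarrow> prime q" and summ: "(\<lambda>q. 1 / real q) summable_on Q"
    and inv: "\<And>p. prime p \<Longrightarrow> p \<notin> Q \<Longrightarrow> L2_norm M (\<lambda>x. G (S p x) - G x) = 0" and e: "e > 0"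
  shows "\<exists>N0. \<forall>N\<ge>N0. \<forall>N'\<ge>N0. L2_dist M (ergodic_average S G N) (ergodic_average S G N') \<le> e"
proof -
  have LG: "L2_norm M G + 1 > 0" using L2_norm_nonneg[of M G] by linarith
  \<comment> \<open>A proportion of at most 2\<epsilon> of bad indices, each costing twice the norm
    of \<open>G\<close>, amounts to at most e/3.\<close>
  define \<epsilon> where "\<epsilon> = e / (12 * (L2_norm M G + 1))"
  have \<epsilon>: "\<epsilon> > 0" using e LG by (simp add: \<epsilon>_def)
  obtain B where B: "finite B" "B \<subseteq> Q" "dist (sum (\<lambda>q. 1 / real q) B) (infsum (\<lambda>q. 1 / real q) Q) \<le> \<epsilon>"
    using infsum_finite_approximation[OF summ \<epsilon>] by auto
  have tail: "sum (\<lambda>q. 1 / real q) E \<le> \<epsilon>" if E: "finite E" "E \<subseteq> Q - B" for E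
  proof -
    have "sum (\<lambda>q. 1 / real q) B + sum (\<lambda>q. 1 / real q) E = sum (\<lambda>q. 1 / real q) (B \<union> E)"
      using B E by (intro sum.union_disjoint[symmetric]) auto
    also have "\<dots> \<le> infsum (\<lambda>q. 1 / real q) Q"
      using B E by (intro finite_sum_le_infsum summ) auto
    finally show ?thesis using B(3) by (simp add: dist_real_def)
  qed
  \<comment> \<open>Since each prime is at least 2, this makes the multiples of
    \<open>q ^ Suc K\<close>, taken over all \<open>q\<close> in \<open>B\<close>, have total
    density at most \<epsilon>.\<close>
  obtain K where K: "(1/2::real) ^ K < \<epsilon> / (real (card B) + 1)"
    using real_arch_pow_inv[of "\<epsilon> / (real (card B) + 1)" "1/2"] \<epsilon> by auto
  define m where "m = (\<Prod>q\<in>B. q ^ K)"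
  have m: "m > 0" unfolding m_def using B(2) Q by (intro prod_pos) (auto simp: prime_gt_0_nat)
  have small: "(\<Sum>q\<in>B. 1 / real (q ^ Suc K)) \<le> \<epsilon>"
  proof -
    have "(\<Sum>q\<in>B. 1 / real (q ^ Suc K)) \<le> (\<Sum>q\<in>B. (1/2) ^ K)"
    proof (rule sum_mono)
      fix q assume "q \<in> B"
      then have q: "real q \<ge> 2" using B(2) Q prime_ge_2_nat by fastforce
      have "2 ^ K \<le> real q ^ Suc K" using q by (intro order_trans[OF power_increasing[of K "Suc K" "2::real"] power_mono]) auto
      then have "1 / real q ^ Suc K \<le> 1 / 2 ^ K" by (intro divide_left_mono) (use q in auto)
      then show "1 / real (q ^ Suc K) \<le> (1/2) ^ K" by (simp add: power_one_over)
    qed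
    also have "\<dots> = real (card B) * (1/2) ^ K" by simp
    also have "\<dots> \<le> (real (card B) + 1) * (\<epsilon> / (real (card B) + 1))"
      using K by (intro mult_mono) auto
    also have "\<dots> = \<epsilon>" by (simp add: field_simps)
    finally show ?thesis .
  qed
  define avg where "avg = (\<lambda>N x. \<Sum>n=1..N. (1 / of_nat N) * G (S (gcd n m) x))"
  have gcd1: "gcd n m \<ge> 1" for n using m by (simp add: Suc_le_eq)
  have avg: "avg N \<in> L2_space M" for N
    unfolding avg_def using gcd1 by (intro L2_space_sum L2_space_scale L2_space_S G) auto
  have approx: "L2_dist M (ergodic_average S G N) (avg N) \<le> e / 3" if N: "N > 0" for N
  proof -
    \<comment> \<open>Outside this set the cofactor \<open>n div gcd n m\<close> has no prime factor
      in \<open>Q\<close>: the primes of \<open>B\<close> are absorbed by their powers in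
      \<open>m\<close>, and the remaining primes of \<open>Q\<close> do not divide
      \<open>n\<close>.\<close>
    define bad where "bad = (\<Union>q\<in>B. {n\<in>{1..N}. q ^ Suc K dvd n}) \<union> (\<Union>q\<in>(Q - B) \<inter> {..N}. {n\<in>{1..N}. q dvd n})"
    have fin_bad: "finite bad" using B(1) by (auto simp: bad_def)
    have card_bad: "real (card bad) \<le> 2 * \<epsilon> * real N"
    proof -
      have "real (card bad) \<le> real (card (\<Union>q\<in>B. {n\<in>{1..N}. q ^ Suc K dvd n}) + card (\<Union>q\<in>(Q - B) \<inter> {..N}. {n\<in>{1..N}. q dvd n}))"
        unfolding bad_def of_nat_le_iff by (rule card_Un_le)
      also have "\<dots> \<le> real ((\<Sum>q\<in>B. card {n\<in>{1..N}. q ^ Suc K dvd n}) + (\<Sum>q\<in>(Q - B) \<inter> {..N}. card {n\<in>{1..N}. q dvd n}))"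
        unfolding of_nat_le_iff using B(1) by (intro add_mono card_UN_le) auto
      also have "\<dots> \<le> (\<Sum>q\<in>B. real N / real (q ^ Suc K)) + (\<Sum>q\<in>(Q - B) \<inter> {..N}. real N / real q)"
        unfolding of_nat_add of_nat_sum by (intro add_mono sum_mono card_multiples_le)
      also have "\<dots> = real N * (\<Sum>q\<in>B. 1 / real (q ^ Suc K)) + real N * (\<Sum>q\<in>(Q - B) \<inter> {..N}. 1 / real q)"
        by (simp add: sum_distrib_left)
      also have "\<dots> \<le> real N * \<epsilon> + real N * \<epsilon>"
        using small by (intro add_mono mult_left_mono tail) auto
      finally show ?thesis by simp
    qed
    have good: "L2_norm M (\<lambda>x. G (S n x) - G (S (gcd n m) x)) = 0" if n: "n \<in> {1..N}" "n \<notin> bad" for n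
    proof -
      define k where "k = n div gcd n m"
      have n_eq: "n = k * gcd n m" by (simp add: k_def)
      then have k: "k > 0" using n by (cases "k = 0") auto
      have "L2_norm M (\<lambda>x. G (S k x) - G x) = 0"
      proof (rule L2_invariant_products[OF G _ k])
        fix p assume p: "prime p" "p dvd k"
        show "L2_norm M (\<lambda>x. G (S p x) - G x) = 0"
        proof (rule inv[OF p(1)])
          show "p \<notin> Q"
          proof
            assume pQ: "p \<in> Q"
            have pn: "p dvd n" using p(2) n_eq by (metis dvd_mult2)
            show False
            proof (cases "p \<in> B")
              case True
              then have "p ^ K dvd m" unfolding m_def using B(1) by (intro dvd_prodI) auto
              then have "p ^ Suc K dvd n" using prime_dvd_div_gcd[OF p(1) _ p(2)[unfolded k_def]] n by simp
              then show False using n True unfolding bad_def by blast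
            next
              case False
              have "p \<le> N" using pn n dvd_imp_le[of p n] by auto
              then show False using n pQ pn False unfolding bad_def by blast
            qed
          qed
        qed
      qed
      from L2_norm_S_eq_0_mult[OF G _ this gcd1[of n]] k show ?thesis
        using n_eq by (metis One_nat_def Suc_leI)
    qed
    have "L2_dist M (ergodic_average S G N) (avg N) = L2_norm M (\<lambda>x. \<Sum>n=1..N. (1 / of_nat N) * (G (S n x) - G (S (gcd n m) x)))"
      by (simp add: ergodic_average_altdef avg_def right_diff_distrib sum_subtractf)
    also have "\<dots> \<le> (\<Sum>n=1..N. L2_norm M (\<lambda>x. (1 / of_nat N) * (G (S n x) - G (S (gcd n m) x))))"
      using gcd1 by (intro L2_norm_sum_le L2_space_scale L2_space_diff L2_space_S G) auto
    also have "\<dots> \<le> (\<Sum>n=1..N. if n \<in> bad then (1 / real N) * (2 * L2_norm M G) else 0)"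
    proof (rule sum_mono)
      fix n assume n: "n \<in> {1..N}"
      have "L2_norm M (\<lambda>x. G (S n x) - G (S (gcd n m) x)) \<le> 2 * L2_norm M G"
        using L2_norm_triangle_diff[OF L2_space_S[OF G, of n] L2_space_zero L2_space_S[OF G gcd1[of n]]] n
          L2_norm_S[OF G, of n] L2_norm_S[OF G gcd1[of n]] L2_norm_minus_commute[of M "\<lambda>_. 0" "\<lambda>x. G (S (gcd n m) x)"] by simp
      with good[OF n] show "L2_norm M (\<lambda>x. (1 / of_nat N) * (G (S n x) - G (S (gcd n m) x))) \<le> (if n \<in> bad then (1 / real N) * (2 * L2_norm M G) else 0)"
        unfolding L2_norm_scale by (auto simp: norm_divide divide_right_mono)
    qed
    also have "\<dots> \<le> real (card bad) * ((1 / real N) * (2 * L2_norm M G))"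
    proof -
      have "(\<Sum>n=1..N. if n \<in> bad then (1 / real N) * (2 * L2_norm M G) else 0) = (\<Sum>n\<in>{1..N} \<inter> bad. (1 / real N) * (2 * L2_norm M G))"
        by (rule sum.inter_restrict[symmetric]) auto
      also have "\<dots> \<le> (\<Sum>n\<in>bad. (1 / real N) * (2 * L2_norm M G))"
        using fin_bad by (intro sum_mono2) auto
      finally show ?thesis by simp
    qed
    also have "\<dots> \<le> (2 * \<epsilon> * real N) * ((1 / real N) * (2 * L2_norm M G))"
      using card_bad by (intro mult_right_mono) auto
    also have "\<dots> = 4 * \<epsilon> * L2_norm M G" using N by simp
    also have "\<dots> \<le> 4 * \<epsilon> * (L2_norm M G + 1)" using \<epsilon> by simp
    also have "\<dots> = e / 3" unfolding \<epsilon>_def using LG by (simp add: field_simps)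
    finally show ?thesis .
  qed
  obtain N0 where N0: "\<And>N N'. N \<ge> N0 \<Longrightarrow> N' \<ge> N0 \<Longrightarrow> L2_dist M (avg N) (avg N') \<le> e / 3"
    using periodic_average_cauchy[OF G m, of "e / 3"] e unfolding avg_def by auto
  show ?thesis
  proof (intro exI[of _ "Suc N0"] allI impI)
    fix N N' assume N: "N \<ge> Suc N0" "N' \<ge> Suc N0"
    have "L2_dist M (ergodic_average S G N) (ergodic_average S G N') \<le>
      L2_dist M (ergodic_average S G N) (avg N) + L2_dist M (avg N) (ergodic_average S G N')"
      by (intro L2_norm_triangle_diff L2_space_average G avg)
    also have "L2_dist M (avg N) (ergodic_average S G N') \<le> L2_dist M (avg N) (avg N') + L2_dist M (avg N') (ergodic_average S G N')"
      by (intro L2_norm_triangle_diff L2_space_average G avg)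
    also have "L2_dist M (avg N') (ergodic_average S G N') = L2_dist M (ergodic_average S G N') (avg N')"
      by (rule L2_norm_minus_commute)
    finally show "L2_dist M (ergodic_average S G N) (ergodic_average S G N') \<le> e"
      using approx[of N] approx[of N'] N0[of N N'] N by simp
  qed
qed

text \<open>Dyadic convex combinations of the orbit. Midpoints are what the parallelogram law uses,
  and each closure rule is one step in the induction that compares averages of \<open>F\<close> with
  those of hull elements.\<close>

inductive_set averaging_hull :: "nat set \<Rightarrow> ('a \<Rightarrow> complex) \<Rightarrow> ('a \<Rightarrow> complex) set" for D F where
  base: "F \<in> averaging_hull D F"
| shift: "K \<in> averaging_hull D F \<Longrightarrow> p \<in> D \<Longrightarrow> (\<lambda>x. K (S p x)) \<in> averaging_hull D F"
| midpoint: "K \<in> averaging_hull D F \<Longrightarrow> L \<in> averaging_hull D F \<Longrightarrow> (\<lambda>x. (1/2) * (K x + L x)) \<in> averaging_hull D F"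

lemma averaging_hull_L2:
  assumes "F \<in> L2_space M" "\<And>p. p \<in> D \<Longrightarrow> p \<ge> 1" "K \<in> averaging_hull D F"
  shows "K \<in> L2_space M"
  using assms(3)
proof induction
  case (midpoint K L)
  show ?case by (rule L2_space_scale[OF L2_space_add[OF midpoint.IH]])
qed (use assms(1,2) in \<open>auto intro!: L2_space_S\<close>)

text \<open>A minimising sequence for the norm on the midpoint-convex hull is Cauchy by the parallelogram law; as
  the hull is stable under the shifts, the limit is invariant.\<close>

lemma invariant_limit_of_hull:
  assumes F: "F \<in> L2_space M" and D: "\<And>p. p \<in> D \<Longrightarrow> p \<ge> 1"
  obtains K G where "\<And>j. K j \<in> averaging_hull D F" "G \<in> L2_space M" "(\<lambda>j. L2_dist M (K j) G) \<longlonglongrightarrow> 0"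
    "\<And>p. p \<in> D \<Longrightarrow> L2_norm M (\<lambda>x. G (S p x) - G x) = 0"
proof -
  let ?C = "averaging_hull D F"
  note L2C = averaging_hull_L2[OF F D]
  define d where "d = (INF K\<in>?C. L2_norm M K)"
  have bdd: "bdd_below (L2_norm M ` ?C)" by (rule bdd_belowI2[of _ 0]) simp
  have d_le: "d \<le> L2_norm M K" if "K \<in> ?C" for K
    unfolding d_def using bdd that by (rule cINF_lower)
  have d0: "d \<ge> 0" unfolding d_def by (rule cINF_greatest) (use averaging_hull.base in auto)
  have "\<exists>K\<in>?C. L2_norm M K < d + 1 / real (Suc j)" for j
  proof -
    have "(INF K\<in>?C. L2_norm M K) < d + 1 / real (Suc j)" unfolding d_def by simp
    then show ?thesis using bdd averaging_hull.base by (subst (asm) cINF_less_iff) auto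
  qed
  then obtain K where K: "\<And>j. K j \<in> ?C" "\<And>j. L2_norm M (K j) < d + 1 / real (Suc j)" by metis
  \<comment> \<open>The midpoint lies in the hull, so its norm is at least \<open>d\<close>; the
    estimate is the expansion of 4 (d + \<eta>)^2 - 4 d^2 with \<eta> \<le> 1.\<close>
  have diff: "(L2_dist M U V)\<^sup>2 \<le> (8 * d + 4) * \<eta>"
    if UV: "U \<in> ?C" "V \<in> ?C" "L2_norm M U \<le> d + \<eta>" "L2_norm M V \<le> d + \<eta>" "0 \<le> \<eta>" "\<eta> \<le> 1" for U V \<eta>
  proof -
    have "(\<lambda>x. (1/2) * (U x + V x)) \<in> ?C" using UV by (intro averaging_hull.midpoint)
    from d_le[OF this] have "2 * d \<le> L2_norm M (\<lambda>x. U x + V x)" unfolding L2_norm_scale by simp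
    then have 1: "(2 * d)\<^sup>2 \<le> (L2_norm M (\<lambda>x. U x + V x))\<^sup>2" using d0 by (intro power_mono) auto
    have 2: "(L2_norm M U)\<^sup>2 \<le> (d + \<eta>)\<^sup>2" "(L2_norm M V)\<^sup>2 \<le> (d + \<eta>)\<^sup>2" using UV by (auto intro!: power_mono)
    have "(L2_dist M U V)\<^sup>2 \<le> 4 * (d + \<eta>)\<^sup>2 - (2 * d)\<^sup>2"
      using L2_norm_parallelogram[OF L2C[OF _ UV(1)] L2C[OF _ UV(2)]] 1 2 by linarith
    also have "\<dots> = 8 * d * \<eta> + 4 * (\<eta> * \<eta>)" by (simp add: power2_eq_square algebra_simps)
    also have "\<dots> \<le> 8 * d * \<eta> + 4 * (\<eta> * 1)" using UV by (intro add_mono mult_left_mono order_refl) auto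
    finally show ?thesis by (simp add: algebra_simps)
  qed
  have diff': "L2_dist M U V \<le> sqrt ((8 * d + 4) * (1 / real (Suc j)))"
    if "U \<in> ?C" "V \<in> ?C" "L2_norm M U \<le> d + 1 / real (Suc j)" "L2_norm M V \<le> d + 1 / real (Suc j)" for U V j
    by (rule real_le_rsqrt) (rule diff, use that in auto)
  have lim0: "(\<lambda>j. sqrt ((8 * d + 4) * (1 / real (Suc j)))) \<longlonglongrightarrow> 0"
  proof -
    have "(\<lambda>j. sqrt ((8 * d + 4) * (1 / real (Suc j)))) \<longlonglongrightarrow> sqrt ((8 * d + 4) * 0)"
      by (intro tendsto_real_sqrt tendsto_mult tendsto_const LIMSEQ_inverse_real_of_nat[unfolded inverse_eq_divide])
    then show ?thesis by simp
  qed
  obtain G where G: "G \<in> L2_space M" "(\<lambda>j. L2_dist M (K j) G) \<longlonglongrightarrow> 0"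
  proof (rule L2_complete[of K])
    show "K n \<in> L2_space M" for n by (rule L2C[OF _ K(1)])
    fix e :: real assume "e > 0"
    then obtain j where j: "sqrt ((8 * d + 4) * (1 / real (Suc j))) < e"
      using order_tendstoD(2)[OF lim0] by (auto simp: eventually_sequentially)
    show "\<exists>N. \<forall>m\<ge>N. \<forall>n\<ge>N. L2_dist M (K m) (K n) \<le> e"
    proof (intro exI[of _ j] allI impI)
      fix m n assume mn: "m \<ge> j" "n \<ge> j"
      have "L2_norm M (K i) \<le> d + 1 / real (Suc j)" if "i \<ge> j" for i
      proof -
        have "1 / real (Suc i) \<le> 1 / real (Suc j)" using that by (intro divide_left_mono) auto
        then show ?thesis using K(2)[of i] by linarith
      qed
      then have "L2_dist M (K m) (K n) \<le> sqrt ((8 * d + 4) * (1 / real (Suc j)))"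
        using mn by (intro diff' K(1)) auto
      then show "L2_dist M (K m) (K n) \<le> e" using j by linarith
    qed
  qed blast
  have inv: "L2_norm M (\<lambda>x. G (S p x) - G x) = 0" if p: "p \<in> D" for p
  proof -
    have KL: "K j \<in> L2_space M" for j by (rule L2C[OF _ K(1)])
    have le: "L2_norm M (\<lambda>x. G (S p x) - G x) \<le> 2 * L2_dist M (K j) G + sqrt ((8 * d + 4) * (1 / real (Suc j)))" for j
    proof -
      have "L2_norm M (\<lambda>x. G (S p x) - G x) \<le> L2_norm M (\<lambda>x. G (S p x) - K j (S p x)) + L2_norm M (\<lambda>x. K j (S p x) - G x)"
        using D[OF p] by (intro L2_norm_triangle_diff L2_space_S G KL)
      also have "L2_norm M (\<lambda>x. K j (S p x) - G x) \<le> L2_norm M (\<lambda>x. K j (S p x) - K j x) + L2_dist M (K j) G"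
        using D[OF p] by (intro L2_norm_triangle_diff L2_space_S G KL)
      also have "L2_norm M (\<lambda>x. G (S p x) - K j (S p x)) = L2_dist M (K j) G"
        using L2_norm_S[OF L2_space_diff[OF G(1) KL[of j]] D[OF p]] by (simp add: L2_norm_minus_commute)
      \<comment> \<open>Both functions lie in the hull and have the same, nearly minimal norm, so
        the parallelogram bound makes them close.\<close>
      also have "L2_norm M (\<lambda>x. K j (S p x) - K j x) \<le> sqrt ((8 * d + 4) * (1 / real (Suc j)))"
        using K(2)[of j] L2_norm_S[OF KL[of j] D[OF p]] p by (intro diff' averaging_hull.shift K(1)) auto
      finally show ?thesis by simp
    qed
    have "(\<lambda>j. 2 * L2_dist M (K j) G + sqrt ((8 * d + 4) * (1 / real (Suc j)))) \<longlonglongrightarrow> 2 * 0 + 0"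
      by (intro tendsto_add tendsto_mult tendsto_const G(2) lim0)
    then have "L2_norm M (\<lambda>x. G (S p x) - G x) \<le> 2 * 0 + 0" by (rule LIMSEQ_le_const) (use le in blast)
    then show ?thesis using L2_norm_nonneg[of M "\<lambda>x. G (S p x) - G x"] by linarith
  qed
  show ?thesis by (rule that[OF K(1) G inv])
qed

text \<open>Replacing \<open>K\<close> by its shift adds the coboundary of \<open>K\<close> to the
  difference, and a midpoint averages two differences; both keep the limit 0.\<close>

lemma average_hull_difference:
  assumes F: "F \<in> L2_space M" and D: "\<And>p. p \<in> D \<Longrightarrow> p \<ge> 1"
    and cob: "\<And>p H. p \<in> D \<Longrightarrow> H \<in> L2_space M \<Longrightarrow> (\<lambda>N. L2_norm M (ergodic_average S (\<lambda>x. H x - H (S p x)) N)) \<longlonglongrightarrow> 0"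
    and K: "K \<in> averaging_hull D F"
  shows "(\<lambda>N. L2_norm M (ergodic_average S (\<lambda>x. F x - K x) N)) \<longlonglongrightarrow> 0"
  using K
proof induction
  case base
  then show ?case by (simp add: ergodic_average_def[abs_def])
next
  case (shift K p)
  have K: "K \<in> L2_space M" by (rule averaging_hull_L2[OF F D shift(1)])
  have p1: "p \<ge> 1" by (rule D[OF shift(2)])
  have le: "L2_norm M (ergodic_average S (\<lambda>x. F x - K (S p x)) N) \<le>
     L2_norm M (ergodic_average S (\<lambda>x. F x - K x) N) + L2_norm M (ergodic_average S (\<lambda>x. K x - K (S p x)) N)" for N
    using L2_norm_triangle_diff[OF L2_space_average[OF F] L2_space_average[OF K] L2_space_average[OF L2_space_S[OF K p1]], of N N N]
    by (simp add: ergodic_average_diff[abs_def])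
  have "(\<lambda>N. L2_norm M (ergodic_average S (\<lambda>x. F x - K x) N) + L2_norm M (ergodic_average S (\<lambda>x. K x - K (S p x)) N)) \<longlonglongrightarrow> 0 + 0"
    by (intro tendsto_add shift.IH cob K shift(2))
  then have "(\<lambda>N. L2_norm M (ergodic_average S (\<lambda>x. F x - K x) N) + L2_norm M (ergodic_average S (\<lambda>x. K x - K (S p x)) N)) \<longlonglongrightarrow> 0" by simp
  then show ?case
    by (rule Lim_null_comparison[rotated]) (rule always_eventually, rule allI, simp only: real_norm_def abs_of_nonneg[OF L2_norm_nonneg] le)
next
  case (midpoint K L)
  note K = averaging_hull_L2[OF F D midpoint(1)] and L = averaging_hull_L2[OF F D midpoint(2)]
  have le: "L2_norm M (ergodic_average S (\<lambda>x. F x - (1/2) * (K x + L x)) N) \<le>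
     1/2 * L2_norm M (ergodic_average S (\<lambda>x. F x - K x) N) + 1/2 * L2_norm M (ergodic_average S (\<lambda>x. F x - L x) N)" for N
  proof -
    have eq: "ergodic_average S (\<lambda>x. F x - (1/2) * (K x + L x)) N = (\<lambda>x. (1/2) * ergodic_average S (\<lambda>x. F x - K x) N x + (1/2) * ergodic_average S (\<lambda>x. F x - L x) N x)"
    proof
      fix x
      have "(\<Sum>n=1..N. F (S n x) - (1/2) * (K (S n x) + L (S n x))) = (1/2) * (\<Sum>n=1..N. F (S n x) - K (S n x)) + (1/2) * (\<Sum>n=1..N. F (S n x) - L (S n x))"
        unfolding sum_distrib_left sum.distrib[symmetric] by (intro sum.cong refl) (simp add: field_simps)
      then show "ergodic_average S (\<lambda>x. F x - (1/2) * (K x + L x)) N x = (1/2) * ergodic_average S (\<lambda>x. F x - K x) N x + (1/2) * ergodic_average S (\<lambda>x. F x - L x) N x"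
        unfolding ergodic_average_def o_def by (simp only: distrib_left mult.left_commute)
    qed
    show ?thesis
      unfolding eq
      using L2_norm_triangle[OF L2_space_scale[OF L2_space_average[OF L2_space_diff[OF F K]]] L2_space_scale[OF L2_space_average[OF L2_space_diff[OF F L]]], of "1/2" N "1/2" N]
      unfolding L2_norm_scale by simp
  qed
  have "(\<lambda>N. 1/2 * L2_norm M (ergodic_average S (\<lambda>x. F x - K x) N) + 1/2 * L2_norm M (ergodic_average S (\<lambda>x. F x - L x) N)) \<longlonglongrightarrow> 1/2 * 0 + 1/2 * 0"
    by (intro tendsto_add tendsto_mult tendsto_const midpoint.IH)
  then have "(\<lambda>N. 1/2 * L2_norm M (ergodic_average S (\<lambda>x. F x - K x) N) + 1/2 * L2_norm M (ergodic_average S (\<lambda>x. F x - L x) N)) \<longlonglongrightarrow> 0" by simp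
  then show ?case
    by (rule Lim_null_comparison[rotated]) (rule always_eventually, rule allI, simp only: real_norm_def abs_of_nonneg[OF L2_norm_nonneg] le)
qed

theorem average_converges:
  assumes fg: "finitely_generated M S" and F: "F \<in> L2_space M"
  obtains G where "G \<in> L2_space M" "(\<lambda>N. L2_dist M (ergodic_average S F N) G) \<longlonglongrightarrow> 0"
proof -
  define T where "T = (\<lambda>p. restrict (S p) (space M))"
  \<comment> \<open>The least prime with the same action on the space labels the class, so labels
    are primes and their number is finite by finite generation.\<close>
  define \<rho> where "\<rho> = (\<lambda>p. LEAST q. prime q \<and> T q = T p)"
  have \<rho>_spec: "prime (\<rho> p) \<and> T (\<rho> p) = T p" if "prime p" for p
    unfolding \<rho>_def by (rule LeastI[of _ p]) (use that in simp)
  have \<rho>: "prime (\<rho> p)" if "prime p" for p using \<rho>_spec[OF that] by simp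
  have S\<rho>: "S (\<rho> p) x = S p x" if "prime p" "x \<in> space M" for p x
    using \<rho>_spec[OF that(1)] that(2) unfolding T_def by (metis restrict_apply')
  have fin: "finite (\<rho> ` {p. prime p})"
  proof -
    have "\<rho> ` {p. prime p} = (\<lambda>t. LEAST q. prime q \<and> T q = t) ` T ` {p. prime p}"
      by (auto simp: \<rho>_def image_image)
    then show ?thesis using fg by (simp add: finitely_generated_def T_def)
  qed
  define fibre where "fibre = (\<lambda>r. {q. prime q \<and> \<rho> q = r})"
  define D where "D = {p. prime p \<and> \<not> (\<lambda>q. 1 / real q) summable_on fibre (\<rho> p)}"
  define Q where "Q = {p. prime p \<and> (\<lambda>q. 1 / real q) summable_on fibre (\<rho> p)}"
  have D1: "p \<ge> 1" if "p \<in> D" for p using that by (auto simp: D_def Suc_le_eq prime_gt_0_nat)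
  \<comment> \<open>Finiteness of the number of classes enters again: finitely many convergent
    reciprocal sums add up to a convergent one.\<close>
  have summ: "(\<lambda>q. 1 / real q) summable_on Q"
  proof -
    have "Q = (\<Union>r\<in>\<rho> ` Q. fibre r)" by (auto simp: Q_def fibre_def)
    moreover have "finite (\<rho> ` Q)" by (rule finite_subset[OF _ fin]) (auto simp: Q_def)
    then have "(\<lambda>q. 1 / real q) summable_on (\<Union>r\<in>\<rho> ` Q. fibre r)"
      by (rule summable_on_finite_union_disjoint) (auto simp: Q_def fibre_def)
    ultimately show ?thesis by simp
  qed
  have cob: "(\<lambda>N. L2_norm M (ergodic_average S (\<lambda>x. H x - H (S p x)) N)) \<longlonglongrightarrow> 0" if "p \<in> D" "H \<in> L2_space M" for p H
    using that by (intro average_coboundary_tendsto_0[OF fin \<rho> S\<rho>]) (auto simp: D_def fibre_def)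
  obtain K G where K: "\<And>j. K j \<in> averaging_hull D F" and G: "G \<in> L2_space M"
    and KG: "(\<lambda>j. L2_dist M (K j) G) \<longlonglongrightarrow> 0"
    and inv: "\<And>p. p \<in> D \<Longrightarrow> L2_norm M (\<lambda>x. G (S p x) - G x) = 0"
    by (rule invariant_limit_of_hull[OF F D1]) blast+
  have KL: "K j \<in> L2_space M" for j by (rule averaging_hull_L2[OF F D1 K])
  \<comment> \<open>An element \<open>K j\<close> near \<open>G\<close> is fixed before
    \<open>N\<close> grows: its averages agree with those of \<open>F\<close> in the limit, and
    averaging is a contraction, so they stay near those of \<open>G\<close>.\<close>
  have FG: "\<exists>N0. \<forall>N\<ge>N0. L2_dist M (ergodic_average S F N) (ergodic_average S G N) \<le> e" if e: "e > 0" for e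
  proof -
    obtain j where j: "L2_dist M (K j) G < e / 2"
      using order_tendstoD(2)[OF KG, of "e / 2"] e by (auto simp: eventually_sequentially)
    have "\<forall>\<^sub>F N in sequentially. L2_norm M (ergodic_average S (\<lambda>x. F x - K j x) N) < e / 2"
      using e by (intro order_tendstoD(2)[OF average_hull_difference[OF F D1 cob K]]) auto
    then obtain N0 where N0: "\<And>N. N \<ge> N0 \<Longrightarrow> L2_norm M (ergodic_average S (\<lambda>x. F x - K j x) N) < e / 2"
      by (auto simp: eventually_sequentially)
    show ?thesis
    proof (intro exI[of _ N0] allI impI)
      fix N assume N: "N \<ge> N0"
      have "L2_dist M (ergodic_average S F N) (ergodic_average S G N) \<le>
        L2_dist M (ergodic_average S F N) (ergodic_average S (K j) N) + L2_dist M (ergodic_average S (K j) N) (ergodic_average S G N)"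
        by (intro L2_norm_triangle_diff L2_space_average F KL G)
      also have "L2_dist M (ergodic_average S (K j) N) (ergodic_average S G N) \<le> L2_dist M (K j) G"
        by (rule L2_norm_average_diff_le[OF KL G])
      finally show "L2_dist M (ergodic_average S F N) (ergodic_average S G N) \<le> e"
        using N0[OF N] j by (simp add: ergodic_average_diff[abs_def])
    qed
  qed
  have cauchy: "\<exists>N0. \<forall>m\<ge>N0. \<forall>n\<ge>N0. L2_dist M (ergodic_average S F m) (ergodic_average S F n) \<le> e" if e: "e > 0" for e
  proof -
    obtain N1 where N1: "\<And>N. N \<ge> N1 \<Longrightarrow> L2_dist M (ergodic_average S F N) (ergodic_average S G N) \<le> e / 3"
      using FG[of "e / 3"] e by auto
    have invQ: "L2_norm M (\<lambda>x. G (S p x) - G x) = 0" if "prime p" "p \<notin> Q" for p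
      using inv that by (auto simp: D_def Q_def)
    obtain N2 where N2: "\<And>m n. m \<ge> N2 \<Longrightarrow> n \<ge> N2 \<Longrightarrow> L2_dist M (ergodic_average S G m) (ergodic_average S G n) \<le> e / 3"
      using average_cauchy_if_few_primes[OF G _ summ invQ, of "e / 3"] e by (auto simp: Q_def)
    show ?thesis
    proof (intro exI[of _ "max N1 N2"] allI impI)
      fix m n assume mn: "m \<ge> max N1 N2" "n \<ge> max N1 N2"
      have "L2_dist M (ergodic_average S F m) (ergodic_average S F n) \<le>
        L2_dist M (ergodic_average S F m) (ergodic_average S G m) + L2_dist M (ergodic_average S G m) (ergodic_average S F n)"
        by (intro L2_norm_triangle_diff L2_space_average F G)
      also have "L2_dist M (ergodic_average S G m) (ergodic_average S F n) \<le>
        L2_dist M (ergodic_average S G m) (ergodic_average S G n) + L2_dist M (ergodic_average S G n) (ergodic_average S F n)"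
        by (intro L2_norm_triangle_diff L2_space_average F G)
      also have "L2_dist M (ergodic_average S G n) (ergodic_average S F n) = L2_dist M (ergodic_average S F n) (ergodic_average S G n)"
        by (rule L2_norm_minus_commute)
      finally show "L2_dist M (ergodic_average S F m) (ergodic_average S F n) \<le> e"
        using N1[of m] N1[of n] N2[of m n] mn by simp
    qed
  qed
  show ?thesis
    by (rule L2_complete[of "ergodic_average S F", OF L2_space_average[OF F] cauchy]) (use that in blast)+
qed

end

theorem corollary1p9:
  fixes M :: "'a::metric_space measure" and S :: "nat \<Rightarrow> 'a \<Rightarrow> 'a" and F :: "'a \<Rightarrow> complex"
  assumes "multiplicative_system M S"
    and "finitely_generated M S"
    and "F \<in> L2_space M"
  shows "\<exists>G \<in> L2_space M. (\<lambda>N. L2_dist M (ergodic_average S F N) G) \<longlonglongrightarrow> 0"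
proof -
  interpret multiplicative_system M S by (rule assms(1))
  show ?thesis by (rule average_converges[OF assms(2,3)]) blast
qed

end
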